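(* Let $\mathcal{E}$ be the group (under composition) of all interval exchange transformations of $[0,1)$. Suppose that $\mathcal{E}$ is equipped with a topology making it a topological group and such that for every $n \ge 1$ and every unpartitioned permutation $\pi \in \Sigma_n$, the coordinate map $\Gamma_\pi \colon \overline{\Lambda}_n \to \mathcal{E}$, $\Gamma_\pi(\lambda) = f_{(\pi,\lambda)}$, is continuous and its restriction $\Gamma_\pi|_{\Lambda_n}$ is a homeomorphism onto its image. Then a group homomorphism $\mathbb{R} \to \mathcal{E}$ is continuous if and only if it is a rotation action.
   Context: $\Sigma_n$ is the group of permutations of $\{1,\dots,n\}$; $\Lambda_n = \{\lambda = (\lambda_1,\dots,\lambda_n) \in \mathbb{R}^n : \lambda_i > 0,\ \sum_i \lambda_i = 1\}$, and $\overline{\Lambda}_n$ is its closure in $\mathbb{R}^n$ (allow $\lambda_i \ge 0$). For $\lambda \in \overline{\Lambda}_n$ put $\beta_j = \sum_{i=1}^{j} \lambda_i$ ($0 \le j \le n$) and $I_j = [\beta_{j-1}, \beta_j)$ (possibly empty if $\lambda_j = 0$). For $\pi \in \Sigma_n$ and $\lambda \in \overline{\Lambda}_n$ define $f_{(\pi,\lambda)} \colon [0,1) \to [0,1)$ by $f_{(\pi,\lambda)}(x) = x + \omega_j$ for $x \in I_j$, where $\omega_j = \sum_{i : \pi(i) < \pi(j)} \lambda_i - \sum_{i : i < j} \lambda_i$. An interval exchange transformation is a map of the form $f_{(\pi,\lambda)}$ for some $n \ge 1$, $\pi \in \Sigma_n$, $\lambda \in \Lambda_n$; these form a group $\mathcal{E}$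 under composition (and $f_{(\pi,\lambda)} \in \mathcal{E}$ also for $\lambda \in \overline{\Lambda}_n$). A permutation $\pi \in \Sigma_n$ is unpartitioned if $\pi(j+1) \ne \pi(j) + 1$ for all $1 \le j \le n-1$. Standard torus actions: identify $\mathbb{T}^n = \mathbb{R}^n/\mathbb{Z}^n$ with $[0,1)^n$. For $\lambda \in \Lambda_n$ and $\alpha = (\alpha_1,\dots,\alpha_n) \in \mathbb{T}^n$ (with $\alpha_j \in [0,1)$), let $f_{(\alpha,\lambda)} \in \mathcal{E}$ be the map with $f_{(\alpha,\lambda)}(x) = x + \lambda_j\alpha_j$ if $x \in [\beta_{j-1}, \beta_j - \lambda_j\alpha_j)$ and $f_{(\alpha,\lambda)}(x) = x + \lambda_j\alpha_j - \lambda_j$ if $x \in [\beta_j - \lambda_j\alpha_j, \beta_j)$, for $1 \le j \le n$. The homomorphism $\mathbb{T}^n \to \mathcal{E}$, $\alpha \mapsto f_{(\alpha,\lambda)}$, is the standard torus action associated to $\lambda$. A rotation action is a homomorphism $\mathbb{R} \to \mathcal{E}$, $t \mapsto f_t$, that is conjugate in $\mathcal{E}$ to a one-parameter subgroup of a standard torus action: there exist $n \ge 1$, $\lambda \in \Lambda_n$, $\alpha \in \mathbb{R}^n$ and $h \in \mathcal{E}$ with $f_t = h \circ f_{([t\alpha],\lambda)} \circ h^{-1}$ for all $t \in \mathbb{R}$, where $[t\alpha]$ is the class of $t\alpha$ in $\mathbb{T}^n$. $\mathbb{R}$ carries its usual topology. *)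

theory Defs
  imports "HOL-Analysis.Analysis" "HOL-Algebra.Bij" "HOL-Combinatorics.Permutations"
begin

section \<open>Interval exchange transformations\<close>

text \<open>
  Vectors in \<open>\<real>\<^sup>n\<close> are functions in \<open>{1..n} \<rightarrow>\<^sub>E UNIV\<close>, the carrier of the product topology
  \<open>powertop_real {1..n}\<close>; a permutation of \<open>{1..n}\<close> is a \<open>\<pi> :: nat \<Rightarrow> nat\<close> with \<open>\<pi> permutes {1..n}\<close>.
  Maps of \<open>[0,1)\<close> are functions on \<open>real\<close> that are \<open>undefined\<close> outside \<open>{0..<1}\<close>, as in
  \<^const>\<open>BijGroup\<close>.
\<close>

definition Lambda :: "nat \<Rightarrow> (nat \<Rightarrow> real) set" where
  "Lambda n = {l \<in> {1..n} \<rightarrow>\<^sub>E UNIV. (\<forall>i\<in>{1..n}. 0 < l i) \<and> (\<Sum>i=1..n. l i) = 1}"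

definition Lambda_closed :: "nat \<Rightarrow> (nat \<Rightarrow> real) set" where
  "Lambda_closed n = powertop_real {1..n} closure_of Lambda n"

definition breakpoint :: "(nat \<Rightarrow> real) \<Rightarrow> nat \<Rightarrow> real" where
  "breakpoint l j = (\<Sum>i=1..j. l i)"

definition piece :: "(nat \<Rightarrow> real) \<Rightarrow> nat \<Rightarrow> real set" where
  "piece l j = {breakpoint l (j - 1)..<breakpoint l j}"

definition shift :: "nat \<Rightarrow> (nat \<Rightarrow> nat) \<Rightarrow> (nat \<Rightarrow> real) \<Rightarrow> nat \<Rightarrow> real" where
  "shift n \<pi> l j =
     (\<Sum>i | i \<in> {1..n} \<and> \<pi> i < \<pi> j. l i) - (\<Sum>i | i \<in> {1..n} \<and> i < j. l i)"

definition interval_exchange :: "nat \<Rightarrow> (nat \<Rightarrow> nat) \<Rightarrow> (nat \<Rightarrow> real) \<Rightarrow> real \<Rightarrow> real" where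
  "interval_exchange n \<pi> l =
     (\<lambda>x\<in>{0..<1}. x + shift n \<pi> l (THE j. j \<in> {1..n} \<and> x \<in> piece l j))"

definition IET :: "(real \<Rightarrow> real) set" where
  "IET = {interval_exchange n \<pi> l | n \<pi> l. 1 \<le> n \<and> \<pi> permutes {1..n} \<and> l \<in> Lambda n}"

definition IET_group :: "(real \<Rightarrow> real) monoid" where
  "IET_group = (BijGroup {0..<1})\<lparr>carrier := IET\<rparr>"

definition unpartitioned :: "nat \<Rightarrow> (nat \<Rightarrow> nat) \<Rightarrow> bool" where
  "unpartitioned n \<pi> \<longleftrightarrow> \<pi> permutes {1..n} \<and> (\<forall>j\<in>{1..<n}. \<pi> (j + 1) \<noteq> \<pi> j + 1)"


section \<open>Rotation actions\<close>

text \<open>The torus \<open>\<real>\<^sup>n/\<int>\<^sup>n\<close> is identified with \<open>[0,1)\<^sup>n\<close>; the class of a vector is its vector of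
  fractional parts.\<close>

definition torus_class :: "nat \<Rightarrow> (nat \<Rightarrow> real) \<Rightarrow> nat \<Rightarrow> real" where
  "torus_class n a = (\<lambda>j\<in>{1..n}. frac (a j))"

definition torus_exchange :: "nat \<Rightarrow> (nat \<Rightarrow> real) \<Rightarrow> (nat \<Rightarrow> real) \<Rightarrow> real \<Rightarrow> real" where
  "torus_exchange n a l =
     (\<lambda>x\<in>{0..<1}. let j = (THE j. j \<in> {1..n} \<and> x \<in> piece l j) in
        if x < breakpoint l j - l j * a j then x + l j * a j else x + l j * a j - l j)"

definition real_group :: "real monoid" where
  "real_group = \<lparr>carrier = UNIV, mult = (+), one = 0\<rparr>"

definition rotation_action :: "(real \<Rightarrow> real \<Rightarrow> real) \<Rightarrow> bool" where
  "rotation_action F \<longleftrightarrow> F \<in> hom real_group IET_group \<and>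
     (\<exists>n l a h. 1 \<le> n \<and> l \<in> Lambda n \<and> a \<in> ({1..n} \<rightarrow>\<^sub>E UNIV) \<and> h \<in> IET \<and>
        (\<forall>t. F t = h \<otimes>\<^bsub>IET_group\<^esub> torus_exchange n (torus_class n (\<lambda>j. t * a j)) l
                     \<otimes>\<^bsub>IET_group\<^esub> inv\<^bsub>IET_group\<^esub> h))"


section \<open>Topological groups\<close>

definition topological_group :: "('a, 'b) monoid_scheme \<Rightarrow> 'a topology \<Rightarrow> bool" where
  "topological_group G T \<longleftrightarrow> group G \<and> topspace T = carrier G \<and>
     continuous_map (prod_topology T T) T (\<lambda>(x, y). x \<otimes>\<^bsub>G\<^esub> y) \<and>
     continuous_map T T (\<lambda>x. inv\<^bsub>G\<^esub> x)"


section \<open>The interval exchange transformations form a group\<close>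

lemma Lambda_closed_eq:
  assumes "1 \<le> n"
  shows "Lambda_closed n =
    {l \<in> {1..n} \<rightarrow>\<^sub>E UNIV. (\<forall>i\<in>{1..n}. 0 \<le> l i) \<and> (\<Sum>i=1..n. l i) = 1}" (is "_ = ?R")
proof
  let ?T = "powertop_real {1..n}"
  have cp: "continuous_map ?T euclideanreal (\<lambda>l. l i)" if "i \<in> {1..n}" for i
    using that by (rule continuous_map_product_projection)
  have cs: "continuous_map ?T euclideanreal (\<lambda>l. \<Sum>i=1..n. l i)"
    by (intro continuous_map_sum cp) auto
  have eq: "?R = topspace ?T \<inter> (\<Inter>i\<in>{1..n}. {l \<in> topspace ?T. l i \<in> {0..}})
      \<inter> {l \<in> topspace ?T. (\<Sum>i=1..n. l i) \<in> {1}}" by auto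
  have "closedin ?T {l \<in> topspace ?T. l i \<in> {0..}}" if "i \<in> {1..n}" for i
    by (rule closedin_continuous_map_preimage[OF cp[OF that]]) simp
  moreover have "closedin ?T {l \<in> topspace ?T. (\<Sum>i=1..n. l i) \<in> {1}}"
    by (rule closedin_continuous_map_preimage[OF cs]) simp
  ultimately have "closedin ?T ?R" unfolding eq
    by (intro closedin_Int closedin_INT closedin_topspace) (use assms in auto)
  moreover have "Lambda n \<subseteq> ?R" by (auto simp: Lambda_def less_imp_le)
  ultimately show "Lambda_closed n \<subseteq> ?R" 
    unfolding Lambda_closed_def by (simp add: closure_of_minimal)
  show "?R \<subseteq> Lambda_closed n"
  proof
    fix l assume l: "l \<in> ?R"
    define g where "g = (\<lambda>(t::real). \<lambda>i\<in>{1..n}. (1 - t) * l i + t * (1 / real n))"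
    have cg: "continuous_map (top_of_set {0..1}) ?T g"
      unfolding continuous_map_componentwise g_def
      by (auto simp: continuous_map_iff_continuous intro!: continuous_intros)
    have gL: "g t \<in> Lambda n" if "t \<in> {0<..1}" for t
    proof -
      have "(\<Sum>i=1..n. g t i) = (1 - t) * (\<Sum>i=1..n. l i) + t"
        using assms by (simp add: g_def sum.distrib flip: sum_distrib_left)
      moreover have "0 < g t i" if "i \<in> {1..n}" for i
        using l that \<open>t \<in> {0<..1}\<close> assms by (auto simp: g_def intro!: add_nonneg_pos mult_nonneg_nonneg)
      ultimately show ?thesis using l by (auto simp: Lambda_def g_def)
    qed
    have "{0..1::real} \<inter> {0<..1} = {0<..1}" by auto
    then have "0 \<in> top_of_set {0..1::real} closure_of {0<..1}"
      by (simp add: closure_of_subtopology)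
    then have "g 0 \<in> ?T closure_of (g ` {0<..1})"
      using cg continuous_map_image_closure_subset by blast
    also have "\<dots> \<subseteq> ?T closure_of Lambda n" using gL by (intro closure_of_mono) auto
    also have "g 0 = l" using l by (auto simp: g_def fun_eq_iff PiE_def extensional_def)
    finally show "l \<in> Lambda_closed n" by (simp add: Lambda_closed_def)
  qed
qed

lemma breakpoint_mono:
  assumes "\<forall>i\<in>{1..n}. 0 \<le> l i" "i \<le> j" "j \<le> n"
  shows "breakpoint l i \<le> breakpoint l j"
  unfolding breakpoint_def using assms by (intro sum_mono2) auto

lemma breakpoint_step:
  assumes "1 \<le> j" shows "breakpoint l j = breakpoint l (j - 1) + l j"
  using assms by (cases j) (auto simp: breakpoint_def)

lemma piece_inj:
  assumes "\<forall>i\<in>{1..n}. 0 \<le> l i" "j \<in> {1..n}" "k \<in> {1..n}" "x \<in> piece l j" "x \<in> piece l k"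
  shows "j = k"
proof (rule ccontr)
  assume "j \<noteq> k"
  then have "j \<le> k - 1 \<or> k \<le> j - 1" by auto
  then show False
  proof
    assume "j \<le> k - 1"
    then have "breakpoint l j \<le> breakpoint l (k - 1)" using assms by (intro breakpoint_mono) auto
    then show False using assms by (auto simp: piece_def)
  next
    assume "k \<le> j - 1"
    then have "breakpoint l k \<le> breakpoint l (j - 1)" using assms by (intro breakpoint_mono) auto
    then show False using assms by (auto simp: piece_def)
  qed
qed

lemma piece_exists:
  assumes "breakpoint l n = 1" "x \<in> {0..<1}"
  obtains j where "j \<in> {1..n}" "x \<in> piece l j"
proof -
  define j where "j = (LEAST j. x < breakpoint l j)"
  have 1: "x < breakpoint l j" unfolding j_def by (rule LeastI[of _ n]) (use assms in auto)
  have 2: "j \<le> n" unfolding j_def by (rule Least_le) (use assms in auto)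
  have 3: "j \<noteq> 0" by (rule notI) (use 1 assms in \<open>simp add: breakpoint_def\<close>)
  then have "\<not> x < breakpoint l (j - 1)" unfolding j_def by (intro not_less_Least) auto
  then show ?thesis using 1 2 3 that[of j] by (auto simp: piece_def)
qed

lemma piece_subset:
  assumes "\<forall>i\<in>{1..n}. 0 \<le> l i" "breakpoint l n = 1" "j \<in> {1..n}"
  shows "piece l j \<subseteq> {0..<1}"
proof -
  have "breakpoint l 0 \<le> breakpoint l (j - 1)" "breakpoint l j \<le> breakpoint l n"
    by (rule breakpoint_mono[OF assms(1)]; use assms(3) in auto)+
  then show ?thesis using assms by (auto simp: piece_def breakpoint_def)
qed

lemma THE_piece:
  assumes "\<forall>i\<in>{1..n}. 0 \<le> l i" "j \<in> {1..n}" "x \<in> piece l j"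
  shows "(THE j. j \<in> {1..n} \<and> x \<in> piece l j) = j"
  using assms piece_inj by (intro the_equality) blast+

lemma interval_exchange_eq:
  assumes "\<forall>i\<in>{1..n}. 0 \<le> l i" "breakpoint l n = 1" "j \<in> {1..n}" "x \<in> piece l j"
  shows "interval_exchange n \<pi> l x = x + shift n \<pi> l j"
proof -
  have "x \<in> {0..<1}" using piece_subset assms by blast
  then show ?thesis unfolding interval_exchange_def using THE_piece[OF assms(1,3,4)] by simp
qed

lemma shift_eq:
  assumes "\<pi> permutes {1..n}" "j \<in> {1..n}"
  shows "shift n \<pi> l j = breakpoint (l \<circ> inv_into UNIV \<pi>) (\<pi> j - 1) - breakpoint l (j - 1)"
proof -
  have pj: "\<pi> j \<in> {1..n}" using assms(2) permutes_in_image[OF assms(1), of j] by simp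
  let ?S = "{i. i \<in> {1..n} \<and> \<pi> i < \<pi> j}"
  have "bij_betw \<pi> ?S {1..\<pi> j - 1}"
  proof (rule bij_betw_imageI)
    show "inj_on \<pi> ?S" by (rule inj_on_subset[OF permutes_inj[OF assms(1)]]) simp
    show "\<pi> ` ?S = {1..\<pi> j - 1}"
    proof (intro subset_antisym subsetI)
      fix k assume "k \<in> \<pi> ` ?S"
      then obtain i where i: "i \<in> {1..n}" "\<pi> i < \<pi> j" "k = \<pi> i" by auto
      then have "1 \<le> \<pi> i" using permutes_in_image[OF assms(1), of i] by simp
      then show "k \<in> {1..\<pi> j - 1}" using i by auto
    next
      fix k assume k: "k \<in> {1..\<pi> j - 1}"
      then have "k \<in> {1..n}" using pj by auto
      then have "inv_into UNIV \<pi> k \<in> {1..n}"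
        using permutes_in_image[OF permutes_inv[OF assms(1)], of k] by simp
      moreover have *: "k = \<pi> (inv_into UNIV \<pi> k)" by (simp add: permutes_inverses[OF assms(1)])
      moreover have "k < \<pi> j" using k by auto
      ultimately have "inv_into UNIV \<pi> k \<in> ?S" by simp
      moreover note *
      ultimately show "k \<in> \<pi> ` ?S" by (rule rev_image_eqI)
    qed
  qed
  from sum.reindex_bij_betw[OF this, of "l \<circ> inv_into UNIV \<pi>"]
  have "(\<Sum>i | i \<in> {1..n} \<and> \<pi> i < \<pi> j. l i) = (\<Sum>k\<in>{1..\<pi> j - 1}. (l \<circ> inv_into UNIV \<pi>) k)"
    by (simp add: permutes_inverses[OF assms(1)])
  moreover have "{i. i \<in> {1..n} \<and> i < j} = {1..j - 1}" using assms by auto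
  ultimately show ?thesis by (simp add: shift_def breakpoint_def)
qed

lemma interval_exchange_piece:
  assumes "\<pi> permutes {1..n}" "\<forall>i\<in>{1..n}. 0 \<le> l i" "breakpoint l n = 1" "j \<in> {1..n}"
  shows "x \<in> piece l j \<longleftrightarrow> x + shift n \<pi> l j \<in> piece (l \<circ> inv_into UNIV \<pi>) (\<pi> j)"
proof -
  have "1 \<le> \<pi> j" using assms permutes_in_image[OF assms(1), of j] by simp
  then have "breakpoint (l \<circ> inv_into UNIV \<pi>) (\<pi> j) = breakpoint (l \<circ> inv_into UNIV \<pi>) (\<pi> j - 1) + l j"
    by (subst breakpoint_step) (auto simp: permutes_inverses[OF assms(1)])
  moreover have "breakpoint l j = breakpoint l (j - 1) + l j"
    using assms by (intro breakpoint_step) auto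
  ultimately show ?thesis using shift_eq[OF assms(1,4), of l] by (auto simp: piece_def)
qed

lemma interval_exchange_Bij:
  assumes "\<pi> permutes {1..n}" "\<forall>i\<in>{1..n}. 0 \<le> l i" "breakpoint l n = 1"
  shows "interval_exchange n \<pi> l \<in> Bij {0..<1}"
proof -
  let ?f = "interval_exchange n \<pi> l" and ?m = "l \<circ> inv_into UNIV \<pi>"
  have invp: "inv_into UNIV \<pi> permutes {1..n}" by (rule permutes_inv[OF assms(1)])
  have mpos: "\<forall>i\<in>{1..n}. 0 \<le> ?m i" using assms permutes_in_image[OF invp] by simp
  have m1: "breakpoint ?m n = 1"
    using assms(3) sum.permute[OF invp, of l] by (simp add: breakpoint_def)
  have in_piece: "?f x \<in> piece ?m (\<pi> j)" if "j \<in> {1..n}" "x \<in> piece l j" for x j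
    using interval_exchange_piece[OF assms that(1), of x] that(2)
    unfolding interval_exchange_eq[OF assms(2,3) that] by (rule iffD1)
  have pn: "\<pi> j \<in> {1..n}" if "j \<in> {1..n}" for j
    using that permutes_in_image[OF assms(1), of j] by simp
  have "inj_on ?f {0..<1}"
  proof (rule inj_onI)
    fix x y :: real assume "x \<in> {0..<1}" "y \<in> {0..<1}" and eq: "?f x = ?f y"
    then obtain j k where j: "j \<in> {1..n}" "x \<in> piece l j" and k: "k \<in> {1..n}" "y \<in> piece l k"
      using piece_exists[OF assms(3)] by metis
    have "\<pi> j = \<pi> k" using piece_inj[OF mpos pn[OF j(1)] pn[OF k(1)] in_piece[OF j]] in_piece[OF k] eq by simp
    then have "j = k" by (rule injD[OF permutes_inj[OF assms(1)]])
    then show "x = y"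
      using eq interval_exchange_eq[OF assms(2,3) j] interval_exchange_eq[OF assms(2,3) k] by simp
  qed
  moreover have "?f ` {0..<1} = {0..<1}"
  proof (intro subset_antisym subsetI)
    fix y assume "y \<in> ?f ` {0..<1}"
    then obtain x where x: "x \<in> {0..<1}" "y = ?f x" by blast
    then obtain j where j: "j \<in> {1..n}" "x \<in> piece l j"
      using piece_exists[OF assms(3)] by metis
    show "y \<in> {0..<1}" using in_piece[OF j] piece_subset[OF mpos m1 pn[OF j(1)]] x by auto
  next
    fix y :: real assume "y \<in> {0..<1}"
    then obtain k where k: "k \<in> {1..n}" "y \<in> piece ?m k" using piece_exists[OF m1] by metis
    define j where "j = inv_into UNIV \<pi> k"
    have j: "j \<in> {1..n}" "\<pi> j = k"
      using k permutes_in_image[OF invp] by (auto simp: j_def permutes_inverses[OF assms(1)])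
    have x: "y - shift n \<pi> l j \<in> piece l j"
      using interval_exchange_piece[OF assms j(1), of "y - shift n \<pi> l j"] k j by simp
    then have "?f (y - shift n \<pi> l j) = y"
      using interval_exchange_eq[OF assms(2,3) j(1) x, of \<pi>] by simp
    then show "y \<in> ?f ` {0..<1}" using piece_subset[OF assms(2,3) j(1)] x by (metis image_eqI subsetD)
  qed
  ultimately show ?thesis by (auto simp: Bij_def bij_betw_def interval_exchange_def)
qed

text \<open>Membership in \<^const>\<open>IET\<close> amounts to being a bijection that is a translation between any two
  points not separated by some finite set.\<close>

definition piecewise_translation :: "(real \<Rightarrow> real) \<Rightarrow> bool" where
  "piecewise_translation f \<longleftrightarrow> (\<exists>B. finite B \<and>
     (\<forall>x\<in>{0..<1}. \<forall>y\<in>{0..<1}. x \<le> y \<longrightarrow> B \<inter> {x<..y} = {} \<longrightarrow> f y - f x = y - x))"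

lemma interval_exchange_piecewise:
  assumes "\<forall>i\<in>{1..n}. 0 \<le> l i" "breakpoint l n = 1"
  shows "piecewise_translation (interval_exchange n \<pi> l)"
  unfolding piecewise_translation_def
proof (intro exI[of _ "breakpoint l ` {0..n}"] conjI ballI impI)
  fix x y :: real assume xy: "x \<in> {0..<1}" "y \<in> {0..<1}" "x \<le> y"
    and B: "breakpoint l ` {0..n} \<inter> {x<..y} = {}"
  obtain j where j: "j \<in> {1..n}" "x \<in> piece l j" using piece_exists[OF assms(2) xy(1)] .
  have "breakpoint l j \<notin> {x<..y}" using B j(1) by force
  then have "y \<in> piece l j" using j xy by (auto simp: piece_def)
  then show "interval_exchange n \<pi> l y - interval_exchange n \<pi> l x = y - x"
    using interval_exchange_eq[OF assms j, of \<pi>] interval_exchange_eq[OF assms j(1), of y \<pi>] by simp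
qed simp

lemma piecewise_translation_IET:
  assumes f: "f \<in> Bij {0..<1}" and pw: "piecewise_translation f"
  shows "f \<in> IET"
proof -
  obtain B0 where B0: "finite B0" "\<And>x y. \<lbrakk>x \<in> {0..<1}; y \<in> {0..<1}; x \<le> y; B0 \<inter> {x<..y} = {}\<rbrakk> \<Longrightarrow> f y - f x = y - x"
    using pw unfolding piecewise_translation_def by blast
  have inj: "inj_on f {0..<1}" and im: "f ` {0..<1} = {0..<1}" and ext: "f \<in> extensional {0..<1}"
    using f by (auto simp: Bij_def bij_betw_def)
  define B where "B = insert 0 (B0 \<inter> {0..<1})"
  define xs where "xs = sorted_list_of_set B"
  define n where "n = length xs"
  have finB: "finite B" using B0 by (simp add: B_def)
  have setxs: "set xs = B" and sxs: "sorted_wrt (<) xs" using finB by (auto simp: xs_def)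
  have n1: "1 \<le> n" using setxs unfolding n_def B_def by (cases xs) auto
  define b where "b = (\<lambda>j. if j < n then xs ! j else 1)"
  have bB: "b j \<in> B" if "j < n" for j using that setxs by (auto simp: b_def n_def)
  have b01: "b j \<in> {0..<1}" if "j < n" for j using bB[OF that] by (auto simp: B_def)
  have bn: "b n = 1" by (simp add: b_def)
  have bless: "b i < b j" if "i < j" "j \<le> n" for i j
  proof (cases "j < n")
    case True then show ?thesis using that sxs by (auto simp: b_def n_def sorted_wrt_iff_nth_less)
  next
    case False then show ?thesis using that b01[of i] bn by auto
  qed
  have b0: "b 0 = 0"
  proof -
    obtain k where k: "k < n" "b k = 0"
      using setxs by (metis B_def b_def in_set_conv_nth insertI1 n_def)
    show ?thesis
    proof (cases "k = 0")
      case False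
      then show ?thesis using bless[of 0 k] k b01[of 0] by auto
    qed (use k in simp)
  qed
  define l where "l = (\<lambda>j\<in>{1..n}. b j - b (j - 1))"
  have bp: "breakpoint l j = b j" if "j \<le> n" for j using that
  proof (induction j)
    case 0 then show ?case by (simp add: b0 breakpoint_def)
  next
    case (Suc j)
    then have "l (Suc j) = b (Suc j) - b j" by (simp add: l_def)
    then show ?case using Suc breakpoint_step[of "Suc j" l] by simp
  qed
  have lpos: "\<forall>i\<in>{1..n}. 0 < l i" using bless by (auto simp: l_def)
  then have lnn: "\<forall>i\<in>{1..n}. 0 \<le> l i" by (auto intro: less_imp_le)
  have l1: "breakpoint l n = 1" using bp bn by simp
  have lL: "l \<in> Lambda n" using lpos l1 by (auto simp: Lambda_def breakpoint_def l_def)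
  have pc: "piece l j = {b (j - 1)..<b j}" if "j \<in> {1..n}" for j
    using that bp[of j] bp[of "j - 1"] by (auto simp: piece_def)
  define c where "c = (\<lambda>j. f (b (j - 1)))"
  have fc: "f x = c j + (x - b (j - 1))" if j: "j \<in> {1..n}" and x: "x \<in> piece l j" for j x
  proof -
    have "B0 \<inter> {b (j - 1)<..x} = {}"
    proof (rule ccontr)
      assume "\<not> ?thesis"
      then obtain z where z: "z \<in> B0" "b (j - 1) < z" "z \<le> x" by auto
      have xx: "x < b j" using x pc[OF j] by auto
      have "x < 1" "0 \<le> b (j - 1)" using piece_subset[OF lnn l1 j] x b01[of "j - 1"] j by auto
      then have "z \<in> set xs" using z setxs by (auto simp: B_def)
      then obtain k where k: "k < n" "z = b k" by (metis b_def in_set_conv_nth n_def)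
      have "\<not> k < j"
      proof
        assume "k < j"
        then have "k = j - 1 \<or> k < j - 1" by arith
        then have "b k \<le> b (j - 1)" using bless[of k "j - 1"] j by (auto intro: less_imp_le)
        then show False using z k by simp
      qed
      then have "b j \<le> b k" using bless[of j k] k by (cases "j = k") auto
      then show False using z k xx by auto
    qed
    moreover have "b (j - 1) \<in> {0..<1}" using j by (intro b01) auto
    moreover have "x \<in> {0..<1}" "b (j - 1) \<le> x" using piece_subset[OF lnn l1 j] x pc[OF j] by auto
    ultimately show ?thesis using B0(2)[of "b (j - 1)" x] by (simp add: c_def)
  qed
  have lj: "l j = b j - b (j - 1)" if "j \<in> {1..n}" for j using that by (simp add: l_def)
  define J where "J = (\<lambda>j. {c j..<c j + l j})"
  have J: "J j = f ` piece l j" if j: "j \<in> {1..n}" for j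
  proof -
    have "f ` piece l j = (\<lambda>x. (c j - b (j - 1)) + x) ` {b (j - 1)..<b j}"
      unfolding pc[OF j, symmetric] by (rule image_cong) (use fc[OF j] in auto)
    moreover have "J j = {c j..<b j + (c j - b (j - 1))}"
      by (simp add: J_def lj[OF j] algebra_simps)
    ultimately show ?thesis by simp
  qed
  have cJ: "c j \<in> J j" if "j \<in> {1..n}" for j using lpos that by (simp add: J_def)
  have Jdisj: "i = j" if ij: "i \<in> {1..n}" "j \<in> {1..n}" "y \<in> J i" "y \<in> J j" for i j y
  proof -
    obtain x where x: "x \<in> piece l i" "y = f x" using ij(3) unfolding J[OF ij(1)] by blast
    obtain x' where x': "x' \<in> piece l j" "y = f x'" using ij(4) unfolding J[OF ij(2)] by blast
    have "x \<in> {0..<1}" "x' \<in> {0..<1}"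
      using subsetD[OF piece_subset[OF lnn l1 ij(1)] x(1)]
        subsetD[OF piece_subset[OF lnn l1 ij(2)] x'(1)] .
    then have "x = x'" using inj_onD[OF inj, of x x'] x(2) x'(2) by simp
    then show ?thesis using piece_inj[OF lnn ij(1,2) x(1)] x' by simp
  qed
  have Jcov: "\<exists>i\<in>{1..n}. y \<in> J i" if y: "y \<in> {0..<1}" for y
  proof -
    have "y \<in> f ` {0..<1}" using y by (simp only: im)
    then obtain x where x: "x \<in> {0..<1}" "y = f x" by blast
    obtain j where j: "j \<in> {1..n}" "x \<in> piece l j" using piece_exists[OF l1 x(1)] .
    then have "y \<in> J j" unfolding J[OF j(1)] x(2) by blast
    then show ?thesis using j(1) by blast
  qed
  have Jsub: "J j \<subseteq> {0..<1}" if "j \<in> {1..n}" for j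
    using J[OF that] piece_subset[OF lnn l1 that] im by blast
  have sumc: "(\<Sum>i | i \<in> {1..n} \<and> c i < c j. l i) = c j" if j: "j \<in> {1..n}" for j
  proof -
    let ?I = "{i. i \<in> {1..n} \<and> c i < c j}"
    have "(\<Union>i\<in>?I. J i) = {0..<c j}"
    proof (intro subset_antisym subsetI)
      fix y assume "y \<in> (\<Union>i\<in>?I. J i)"
      then obtain i where i: "i \<in> {1..n}" "c i < c j" "y \<in> J i" by auto
      have "y < c j"
      proof (rule ccontr)
        assume "\<not> y < c j"
        then have "c j \<in> J i" using i by (auto simp: J_def)
        then show False using Jdisj[OF i(1) j _ cJ[OF j]] i by auto
      qed
      then show "y \<in> {0..<c j}" using Jsub[OF i(1)] i by auto
    next
      fix y assume y: "y \<in> {0..<c j}"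
      moreover have "c j < 1" using Jsub[OF j] cJ[OF j] by auto
      ultimately obtain i where "i \<in> {1..n}" "y \<in> J i" using Jcov[of y] by auto
      then show "y \<in> (\<Union>i\<in>?I. J i)" using y by (auto simp: J_def intro!: exI[of _ i])
    qed
    moreover have "measure lborel (\<Union>i\<in>?I. J i) = (\<Sum>i\<in>?I. measure lborel (J i))"
    proof (rule measure_finite_Union)
      show "disjoint_family_on J ?I" using Jdisj by (auto simp: disjoint_family_on_def)
    qed (use lnn in \<open>auto simp: J_def\<close>)
    moreover have "(\<Sum>i\<in>?I. measure lborel (J i)) = (\<Sum>i\<in>?I. l i)"
      using lnn by (intro sum.cong) (auto simp: J_def)
    moreover have "0 \<le> c j" using Jsub[OF j] cJ[OF j] by auto
    ultimately show ?thesis by simp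
  qed
  define \<pi> where "\<pi> = (\<lambda>j. if j \<in> {1..n} then card {i \<in> {1..n}. c i \<le> c j} else j)"
  have pi_less: "\<pi> i < \<pi> j" if "i \<in> {1..n}" "j \<in> {1..n}" "c i < c j" for i j
  proof -
    have "{k \<in> {1..n}. c k \<le> c i} \<subset> {k \<in> {1..n}. c k \<le> c j}"
    proof (rule psubsetI)
      show "{k \<in> {1..n}. c k \<le> c i} \<subseteq> {k \<in> {1..n}. c k \<le> c j}" using that by auto
      have "j \<in> {k \<in> {1..n}. c k \<le> c j}" "j \<notin> {k \<in> {1..n}. c k \<le> c i}" using that by auto
      then show "{k \<in> {1..n}. c k \<le> c i} \<noteq> {k \<in> {1..n}. c k \<le> c j}" by (metis (no_types))
    qed
    then have "card {k \<in> {1..n}. c k \<le> c i} < card {k \<in> {1..n}. c k \<le> c j}"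
      by (intro psubset_card_mono) simp_all
    then show ?thesis unfolding \<pi>_def if_P[OF that(1)] if_P[OF that(2)] .
  qed
  have cinj: "i = j" if "i \<in> {1..n}" "j \<in> {1..n}" "c i = c j" for i j
    using Jdisj[OF that(1,2) cJ[OF that(1)]] cJ[OF that(2)] that by simp
  have pi_less_iff: "\<pi> i < \<pi> j \<longleftrightarrow> c i < c j" if "i \<in> {1..n}" "j \<in> {1..n}" for i j
    using pi_less[OF that] pi_less[OF that(2,1)] cinj[OF that] by (cases "c i" "c j" rule: linorder_cases) auto
  have perm: "\<pi> permutes {1..n}"
  proof -
    have injp: "inj_on \<pi> {1..n}"
    proof (rule inj_onI)
      fix i j assume ij: "i \<in> {1..n}" "j \<in> {1..n}" "\<pi> i = \<pi> j"
      have "\<not> c i < c j" "\<not> c j < c i"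
        using pi_less_iff[OF ij(1,2)] pi_less_iff[OF ij(2,1)] ij(3) by simp_all
      then show "i = j" using cinj[OF ij(1,2)] by simp
    qed
    moreover have "\<pi> ` {1..n} \<subseteq> {1..n}"
    proof clarify
      fix j assume j: "j \<in> {1..n}"
      have "card {i \<in> {1..n}. c i \<le> c j} \<le> card {1..n}" by (intro card_mono) auto
      moreover have "card {i \<in> {1..n}. c i \<le> c j} > 0" using j by (subst card_gt_0_iff) auto
      ultimately show "\<pi> j \<in> {1..n}" using j by (simp add: \<pi>_def)
    qed
    ultimately have "bij_betw \<pi> {1..n} {1..n}"
      unfolding bij_betw_def by (intro conjI endo_inj_surj) simp_all
    then show ?thesis by (rule bij_imp_permutes) (simp only: \<pi>_def if_False)
  qed
  have "f = interval_exchange n \<pi> l"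
  proof
    fix x show "f x = interval_exchange n \<pi> l x"
    proof (cases "x \<in> {0..<1}")
      case True
      then obtain j where j: "j \<in> {1..n}" "x \<in> piece l j" using piece_exists[OF l1] by metis
      have "{i. i \<in> {1..n} \<and> \<pi> i < \<pi> j} = {i. i \<in> {1..n} \<and> c i < c j}"
        by (intro Collect_cong conj_cong refl pi_less_iff j(1))
      moreover have "{i. i \<in> {1..n} \<and> i < j} = {1..j - 1}" using j by auto
      moreover have "j - 1 \<le> n" using j(1) by auto
      ultimately have "shift n \<pi> l j = c j - b (j - 1)"
        using sumc[OF j(1)] bp[of "j - 1"] by (simp add: shift_def breakpoint_def)
      then show ?thesis using interval_exchange_eq[OF lnn l1 j, of \<pi>] fc[OF j] by simp
    next
      case False
      then show ?thesis using ext by (auto simp: interval_exchange_def extensional_def)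
    qed
  qed
  then show ?thesis using perm lL n1 unfolding IET_def by blast
qed

lemma IET_iff: "f \<in> IET \<longleftrightarrow> f \<in> Bij {0..<1} \<and> piecewise_translation f"
proof
  assume "f \<in> IET"
  then obtain n \<pi> l where *: "f = interval_exchange n \<pi> l" "\<pi> permutes {1..n}" "l \<in> Lambda n"
    unfolding IET_def by blast
  have "\<forall>i\<in>{1..n}. 0 \<le> l i" "breakpoint l n = 1"
    using *(3) by (auto simp: Lambda_def breakpoint_def less_imp_le)
  then show "f \<in> Bij {0..<1} \<and> piecewise_translation f"
    using * interval_exchange_Bij interval_exchange_piecewise by simp
qed (use piecewise_translation_IET in blast)

lemma interval_exchange_closed_in_IET:
  assumes "1 \<le> n" "\<pi> permutes {1..n}" "l \<in> Lambda_closed n"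
  shows "interval_exchange n \<pi> l \<in> IET"
  using assms interval_exchange_Bij[of \<pi> n l] interval_exchange_piecewise[of n l \<pi>]
  by (simp add: IET_iff Lambda_closed_eq breakpoint_def)

lemma torus_exchange_in_IET:
  assumes "l \<in> Lambda n" "\<forall>j\<in>{1..n}. a j \<in> {0..<1}"
  shows "torus_exchange n a l \<in> IET"
proof -
  let ?f = "torus_exchange n a l"
  define d where "d = (\<lambda>j. l j * a j)"
  have lpos: "\<forall>i\<in>{1..n}. 0 < l i" and l1: "breakpoint l n = 1"
    using assms(1) by (auto simp: Lambda_def breakpoint_def)
  then have lnn: "\<forall>i\<in>{1..n}. 0 \<le> l i" by (auto intro: less_imp_le)
  have d: "0 \<le> d j" "d j < l j" if "j \<in> {1..n}" for j
    using bspec[OF assms(2) that] bspec[OF lpos that] by (simp_all add: d_def)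
  have pc: "piece l j = {breakpoint l (j - 1)..<breakpoint l (j - 1) + l j}"
    and bs: "breakpoint l j = breakpoint l (j - 1) + l j" if "j \<in> {1..n}" for j
    using that breakpoint_step[of j l] by (auto simp: piece_def)
  have f: "?f x = (if x < breakpoint l j - d j then x + d j else x + d j - l j)"
    if "j \<in> {1..n}" "x \<in> piece l j" for j x
    using piece_subset[OF lnn l1 that(1)] THE_piece[OF lnn that] that
    by (auto simp: torus_exchange_def d_def Let_def)
  have fp: "?f x \<in> piece l j" if "j \<in> {1..n}" "x \<in> piece l j" for j x
    unfolding f[OF that] using that(2) d[OF that(1)] bs[OF that(1)]
    unfolding pc[OF that(1)] by auto
  have "inj_on ?f {0..<1}"
  proof (rule inj_onI)
    fix x y :: real assume "x \<in> {0..<1}" "y \<in> {0..<1}" and eq: "?f x = ?f y"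
    then obtain j k where j: "j \<in> {1..n}" "x \<in> piece l j" and k: "k \<in> {1..n}" "y \<in> piece l k"
      using piece_exists[OF l1] by metis
    have "j = k" using piece_inj[OF lnn j(1) k(1) fp[OF j]] fp[OF k] eq by simp
    then show "x = y" using eq f[OF j] f[OF k] j k d[OF j(1)] bs[OF j(1)]
      unfolding pc[OF j(1)] pc[OF k(1)] by (auto split: if_splits)
  qed
  moreover have "?f ` {0..<1} = {0..<1}"
  proof (intro subset_antisym subsetI)
    fix y assume "y \<in> ?f ` {0..<1}"
    then obtain x where x: "x \<in> {0..<1}" "y = ?f x" by blast
    obtain j where j: "j \<in> {1..n}" "x \<in> piece l j" using piece_exists[OF l1 x(1)] .
    show "y \<in> {0..<1}" using fp[OF j] piece_subset[OF lnn l1 j(1)] x by auto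
  next
    fix y :: real assume "y \<in> {0..<1}"
    then obtain j where j: "j \<in> {1..n}" "y \<in> piece l j" using piece_exists[OF l1] by metis
    define x where "x = (if breakpoint l (j - 1) \<le> y - d j then y - d j else y - d j + l j)"
    have x: "x \<in> piece l j" using j(2) d[OF j(1)] unfolding pc[OF j(1)] x_def by auto
    have "?f x = y" unfolding f[OF j(1) x] using j(2) d[OF j(1)] bs[OF j(1)]
      unfolding pc[OF j(1)] x_def by auto
    then show "y \<in> ?f ` {0..<1}" using x piece_subset[OF lnn l1 j(1)] by (metis image_eqI subsetD)
  qed
  ultimately have "?f \<in> Bij {0..<1}" by (auto simp: Bij_def bij_betw_def torus_exchange_def)
  moreover have "piecewise_translation ?f"
    unfolding piecewise_translation_def
  proof (intro exI[of _ "breakpoint l ` {0..n} \<union> (\<lambda>j. breakpoint l j - d j) ` {1..n}"] conjI ballI impI)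
    fix x y :: real assume xy: "x \<in> {0..<1}" "y \<in> {0..<1}" "x \<le> y"
      and B: "(breakpoint l ` {0..n} \<union> (\<lambda>j. breakpoint l j - d j) ` {1..n}) \<inter> {x<..y} = {}"
    obtain j where j: "j \<in> {1..n}" "x \<in> piece l j" using piece_exists[OF l1 xy(1)] .
    have 1: "breakpoint l j \<notin> {x<..y}" using B j(1) by force
    have 2: "breakpoint l j - d j \<notin> {x<..y}" using B j(1) by blast
    have y: "y \<in> piece l j" using 1 j xy by (auto simp: piece_def)
    show "?f y - ?f x = y - x" unfolding f[OF j] f[OF j(1) y] using 2 xy by auto
  qed simp
  ultimately show ?thesis by (simp add: IET_iff)
qed

lemma IET_subgroup: "subgroup IET (BijGroup {0..<1})"
proof -
  interpret G: group "BijGroup {0..<1::real}" by (rule group_BijGroup)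
  have compose: "compose {0..<1} g f \<in> IET" if f: "f \<in> IET" and g: "g \<in> IET" for f g
  proof -
    have fB: "bij_betw f {0..<1} {0..<1}" using f by (auto simp: IET_iff Bij_def)
    have f01: "f x \<in> {0..<1}" if "x \<in> {0..<1}" for x using fB that by (rule bij_betwE[THEN bspec])
    obtain B where B: "finite B" "\<And>x y. \<lbrakk>x \<in> {0..<1}; y \<in> {0..<1}; x \<le> y; B \<inter> {x<..y} = {}\<rbrakk> \<Longrightarrow> f y - f x = y - x"
      using f unfolding IET_iff piecewise_translation_def by blast
    obtain C where C: "finite C" "\<And>x y. \<lbrakk>x \<in> {0..<1}; y \<in> {0..<1}; x \<le> y; C \<inter> {x<..y} = {}\<rbrakk> \<Longrightarrow> g y - g x = y - x"
      using g unfolding IET_iff piecewise_translation_def by blast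
    have "piecewise_translation (compose {0..<1} g f)"
      unfolding piecewise_translation_def
    proof (intro exI[of _ "B \<union> (f -` C \<inter> {0..<1})"] conjI ballI impI)
      show "finite (B \<union> (f -` C \<inter> {0..<1}))"
        using B C fB by (auto intro!: finite_vimage_IntI simp: bij_betw_def)
      fix x y :: real assume xy: "x \<in> {0..<1}" "y \<in> {0..<1}" "x \<le> y"
        and D: "(B \<union> (f -` C \<inter> {0..<1})) \<inter> {x<..y} = {}"
      have tr: "f z = f x + (z - x)" if "x \<le> z" "z \<le> y" for z
      proof -
        have "B \<inter> {x<..z} = {}" using D that by auto
        then show ?thesis using B(2)[of x z] that xy by auto
      qed
      have "C \<inter> {f x<..f y} = {}"
      proof (rule ccontr)
        assume "\<not> ?thesis"
        then obtain w where w: "w \<in> C" "f x < w" "w \<le> f y" by auto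
        define z where "z = x + (w - f x)"
        have "x < z" "z \<le> y" using w tr[of y] xy by (auto simp: z_def)
        moreover have "f z = w" using tr[of z] \<open>x < z\<close> \<open>z \<le> y\<close> by (simp add: z_def)
        ultimately show False using D w xy by auto
      qed
      then show "compose {0..<1} g f y - compose {0..<1} g f x = y - x"
        using C(2)[OF f01[OF xy(1)] f01[OF xy(2)]] tr[of y] xy by (simp add: compose_def)
    qed
    then show ?thesis using f g by (simp add: IET_iff compose_Bij)
  qed
  have inverse: "restrict (inv_into {0..<1} f) {0..<1} \<in> IET" if f: "f \<in> IET" for f
  proof -
    have fB: "bij_betw f {0..<1} {0..<1}" using f by (auto simp: IET_iff Bij_def)
    have f01: "f x \<in> {0..<1}" if "x \<in> {0..<1}" for x using fB that by (rule bij_betwE[THEN bspec])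
    have finj: "x = y" if "f x = f y" "x \<in> {0..<1}" "y \<in> {0..<1}" for x y
      using fB that by (auto simp: bij_betw_def dest: inj_onD)
    obtain B where B: "finite B" "\<And>x y. \<lbrakk>x \<in> {0..<1}; y \<in> {0..<1}; x \<le> y; B \<inter> {x<..y} = {}\<rbrakk> \<Longrightarrow> f y - f x = y - x"
      using f unfolding IET_iff piecewise_translation_def by blast
    let ?D = "insert 0 B \<inter> {0..<1}"
    let ?g = "inv_into {0..<1} f"
    have g01: "?g u \<in> {0..<1}" and fg: "f (?g u) = u" if "u \<in> {0..<1}" for u
      using that fB inv_into_into[of u f "{0..<1}"]
      by (simp_all add: bij_betw_def f_inv_into_f)
    have "piecewise_translation (restrict ?g {0..<1})"
      unfolding piecewise_translation_def
    proof (intro exI[of _ "f ` ?D"] conjI ballI impI)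
      show "finite (f ` ?D)" using B by auto
      fix u v :: real assume uv: "u \<in> {0..<1}" "v \<in> {0..<1}" "u \<le> v"
        and D: "f ` ?D \<inter> {u<..v} = {}"
      define x where "x = ?g u"
      have x: "x \<in> {0..<1}" "f x = u" using g01 fg uv by (auto simp: x_def)
      define b where "b = Min (insert 1 {z \<in> B. x < z})"
      have fin: "finite (insert 1 {z \<in> B. x < z})" using B by simp
      have b: "b \<in> insert 1 {z \<in> B. x < z}" unfolding b_def using fin by (intro Min_in) auto
      have bmin: "b \<le> z" if "z = 1 \<or> z \<in> B \<and> x < z" for z
        unfolding b_def using fin that by (intro Min_le) auto
      have xb: "x < b" "b \<le> 1" using b x bmin[of 1] by auto
      have tr: "f z = u + (z - x)" if "x \<le> z" "z < b" for z
      proof -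
        have "B \<inter> {x<..z} = {}" using bmin that by force
        then show ?thesis using B(2)[of x z] x xb that by auto
      qed
      have "v < u + (b - x)"
      proof (rule ccontr)
        assume neg: "\<not> ?thesis"
        define w where "w = u + (b - x)"
        have w: "w \<in> {0..<1}" "u < w" "w \<le> v" using neg uv xb by (auto simp: w_def)
        define z where "z = ?g w"
        have z: "z \<in> {0..<1}" "f z = w" using g01 fg w by (auto simp: z_def)
        have "f z \<in> {u<..v}" using z w by simp
        then have "z \<notin> ?D" using D by blast
        then have zD: "z \<noteq> 0" "z \<notin> B" using z by auto
        define m where "m = Max (insert 0 {a \<in> B. a < z})"
        have fin2: "finite (insert 0 {a \<in> B. a < z})" using B by simp
        have "m \<in> insert 0 {a \<in> B. a < z}" unfolding m_def using fin2 by (intro Max_in) auto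
        then have mz: "m < z" using z zD by auto
        have mmax: "a \<le> m" if "a = 0 \<or> a \<in> B \<and> a < z" for a
          unfolding m_def using fin2 that by (intro Max_ge) auto
        have m0: "0 \<le> m" using mmax by simp
        define e where "e = min (z - m) (b - x) / 2"
        have e: "0 < e" "e < z - m" "e < b - x" using mz xb by (auto simp: e_def min_def field_simps)
        have "a \<notin> {z - e<..z}" if "a \<in> B" for a
          using mmax[of a] e zD that by (cases "a < z"; cases "a = z") auto
        then have "B \<inter> {z - e<..z} = {}" by auto
        then have "f z - f (z - e) = e" using B(2)[of "z - e" z] z e m0 by auto
        moreover have "f (b - e) = u + (b - e - x)" using tr[of "b - e"] e by auto
        ultimately have "f (z - e) = f (b - e)" using z by (simp add: w_def)
        then have "z - e = b - e" using finj[of "z - e" "b - e"] z e m0 x xb by auto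
        then have "z = b" by simp
        then show False using b z zD by auto
      qed
      then have "f (x + (v - u)) = v" using tr[of "x + (v - u)"] uv by simp
      moreover have "x + (v - u) \<in> {0..<1}" using \<open>v < u + (b - x)\<close> x xb uv by auto
      ultimately have "?g v = x + (v - u)" using finj fg[OF uv(2)] g01[OF uv(2)] by metis
      then show "restrict ?g {0..<1} v - restrict ?g {0..<1} u = v - u" using uv by (simp add: x_def)
    qed
    then show ?thesis using f restrict_inv_into_Bij[of f "{0..<1}"] by (simp add: IET_iff)
  qed
  have sub: "IET \<subseteq> Bij {0..<1}" by (auto simp: IET_iff)
  have "(\<lambda>x\<in>{0..<1}. x) \<in> IET"
    by (auto simp: IET_iff id_Bij piecewise_translation_def intro!: exI[of _ "{}"])
  then show ?thesis
  proof (intro G.subgroupI)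
    fix f assume f: "f \<in> IET"
    have "inv\<^bsub>BijGroup {0..<1}\<^esub> f = restrict (inv_into {0..<1} f) {0..<1}"
      using f sub by (intro inv_BijGroup) auto
    then show "inv\<^bsub>BijGroup {0..<1}\<^esub> f \<in> IET" using inverse[OF f] by simp
  next
    fix f g assume "f \<in> IET" "g \<in> IET"
    then show "f \<otimes>\<^bsub>BijGroup {0..<1}\<^esub> g \<in> IET"
      using sub compose by (auto simp: BijGroup_def)
  qed (use sub in \<open>auto simp: BijGroup_def\<close>)
qed

lemma group_IET_group: "group IET_group"
  unfolding IET_group_def by (intro subgroup.subgroup_is_group IET_subgroup group_BijGroup)

end

theory Submission
  imports Defs
begin

text \<open>
  Suppose \<open>F\<close> is continuous. \<open>T\<close> is Hausdorff: otherwise some \<open>h \<noteq> 1\<close> is topologically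
  indistinguishable from \<open>1\<close>, so conjugating by \<open>h\<close> an exchange of two short adjacent intervals
  gives an indistinguishable element, namely the exchange of two other intervals of the same
  length; both have the same permutation, against the embedding of the open simplex. The images of
  the closed simplices are then compact, hence closed, and cover \<open>IET\<close>. By Baire, \<open>F\<close> runs on some
  open interval inside the image of a single simplex; taking it of minimal dimension and shrinking
  the interval, inside that of its open part, with lengths depending continuously on the time.
  Translating this interval to \<open>0\<close>, every piece of a fixed partition of \<open>[0,1)\<close> moves with constant
  speed for a short time, because the displacement is locally additive and continuous. Speeds are
  constant along orbits, as each \<open>F t\<close> is locally a translation. So a moving point runs to the end
  of its piece and re-enters at the left end point of a piece of the same speed; there are finitely
  many such points, so it is periodic, and following one orbit in each class for its period
  conjugates \<open>F\<close> to rotations of intervals.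

  Conversely, for small \<open>t \<ge> 0\<close> the torus action is a continuous path in a closed simplex, and a
  homomorphism continuous on a right neighbourhood of \<open>0\<close> is continuous.
\<close>

section \<open>Normal forms of interval exchanges\<close>

text \<open>Puts breakpoints in the form of the two sums in \<open>shift\<close>, so that one
  identity for lengths summed over a predicate settles breakpoints and shifts together.\<close>

lemma breakpoint_filter:
  assumes "j \<le> n"
  shows "breakpoint l j = (\<Sum>i | i \<in> {1..n} \<and> i \<le> j. l i)"
    "breakpoint l (j - 1) = (\<Sum>i | i \<in> {1..n} \<and> i < j. l i)"
proof -
  have "{i. i \<in> {1..n} \<and> i \<le> j} = {1..j}" "{i. i \<in> {1..n} \<and> i < j} = {1..j - 1}"
    using assms by auto
  then show "breakpoint l j = (\<Sum>i | i \<in> {1..n} \<and> i \<le> j. l i)"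
    "breakpoint l (j - 1) = (\<Sum>i | i \<in> {1..n} \<and> i < j. l i)"
    by (simp_all add: breakpoint_def)
qed

lemma Lambda_closedD:
  assumes "1 \<le> n" "l \<in> Lambda_closed n"
  shows "\<forall>i\<in>{1..n}. 0 \<le> l i" "breakpoint l n = 1" "l \<in> {1..n} \<rightarrow>\<^sub>E UNIV"
  using assms by (auto simp: Lambda_closed_eq breakpoint_def)

lemma Lambda_closedI:
  assumes "1 \<le> n" "\<And>i. i \<in> {1..n} \<Longrightarrow> 0 \<le> l i" "breakpoint l n = 1" "l \<in> {1..n} \<rightarrow>\<^sub>E UNIV"
  shows "l \<in> Lambda_closed n"
  using assms by (auto simp: Lambda_closed_eq breakpoint_def)

lemma Lambda_subset_closed: "1 \<le> n \<Longrightarrow> Lambda n \<subseteq> Lambda_closed n"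
  by (auto simp: Lambda_closed_eq Lambda_def less_imp_le)

text \<open>Compares exchanges with different numbers of pieces: it suffices that both translate
  each point by the same amount, without any bijection between the pieces.\<close>

lemma interval_exchange_eqI:
  assumes l: "\<forall>i\<in>{1..n}. 0 \<le> l i" "breakpoint l n = 1"
    and l': "\<forall>i\<in>{1..n'}. 0 \<le> l' i" "breakpoint l' n' = 1"
    and eq: "\<And>j x. \<lbrakk>j \<in> {1..n}; x \<in> piece l j\<rbrakk> \<Longrightarrow>
      \<exists>k\<in>{1..n'}. x \<in> piece l' k \<and> shift n' \<pi>' l' k = shift n \<pi> l j"
  shows "interval_exchange n \<pi> l = interval_exchange n' \<pi>' l'"
proof
  fix x show "interval_exchange n \<pi> l x = interval_exchange n' \<pi>' l' x"
  proof (cases "x \<in> {0..<1}")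
    case True
    then obtain j where j: "j \<in> {1..n}" "x \<in> piece l j" using piece_exists[OF l(2)] by metis
    then obtain k where k: "k \<in> {1..n'}" "x \<in> piece l' k" "shift n' \<pi>' l' k = shift n \<pi> l j"
      using eq by blast
    show ?thesis
      using interval_exchange_eq[OF l j, of \<pi>] interval_exchange_eq[OF l' k(1,2), of \<pi>'] k(3) by simp
  qed (auto simp: interval_exchange_def)
qed

text \<open>An empty piece adds nothing to any sum of lengths, so the breakpoints and shifts of the
  other pieces survive its removal once the indices are renumbered in the domain and in the
  image.\<close>

lemma interval_exchange_delete_zero:
  assumes n: "1 \<le> n" and \<pi>: "\<pi> permutes {1..n}" and l: "l \<in> Lambda_closed n"
    and k: "k \<in> {1..n}" "l k = 0"
  obtains \<rho> m where "1 \<le> n - 1" "\<rho> permutes {1..n - 1}" "m \<in> Lambda_closed (n - 1)"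
    "interval_exchange n \<pi> l = interval_exchange (n - 1) \<rho> m"
proof -
  note lD = Lambda_closedD[OF n l]
  have n1: "1 \<le> n - 1"
  proof (rule ccontr)
    assume "\<not> ?thesis"
    then have "n = 1" "k = 1" using n k by auto
    then show False using lD(2) k by (simp add: breakpoint_def)
  qed
  \<comment> \<open>\<open>d\<close> enumerates the indices other than \<open>k\<close> in
    increasing order.\<close>
  define d where "d = (\<lambda>i. if i < k then i else i + 1)"
  have d_less: "d i < d j \<longleftrightarrow> i < j" and d_le: "d i \<le> d j \<longleftrightarrow> i \<le> j" and d_eq: "d i = d j \<longleftrightarrow> i = j"
    and dk: "d i \<noteq> k" for i j
    by (auto simp: d_def)
  have dn: "d j \<in> {1..n}" if "j \<in> {1..n - 1}" for j using that by (auto simp: d_def)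
  have d_image: "d ` {1..n - 1} = {1..n} - {k}"
  proof (intro subset_antisym subsetI)
    fix i assume "i \<in> d ` {1..n - 1}" then show "i \<in> {1..n} - {k}" using dn dk by auto
  next
    fix i assume i: "i \<in> {1..n} - {k}"
    show "i \<in> d ` {1..n - 1}"
    proof (cases "i < k")
      case True
      then show ?thesis using i k by (intro image_eqI[of _ _ i]) (auto simp: d_def)
    next
      case False
      then show ?thesis using i k by (intro image_eqI[of _ _ "i - 1"]) (auto simp: d_def)
    qed
  qed
  \<comment> \<open>The predicate is left free: index bounds and the order after
    \<open>\<pi>\<close> will both be substituted for it.\<close>
  have sumd: "(\<Sum>i | i \<in> {1..n - 1} \<and> P (d i). l (d i)) = (\<Sum>i | i \<in> {1..n} \<and> P i. l i)" for P
  proof -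
    have "(\<Sum>i | i \<in> {1..n} \<and> P i. l i) = (\<Sum>i | i \<in> {1..n} - {k} \<and> P i. l i)"
      using k by (intro sum.mono_neutral_right) auto
    also have "{i. i \<in> {1..n} - {k} \<and> P i} = d ` {i. i \<in> {1..n - 1} \<and> P (d i)}"
      unfolding d_image[symmetric] by auto
    also have "sum l \<dots> = (\<Sum>i | i \<in> {1..n - 1} \<and> P (d i). l (d i))"
      by (subst sum.reindex) (auto simp: inj_on_def d_eq)
    finally show ?thesis by simp
  qed
  define m where "m = (\<lambda>i\<in>{1..n - 1}. l (d i))"
  have summ: "(\<Sum>i | i \<in> {1..n - 1} \<and> P (d i). m i) = (\<Sum>i | i \<in> {1..n} \<and> P i. l i)" for P
    unfolding sumd[symmetric] by (rule sum.cong) (auto simp: m_def)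
  have \<pi>n: "\<pi> i \<in> {1..n}" if "i \<in> {1..n}" for i using that permutes_in_image[OF \<pi>] by blast
  have \<pi>k: "\<pi> (d i) \<noteq> \<pi> k" for i using dk permutes_inj[OF \<pi>] by (auto dest: injD)
  \<comment> \<open>\<open>e\<close> closes the gap that \<open>k\<close> leaves at position
    \<open>\<pi> k\<close> in the image order.\<close>
  define e where "e = (\<lambda>a. if a < \<pi> k then a else a - 1)"
  have e_less: "e a < e b \<longleftrightarrow> a < b" if "a \<noteq> \<pi> k" "b \<noteq> \<pi> k" for a b
    using that by (auto simp: e_def)
  have en: "e a \<in> {1..n - 1}" if "a \<in> {1..n}" "a \<noteq> \<pi> k" for a
    using that \<pi>n[OF k(1)] by (auto simp: e_def)
  define \<rho> where "\<rho> = (\<lambda>j. if j \<in> {1..n - 1} then e (\<pi> (d j)) else j)"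
  have \<rho>_less: "\<rho> i < \<rho> j \<longleftrightarrow> \<pi> (d i) < \<pi> (d j)" if "i \<in> {1..n - 1}" "j \<in> {1..n - 1}" for i j
    using that e_less[OF \<pi>k \<pi>k] by (simp add: \<rho>_def)
  have "inj_on \<rho> {1..n - 1}"
  proof (rule inj_onI)
    fix i j assume ij: "i \<in> {1..n - 1}" "j \<in> {1..n - 1}" "\<rho> i = \<rho> j"
    then have "\<pi> (d i) = \<pi> (d j)" using \<rho>_less[OF ij(1,2)] \<rho>_less[OF ij(2,1)] by simp
    then show "i = j" using permutes_inj[OF \<pi>] d_eq by (auto dest: injD)
  qed
  moreover have "\<rho> ` {1..n - 1} \<subseteq> {1..n - 1}"
  proof (rule image_subsetI)
    fix j assume j: "j \<in> {1..n - 1}"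
    show "\<rho> j \<in> {1..n - 1}" using en[OF \<pi>n[OF dn[OF j]] \<pi>k] j by (simp add: \<rho>_def)
  qed
  ultimately have "bij_betw \<rho> {1..n - 1} {1..n - 1}"
    unfolding bij_betw_def by (intro conjI endo_inj_surj) simp_all
  then have \<rho>: "\<rho> permutes {1..n - 1}" by (rule bij_imp_permutes) (simp only: \<rho>_def if_False)
  have bp: "breakpoint m j = breakpoint l (d j)" "breakpoint m (j - 1) = breakpoint l (d j - 1)"
    if j: "j \<in> {1..n - 1}" for j
  proof -
    have "d j \<le> n" "j \<le> n - 1" using dn[OF j] j by auto
    then show "breakpoint m j = breakpoint l (d j)" "breakpoint m (j - 1) = breakpoint l (d j - 1)"
      using summ[of "\<lambda>i. i \<le> d j"] summ[of "\<lambda>i. i < d j"]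
      unfolding d_less d_le by (simp_all only: breakpoint_filter)
  qed
  have sh: "shift (n - 1) \<rho> m j = shift n \<pi> l (d j)" if j: "j \<in> {1..n - 1}" for j
  proof -
    have "{i. i \<in> {1..n - 1} \<and> \<rho> i < \<rho> j} = {i. i \<in> {1..n - 1} \<and> \<pi> (d i) < \<pi> (d j)}"
      using \<rho>_less[OF _ j] by blast
    then show ?thesis
      using summ[of "\<lambda>i. \<pi> i < \<pi> (d j)"] summ[of "\<lambda>i. i < d j"]
      unfolding d_less by (simp only: shift_def)
  qed
  have mnn: "\<forall>i\<in>{1..n - 1}. 0 \<le> m i" using lD(1) dn by (simp add: m_def)
  \<comment> \<open>The trivial predicate makes the total length an instance of
    \<open>summ\<close>.\<close>
  have "breakpoint m (n - 1) = (\<Sum>i | i \<in> {1..n - 1} \<and> True. m i)"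
    by (simp only: breakpoint_def simp_thms Collect_mem_eq)
  also have "\<dots> = (\<Sum>i | i \<in> {1..n} \<and> True. l i)" by (rule summ)
  also have "\<dots> = 1" using lD(2) by (simp only: breakpoint_def simp_thms Collect_mem_eq)
  finally have m1: "breakpoint m (n - 1) = 1" .
  have mL: "m \<in> Lambda_closed (n - 1)"
    using mnn m1 n1 by (intro Lambda_closedI) (auto simp: m_def)
  have "interval_exchange (n - 1) \<rho> m = interval_exchange n \<pi> l"
  proof (rule interval_exchange_eqI[OF mnn m1 lD(1,2)])
    fix j x assume "j \<in> {1..n - 1}" "x \<in> piece m j"
    then show "\<exists>k\<in>{1..n}. x \<in> piece l k \<and> shift n \<pi> l k = shift (n - 1) \<rho> m j"
      using bp sh dn by (intro bexI[of _ "d j"]) (auto simp: piece_def)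
  qed
  then show ?thesis using that n1 \<rho> mL by simp
qed

text \<open>Two pieces that remain adjacent in the same order move together, so the first can absorb
  the second. The emptied piece is kept, with \<open>n\<close> and \<open>\<pi>\<close> unchanged,
  so that \<open>interval_exchange_delete_zero\<close> can remove it.\<close>

lemma interval_exchange_merge:
  assumes n: "1 \<le> n" and l: "l \<in> Lambda_closed n" and j: "j \<in> {1..<n}" and \<pi>j: "\<pi> (j + 1) = \<pi> j + 1"
    and \<pi>: "\<pi> permutes {1..n}"
  defines "m \<equiv> l(j := l j + l (j + 1), j + 1 := 0)"
  shows "m \<in> Lambda_closed n" "interval_exchange n \<pi> l = interval_exchange n \<pi> m"
proof -
  note lD = Lambda_closedD[OF n l]
  have summ: "(\<Sum>i | i \<in> {1..n} \<and> P i. m i) = (\<Sum>i | i \<in> {1..n} \<and> P i. l i)"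
    if P: "P j \<longleftrightarrow> P (j + 1)" for P
  proof -
    let ?A = "{i. i \<in> {1..n} \<and> P i}"
    show ?thesis
    proof (cases "P j")
      case True
      have A: "?A = insert j (insert (j + 1) (?A - {j, j + 1}))" using True P j by auto
      have "(\<Sum>i\<in>?A - {j, j + 1}. m i) = (\<Sum>i\<in>?A - {j, j + 1}. l i)"
        by (rule sum.cong) (auto simp: m_def)
      then show ?thesis by (subst (1 2) A) (simp add: m_def)
    next
      case False
      then show ?thesis using P by (intro sum.cong) (auto simp: m_def)
    qed
  qed
  have bp: "breakpoint m i = breakpoint l i" if "i \<le> n" "i \<noteq> j" for i
    using summ[of "\<lambda>a. a \<le> i"] that by (simp only: breakpoint_filter) linarith
  have bpj: "breakpoint m j = breakpoint l (j + 1)"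
  proof -
    have "breakpoint m j = breakpoint m (j - 1) + m j" using j by (intro breakpoint_step) auto
    moreover have "breakpoint l j = breakpoint l (j - 1) + l j" using j by (intro breakpoint_step) auto
    moreover have "breakpoint l (j + 1) = breakpoint l j + l (j + 1)" by (simp add: breakpoint_def)
    moreover have "breakpoint m (j - 1) = breakpoint l (j - 1)" using j by (intro bp) auto
    ultimately show ?thesis by (simp add: m_def)
  qed
  have mnn: "\<forall>i\<in>{1..n}. 0 \<le> m i" using lD(1) j by (auto simp: m_def)
  have m1: "breakpoint m n = 1" using bp[of n] lD(2) j by auto
  show "m \<in> Lambda_closed n"
    using mnn m1 lD(3) j n by (intro Lambda_closedI) (auto simp: m_def PiE_iff extensional_def)
  have \<pi>_inj: "\<pi> a = \<pi> b \<longleftrightarrow> a = b" for a b using permutes_inj[OF \<pi>] by (auto dest: injD)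
  \<comment> \<open>For \<open>i\<close> other than \<open>j + 1\<close>, either both or neither of
    \<open>j\<close> and \<open>j + 1\<close> precede \<open>i\<close>, in the domain and in the
    image alike.\<close>
  have sh: "shift n \<pi> m i = shift n \<pi> l i" if "i \<noteq> j + 1" for i
  proof -
    have "\<pi> i \<noteq> \<pi> (j + 1)" using that \<pi>_inj by simp
    then have "\<pi> j < \<pi> i \<longleftrightarrow> \<pi> (j + 1) < \<pi> i" using \<pi>j by auto
    moreover have "j < i \<longleftrightarrow> j + 1 < i" using that by auto
    ultimately show ?thesis
      using summ[of "\<lambda>a. \<pi> a < \<pi> i"] summ[of "\<lambda>a. a < i"] by (simp only: shift_def)
  qed
  have shj: "shift n \<pi> l (j + 1) = shift n \<pi> l j"
  proof -
    have "{i. i \<in> {1..n} \<and> \<pi> i < \<pi> (j + 1)} = insert j {i. i \<in> {1..n} \<and> \<pi> i < \<pi> j}"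
    proof (intro subset_antisym subsetI)
      fix i assume "i \<in> {i. i \<in> {1..n} \<and> \<pi> i < \<pi> (j + 1)}"
      then have "i \<in> {1..n}" "\<pi> i < \<pi> j \<or> \<pi> i = \<pi> j" using \<pi>j by auto
      then show "i \<in> insert j {i. i \<in> {1..n} \<and> \<pi> i < \<pi> j}" using \<pi>_inj by blast
    qed (use j \<pi>j in auto)
    moreover have "{i. i \<in> {1..n} \<and> i < j + 1} = insert j {i. i \<in> {1..n} \<and> i < j}" using j by auto
    ultimately show ?thesis by (simp add: shift_def)
  qed
  show "interval_exchange n \<pi> l = interval_exchange n \<pi> m"
  proof (rule interval_exchange_eqI[OF lD(1,2) mnn m1])
    fix i x assume i: "i \<in> {1..n}" "x \<in> piece l i"
    have le: "breakpoint l j \<le> breakpoint l (j + 1)" "breakpoint l (j - 1) \<le> breakpoint l j"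
      using j by (intro breakpoint_mono[OF lD(1)]; auto)+
    have pj: "breakpoint m (j - 1) = breakpoint l (j - 1)" using j by (intro bp) auto
    show "\<exists>k\<in>{1..n}. x \<in> piece m k \<and> shift n \<pi> m k = shift n \<pi> l i"
    proof (cases "i = j \<or> i = j + 1")
      case True
      then have "shift n \<pi> m j = shift n \<pi> l i" using sh[of j] shj by auto
      moreover have "x \<in> piece m j" using True i le bpj pj by (auto simp: piece_def)
      ultimately show ?thesis using j by (intro bexI[of _ j]) auto
    next
      case False
      then have "breakpoint m i = breakpoint l i" "breakpoint m (i - 1) = breakpoint l (i - 1)"
        using i j by (intro bp; auto)+
      then show ?thesis using sh[of i] i False by (intro bexI[of _ i]) (auto simp: piece_def)
    qed
  qed
qed

text \<open>Strong induction on the number of pieces: an empty piece is deleted, and a partitioned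
  permutation yields an empty piece by merging. Each reduction lowers the number, so
  \<open>m = n\<close> certifies that none took place and that \<open>l\<close> was already in the
  open simplex; this is what a minimal dimension will exploit.\<close>

lemma interval_exchange_normal_form:
  assumes "1 \<le> n" "\<pi> permutes {1..n}" "l \<in> Lambda_closed n"
  obtains m \<rho> l' where "1 \<le> m" "m \<le> n" "unpartitioned m \<rho>" "l' \<in> Lambda m"
    "interval_exchange n \<pi> l = interval_exchange m \<rho> l'"
    "\<lbrakk>m = n\<rbrakk> \<Longrightarrow> l \<in> Lambda n"
proof -
  have "\<exists>m \<rho> l'. 1 \<le> m \<and> m \<le> n \<and> unpartitioned m \<rho> \<and> l' \<in> Lambda m \<and>
      interval_exchange n \<pi> l = interval_exchange m \<rho> l' \<and> (m = n \<longrightarrow> l \<in> Lambda n)"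
    using assms
  proof (induction n arbitrary: \<pi> l rule: less_induct)
    case (less n)
    have zero: "\<exists>m \<rho> l'. 1 \<le> m \<and> m < n \<and> unpartitioned m \<rho> \<and> l' \<in> Lambda m \<and>
        interval_exchange n \<pi> l = interval_exchange m \<rho> l'"
      if l: "l \<in> Lambda_closed n" and k: "k \<in> {1..n}" "l k = 0" for l k
    proof -
      obtain \<rho> m where *: "1 \<le> n - 1" "\<rho> permutes {1..n - 1}" "m \<in> Lambda_closed (n - 1)"
        "interval_exchange n \<pi> l = interval_exchange (n - 1) \<rho> m"
        using interval_exchange_delete_zero[OF less.prems(1,2) l k] .
      have lt: "n - 1 < n" using less.prems by simp
      obtain m' \<rho>' l' where "1 \<le> m'" "m' \<le> n - 1" "unpartitioned m' \<rho>'" "l' \<in> Lambda m'"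
        "interval_exchange (n - 1) \<rho> m = interval_exchange m' \<rho>' l'"
        using less.IH[OF lt *(1-3)] by blast
      then show ?thesis using *(4) lt by (intro exI[of _ m'] exI[of _ \<rho>'] exI[of _ l']) auto
    qed
    show ?case
    proof (cases "l \<in> Lambda n")
      case L: True
      show ?thesis
      proof (cases "unpartitioned n \<pi>")
        case True
        then show ?thesis using L less.prems by blast
      next
        case False
        then obtain j where j: "j \<in> {1..<n}" "\<pi> (j + 1) = \<pi> j + 1"
          using less.prems by (auto simp: unpartitioned_def)
        have j1: "j + 1 \<in> {1..n}" "j + 1 \<noteq> j" using j by auto
        note mm = interval_exchange_merge[OF less.prems(1,3) j less.prems(2)]
        obtain m \<rho> l' where "1 \<le> m" "m < n" "unpartitioned m \<rho>" "l' \<in> Lambda m"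
          "interval_exchange n \<pi> l = interval_exchange m \<rho> l'"
          using zero[OF mm(1) j1(1)] unfolding mm(2)[symmetric] by auto
        then show ?thesis using less_imp_le by blast
      qed
    next
      case False
      then obtain k where k: "k \<in> {1..n}" "l k = 0"
        using less.prems by (auto simp: Lambda_closed_eq Lambda_def order_le_less)
      then show ?thesis using zero[OF less.prems(3) k] less_imp_le by (metis less_irrefl)
    qed
  qed
  then show ?thesis using that by blast
qed

lemma IET_normal_form:
  assumes "f \<in> IET"
  obtains n \<pi> l where "1 \<le> n" "unpartitioned n \<pi>" "l \<in> Lambda n" "f = interval_exchange n \<pi> l"
proof -
  obtain n \<pi> l where *: "1 \<le> n" "\<pi> permutes {1..n}" "l \<in> Lambda_closed n" "f = interval_exchange n \<pi> l"
    using assms Lambda_subset_closed unfolding IET_def by blast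
  show ?thesis using interval_exchange_normal_form[OF *(1-3)] that *(4) by metis
qed

section \<open>Flows of piecewise constant speed\<close>

lemma IET_bij_betw: "f \<in> IET \<Longrightarrow> bij_betw f {0..<1} {0..<1}"
  by (auto simp: IET_iff Bij_def)

lemma IET_extensional: "f \<in> IET \<Longrightarrow> f \<in> extensional {0..<1}"
  by (auto simp: IET_iff Bij_def)

lemma IET_in_unit: "f \<in> IET \<Longrightarrow> x \<in> {0..<1} \<Longrightarrow> f x \<in> {0..<1}"
  using IET_bij_betw bij_betwE by blast

lemma IET_inj: "f \<in> IET \<Longrightarrow> f x = f y \<Longrightarrow> x \<in> {0..<1} \<Longrightarrow> y \<in> {0..<1} \<Longrightarrow> x = y"
  using IET_bij_betw unfolding bij_betw_def inj_on_def by blast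

lemma IET_eqI:
  assumes "f \<in> IET" "g \<in> IET" "\<And>x. x \<in> {0..<1} \<Longrightarrow> f x = g x"
  shows "f = g"
  using assms IET_extensional by (intro extensionalityI[of _ "{0..<1}"]) auto

lemma carrier_IET_group: "carrier IET_group = IET"
  by (simp add: IET_group_def)

lemma IET_mult:
  assumes "f \<in> IET" "g \<in> IET"
  shows "f \<otimes>\<^bsub>IET_group\<^esub> g = compose {0..<1} f g"
  using assms by (auto simp: IET_group_def BijGroup_def IET_iff)

text \<open>Because pieces contain their left end points, an exchange translates a right
  neighbourhood of every point, breakpoints included.\<close>

lemma IET_right_translation:
  assumes "f \<in> IET" "x \<in> {0..<1}"
  obtains e where "0 < e" "x + e \<le> 1" "\<And>y. x \<le> y \<Longrightarrow> y < x + e \<Longrightarrow> f y = f x + (y - x)"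
proof -
  obtain B where B: "finite B"
    "\<And>x y. \<lbrakk>x \<in> {0..<1}; y \<in> {0..<1}; x \<le> y; B \<inter> {x<..y} = {}\<rbrakk> \<Longrightarrow> f y - f x = y - x"
    using assms(1) unfolding IET_iff piecewise_translation_def by blast
  \<comment> \<open>The next break to the right of \<open>x\<close>, or \<open>1\<close> if that
    comes first; \<open>x\<close> itself may lie in \<open>B\<close>.\<close>
  define b where "b = Min (insert 1 {z \<in> B. x < z})"
  have fin: "finite (insert 1 {z \<in> B. x < z})" using B by simp
  have b: "b \<in> insert 1 {z \<in> B. x < z}" unfolding b_def using fin by (intro Min_in) auto
  have bmin: "b \<le> z" if "z = 1 \<or> z \<in> B \<and> x < z" for z
    unfolding b_def using fin that by (intro Min_le) auto
  have b1: "b \<le> 1" using bmin by blast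
  have xb: "x < b" using b assms(2) by auto
  show ?thesis
  proof (rule that[of "b - x"])
    fix y assume y: "x \<le> y" "y < x + (b - x)"
    have "B \<inter> {x<..y} = {}" using bmin y by force
    then show "f y = f x + (y - x)" using B(2)[of x y] assms(2) y b1 by auto
  qed (use xb b1 in auto)
qed

text \<open>Cuts at one break at a time; injectivity keeps the images of the two halves disjoint.
  Measurability is carried along because additivity of the measure needs it.\<close>

lemma emeasure_piecewise_translation_image:
  fixes f :: "real \<Rightarrow> real"
  assumes "finite B" "a \<le> b" "inj_on f {a..<b}"
    and "\<And>x y. \<lbrakk>x \<in> {a..<b}; y \<in> {a..<b}; x \<le> y; B \<inter> {x<..y} = {}\<rbrakk> \<Longrightarrow> f y - f x = y - x"
  shows "f ` {a..<b} \<in> sets lborel \<and> emeasure lborel (f ` {a..<b}) = ennreal (b - a)"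
  using assms
proof (induction B arbitrary: a b rule: finite_induct)
  case empty
  show ?case
  proof (cases "a = b")
    case False
    then have "f y = (f a - a) + y" if "y \<in> {a..<b}" for y
      using empty.prems(3)[of a y] empty.prems(1) that by simp
    then have "f ` {a..<b} = (\<lambda>y. (f a - a) + y) ` {a..<b}" by (rule image_cong[OF refl])
    also have "\<dots> = {a + (f a - a)..<b + (f a - a)}" by (rule image_add_atLeastLessThan)
    also have "\<dots> = {f a..<f a + (b - a)}" by (simp add: algebra_simps)
    finally show ?thesis using empty.prems(1) by simp
  qed simp
next
  case (insert z B)
  show ?case
  proof (cases "z \<in> {a<..<b}")
    case True
    have eq: "{a..<b} = {a..<z} \<union> {z..<b}" using True by auto
    have 1: "f ` {a..<z} \<in> sets lborel \<and> emeasure lborel (f ` {a..<z}) = ennreal (z - a)"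
    proof (rule insert.IH)
      show "inj_on f {a..<z}" using insert.prems(2) by (rule inj_on_subset) (use True in auto)
      show "f y - f x = y - x" if "x \<in> {a..<z}" "y \<in> {a..<z}" "x \<le> y" "B \<inter> {x<..y} = {}" for x y
        using that True by (intro insert.prems(3)) auto
    qed (use True in auto)
    have 2: "f ` {z..<b} \<in> sets lborel \<and> emeasure lborel (f ` {z..<b}) = ennreal (b - z)"
    proof (rule insert.IH)
      show "inj_on f {z..<b}" using insert.prems(2) by (rule inj_on_subset) (use True in auto)
      show "f y - f x = y - x" if "x \<in> {z..<b}" "y \<in> {z..<b}" "x \<le> y" "B \<inter> {x<..y} = {}" for x y
        using that True by (intro insert.prems(3)) auto
    qed (use True in auto)
    have disj: "f ` {a..<z} \<inter> f ` {z..<b} = {}"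
    proof -
      have "f ` {a..<z} \<inter> f ` {z..<b} = f ` ({a..<z} \<inter> {z..<b})"
        by (rule inj_on_image_Int[symmetric, OF insert.prems(2)]) (use True in auto)
      then show ?thesis by auto
    qed
    have "ennreal (z - a) + ennreal (b - z) = ennreal (b - a)"
      using True by (subst ennreal_plus[symmetric]) auto
    then show ?thesis unfolding eq image_Un
      using 1 2 plus_emeasure[OF conjunct1[OF 1] conjunct1[OF 2] disj] by (metis sets.Un)
  next
    case False
    show ?thesis
    proof (rule insert.IH[OF insert.prems(1,2)])
      show "f y - f x = y - x" if "x \<in> {a..<b}" "y \<in> {a..<b}" "x \<le> y" "B \<inter> {x<..y} = {}" for x y
        using that False by (intro insert.prems(3)) auto
    qed
  qed
qed

section \<open>Homomorphisms of the real line, read as flows on the unit interval\<close>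

locale iet_flow =
  fixes F :: "real \<Rightarrow> real \<Rightarrow> real"
  assumes hom: "F \<in> hom real_group IET_group"
begin

lemma F_IET: "F s \<in> IET"
  using hom by (auto simp: hom_def real_group_def IET_group_def)

lemma F_add: "x \<in> {0..<1} \<Longrightarrow> F (s + t) x = F s (F t x)"
proof -
  assume x: "x \<in> {0..<1}"
  have "F (s + t) = F s \<otimes>\<^bsub>IET_group\<^esub> F t" using hom by (auto simp: hom_def real_group_def)
  then show ?thesis using x IET_mult[OF F_IET F_IET, of s t] by (simp add: compose_def)
qed

lemma F_unit: "x \<in> {0..<1} \<Longrightarrow> F s x \<in> {0..<1}"
  by (rule IET_in_unit[OF F_IET])

lemma F_inj: "F s x = F s y \<Longrightarrow> x \<in> {0..<1} \<Longrightarrow> y \<in> {0..<1} \<Longrightarrow> x = y"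
  by (rule IET_inj[OF F_IET])

lemma F_zero: "x \<in> {0..<1} \<Longrightarrow> F 0 x = x"
  using F_add[of x 0 0] F_inj[of 0 "F 0 x" x] F_unit by simp

lemma F_minus: "x \<in> {0..<1} \<Longrightarrow> F (- s) (F s x) = x"
  using F_add[of x "- s" s] F_zero by simp

lemma F_diff: "F s x = F t y \<Longrightarrow> x \<in> {0..<1} \<Longrightarrow> y \<in> {0..<1} \<Longrightarrow> F (s - t) x = y"
  using F_add[of x "- t" s] F_minus[of y t] by simp

end

text \<open>Motion at speed \<open>v j\<close> is assumed only inside the pieces, for a time that
  may depend on the point; at the end points the flow may jump.\<close>

locale piecewise_flow =
  iet_flow F for F :: "real \<Rightarrow> real \<Rightarrow> real" +
  fixes n :: nat and l :: "nat \<Rightarrow> real" and v :: "nat \<Rightarrow> real"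
  assumes lengths: "l \<in> Lambda n"
    and local: "\<And>j x. \<lbrakk>j \<in> {1..n}; breakpoint l (j - 1) < x; x < breakpoint l j\<rbrakk> \<Longrightarrow>
      \<exists>d>0. \<forall>s. \<bar>s\<bar> < d \<longrightarrow> F s x = x + v j * s"
begin

abbreviation "lo j \<equiv> breakpoint l (j - 1)"
abbreviation "hi j \<equiv> breakpoint l j"

definition idx :: "real \<Rightarrow> nat" where "idx x = (THE j. j \<in> {1..n} \<and> x \<in> piece l j)"
definition vel :: "real \<Rightarrow> real" where "vel x = v (idx x)"
text \<open>The left end points of the pieces are the places where a moving point appears after
  leaving a piece; their finiteness will force periodicity.\<close>

definition D :: "real set" where "D = lo ` {1..n}"

lemma l_nonneg: "\<forall>i\<in>{1..n}. 0 \<le> l i" and l_total: "breakpoint l n = 1"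
  using lengths by (auto simp: Lambda_def breakpoint_def less_imp_le)

lemma idx: "x \<in> {0..<1} \<Longrightarrow> idx x \<in> {1..n}" "x \<in> {0..<1} \<Longrightarrow> x \<in> piece l (idx x)"
  using piece_exists[OF l_total, of x] THE_piece[OF l_nonneg, of _ x] unfolding idx_def by metis+

lemma idx_eq: "j \<in> {1..n} \<Longrightarrow> x \<in> piece l j \<Longrightarrow> idx x = j"
  unfolding idx_def by (rule THE_piece[OF l_nonneg])

lemma lo_hi: "x \<in> {0..<1} \<Longrightarrow> lo (idx x) \<le> x" "x \<in> {0..<1} \<Longrightarrow> x < hi (idx x)"
  using idx[of x] by (auto simp: piece_def)

lemma piece_unit: "j \<in> {1..n} \<Longrightarrow> x \<in> piece l j \<Longrightarrow> x \<in> {0..<1}"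
  using piece_subset[OF l_nonneg l_total] by blast

lemma lo_piece: "j \<in> {1..n} \<Longrightarrow> lo j \<in> piece l j"
  using lengths breakpoint_step[of j l] by (auto simp: Lambda_def piece_def)

lemma finite_D: "finite D" and D_unit: "p \<in> D \<Longrightarrow> p \<in> {0..<1}" and D_lo: "p \<in> D \<Longrightarrow> lo (idx p) = p"
proof -
  show "finite D" by (simp add: D_def)
  assume "p \<in> D"
  then obtain j where j: "j \<in> {1..n}" "p = lo j" by (auto simp: D_def)
  then show "p \<in> {0..<1}" "lo (idx p) = p"
    using idx_eq[OF j(1) lo_piece[OF j(1)]] piece_unit[OF j(1) lo_piece[OF j(1)]] by auto
qed

text \<open>The times at which the linear path stays inside the piece form an interval. By the group
  law, agreement of the flow with the path at one time is equivalent to agreement at nearby times,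
  so agreement and disagreement are both open conditions; connectedness extends the agreement at
  time \<open>0\<close> to the whole interval.\<close>

lemma F_linear_interior:
  assumes j: "j \<in> {1..n}" and x: "lo j < x" "x < hi j" and s: "lo j < x + v j * s" "x + v j * s < hi j"
  shows "F s x = x + v j * s"
proof -
  define A where "A = {u. x + v j * u \<in> {lo j<..<hi j}}"
  have x01: "x \<in> {0..<1}" using piece_unit[OF j, of x] x by (auto simp: piece_def)
  have A01: "x + v j * u \<in> {0..<1}" if "u \<in> A" for u
    using piece_unit[OF j, of "x + v j * u"] that by (auto simp: piece_def A_def)
  have openA: "open A"
  proof -
    have "A = {u. lo j < x + v j * u} \<inter> {u. x + v j * u < hi j}" by (auto simp: A_def)
    moreover have "open {u. lo j < x + v j * u}" "open {u. x + v j * u < hi j}"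
      by (intro open_Collect_less continuous_intros)+
    ultimately show ?thesis by (simp only: open_Int)
  qed
  have "connected A"
    unfolding connected_iff_interval
  proof (intro ballI allI impI)
    fix a b c assume a: "a \<in> A" and b: "b \<in> A" and c: "a \<le> c" "c \<le> b"
    show "c \<in> A"
    proof (cases "0 \<le> v j")
      case True
      then have "v j * a \<le> v j * c" "v j * c \<le> v j * b" using c by (auto intro: mult_left_mono)
      then show ?thesis using a b by (auto simp: A_def)
    next
      case False
      then have "v j * a \<ge> v j * c" "v j * c \<ge> v j * b" using c by (auto intro: mult_left_mono_neg)
      then show ?thesis using a b by (auto simp: A_def)
    qed
  qed
  \<comment> \<open>Both directions pass through \<open>F (u' - u)\<close>; the one from
    \<open>u'\<close> back to \<open>u\<close> uses its injectivity.\<close>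
  have ex: "\<exists>d>0. \<forall>u'. \<bar>u' - u\<bar> < d \<longrightarrow> u' \<in> A \<and> (F u' x = x + v j * u' \<longleftrightarrow> F u x = x + v j * u)"
    if u: "u \<in> A" for u
  proof -
    obtain d1 where d1: "d1 > 0" "\<And>u'. \<bar>u' - u\<bar> < d1 \<Longrightarrow> u' \<in> A"
      using openA u unfolding open_dist dist_real_def by metis
    obtain d2 where d2: "d2 > 0" "\<And>w. \<bar>w\<bar> < d2 \<Longrightarrow> F w (x + v j * u) = x + v j * u + v j * w"
      using local[OF j, of "x + v j * u"] u unfolding A_def by auto
    show ?thesis
    proof (intro exI[of _ "min d1 d2"] conjI allI impI)
      fix u' assume u': "\<bar>u' - u\<bar> < min d1 d2"
      show "u' \<in> A" using d1 u' by auto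
      have 1: "F u' x = F (u' - u) (F u x)" using F_add[OF x01, of "u' - u" u] by simp
      have 2: "F (u' - u) (x + v j * u) = x + v j * u'"
        using d2(2)[of "u' - u"] u' by (simp add: algebra_simps)
      show "F u' x = x + v j * u' \<longleftrightarrow> F u x = x + v j * u"
        using 1 2 F_inj[of "u' - u" "F u x" "x + v j * u"] F_unit[OF x01] A01[OF u] by metis
    qed (use d1 d2 in auto)
  qed
  define U where "U = {u \<in> A. F u x = x + v j * u}"
  define V where "V = {u \<in> A. F u x \<noteq> x + v j * u}"
  have "open U" "open V"
    unfolding open_dist dist_real_def U_def V_def using ex by blast+
  moreover have "U \<inter> V \<inter> A = {}" "A \<subseteq> U \<union> V" by (auto simp: U_def V_def)
  ultimately have "U \<inter> A = {} \<or> V \<inter> A = {}" using connectedD[OF \<open>connected A\<close>, of U V] by simp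
  moreover have "0 \<in> U" using x F_zero[OF x01] by (auto simp: U_def A_def)
  moreover have "s \<in> A" using s by (auto simp: A_def)
  ultimately show ?thesis by (auto simp: U_def V_def)
qed

text \<open>Adds the left end points: \<open>x\<close> is pushed into the piece by a small
  \<open>h\<close>, where the interior case applies, and the result is pulled back because
  \<open>F s\<close> translates a right neighbourhood of \<open>x\<close>.\<close>

lemma F_linear:
  assumes j: "j \<in> {1..n}" and x: "x \<in> piece l j" and s: "x + v j * s \<in> piece l j"
  shows "F s x = x + v j * s"
proof -
  have x01: "x \<in> {0..<1}" by (rule piece_unit[OF j x])
  obtain e where e: "0 < e" "\<And>y. x \<le> y \<Longrightarrow> y < x + e \<Longrightarrow> F s y = F s x + (y - x)"
    using IET_right_translation[OF F_IET x01, of s] by metis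
  define M where "M = min e (min (hi j - x) (hi j - (x + v j * s)))"
  have "0 < M" using e x s by (auto simp: M_def piece_def)
  then obtain h where h0: "0 < h" "h < M" using dense by blast
  then have h: "0 < h" "h < e" "x + h < hi j" "x + v j * s + h < hi j"
    by (auto simp: M_def)
  have "F s (x + h) = x + h + v j * s"
    by (rule F_linear_interior[OF j]) (use h x s in \<open>auto simp: piece_def\<close>)
  then show ?thesis using e(2)[of "x + h"] h by simp
qed

lemma F_vel:
  assumes "x \<in> {0..<1}" "lo (idx x) \<le> x + vel x * s" "x + vel x * s < hi (idx x)"
  shows "F s x = x + vel x * s"
  using F_linear[OF idx[OF assms(1)], of s] assms by (auto simp: vel_def piece_def)

text \<open>\<open>F s\<close> translates a right neighbourhood of \<open>x\<close>, so it carries the short orbit segment at \<open>x\<close> to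
  one at \<open>F s x\<close>.\<close>

lemma vel_F_nonzero:
  assumes x: "x \<in> {0..<1}" and c: "vel x \<noteq> 0"
  shows "vel (F s x) = vel x"
proof -
  define z where "z = F s x"
  define r where "r = vel z / vel x"
  have z: "z \<in> {0..<1}" unfolding z_def by (rule F_unit[OF x])
  obtain e where e: "0 < e" "\<And>y. x \<le> y \<Longrightarrow> y < x + e \<Longrightarrow> F s y = F s x + (y - x)"
    using IET_right_translation[OF F_IET x, of s] by metis
  define M where "M = min e (min (hi (idx x) - x) (hi (idx z) - z))"
  \<comment> \<open>So small that \<open>z\<close> can move by \<open>h\<close> and then by another
    \<open>h * \<bar>r\<bar>\<close> without passing the right end of its piece.\<close>
  define h where "h = M / (2 * (1 + \<bar>r\<bar>))"
  have M: "0 < M" using e lo_hi[OF x] lo_hi[OF z] by (auto simp: M_def)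
  then have h: "0 < h" by (simp add: h_def)
  have "h * (1 + \<bar>r\<bar>) = M / 2" using abs_ge_zero[of r] unfolding h_def by (simp add: field_simps)
  then have hM: "h + h * \<bar>r\<bar> < M" using M by (simp add: algebra_simps)
  have "0 \<le> h * \<bar>r\<bar>" using h by simp
  then have "h < M" using hM by linarith
  then have hx: "h < e" "x + h < hi (idx x)" "z + h < hi (idx z)" by (auto simp: M_def)
  have rM: "h + h * \<bar>r\<bar> < hi (idx z) - z" using hM by (auto simp: M_def)
  define u where "u = h / vel x"
  have u: "vel x * u = h" "vel z * u = r * h" using c by (auto simp: u_def r_def)
  have "F u x = x + h" using F_vel[OF x, of u] lo_hi[OF x] h hx unfolding u by simp
  moreover have "F s (x + h) = z + h" using e(2)[of "x + h"] h hx by (simp add: z_def)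
  ultimately have Fu: "F u z = z + h"
    using F_add[OF x, of s u] F_add[OF x, of u s] by (simp add: z_def add.commute)
  \<comment> \<open>In time \<open>u\<close> the point \<open>z\<close> moves by exactly
    \<open>h\<close>, while its own speed predicts \<open>r * h\<close>. For \<open>r < 0\<close>
    the predicted path could leave the piece on the left, so the comparison starts at
    \<open>z + h\<close> and runs backwards.\<close>
  have "r = 1"
  proof (cases "0 \<le> r")
    case True
    then have "0 \<le> r * h" "r * h = h * \<bar>r\<bar>" using h by auto
    then have "F u z = z + r * h" using F_vel[OF z, of u] lo_hi[OF z] h rM unfolding u by linarith
    then show ?thesis using Fu h by simp
  next
    case False
    have zh: "z + h \<in> {0..<1}" using Fu F_unit[OF z, of u] by simp
    have iz: "idx (z + h) = idx z" by (rule idx_eq[OF idx(1)[OF z]]) (use hx h lo_hi[OF z] in \<open>auto simp: piece_def\<close>)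
    have rh: "\<bar>r\<bar> * h = - (r * h)" "r * h \<le> 0" using False h by (auto simp: mult_nonpos_nonneg)
    have "F (- u) (z + h) = z + h + vel z * - u"
      using F_vel[OF zh, of "- u"] iz u lo_hi[OF z] rM rh h by (simp add: vel_def mult.commute)
    moreover have "F (- u) (z + h) = z" using F_minus[OF z, of u] Fu by simp
    ultimately have "h - r * h = 0" using u by simp
    then show ?thesis using h rh by simp
  qed
  then show ?thesis using c by (simp add: r_def z_def)
qed

text \<open>Points at rest stay at rest: otherwise the nonzero case, run backwards from
  \<open>F s x\<close>, would give \<open>x\<close> a nonzero speed.\<close>

lemma vel_F:
  assumes x: "x \<in> {0..<1}"
  shows "vel (F s x) = vel x"
  using vel_F_nonzero[OF x] vel_F_nonzero[OF F_unit[OF x], of s "- s"] F_minus[OF x] by metis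

section \<open>Return to left end points and periodicity\<close>

lemma exit:
  assumes x: "x \<in> {0..<1}" and c: "vel x \<noteq> 0"
  shows "F ((hi (idx x) - x) / vel x) x \<in> D"
proof -
  define b where "b = hi (idx x)"
  \<comment> \<open>A distance divided by the speed: the time is negative for negative speed, so the
    path always runs to the right.\<close>
  define S where "S = (b - x) / vel x"
  define z where "z = F S x"
  have z: "z \<in> {0..<1}" unfolding z_def by (rule F_unit[OF x])
  have vz: "vel z = vel x" unfolding z_def by (rule vel_F[OF x])
  \<comment> \<open>If \<open>z\<close> were not a left end point, both \<open>z\<close> and the
    path from \<open>x\<close> could be followed back by a small \<open>y\<close>, which gives
    \<open>z = b\<close>. But \<open>b\<close> is either \<open>1\<close> or the left end of the
    next piece.\<close>
  have "z = lo (idx z)"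
  proof (rule ccontr)
    assume ne: "z \<noteq> lo (idx z)"
    define y where "y = min (z - lo (idx z)) (b - x) / 2"
    have y: "0 < y" "y < z - lo (idx z)" "y < b - x"
      using ne lo_hi[OF z] lo_hi[OF x] by (auto simp: y_def b_def min_def)
    have "F (- (y / vel x)) z = z - y"
      using F_vel[OF z, of "- (y / vel x)"] y lo_hi[OF z] c unfolding vz by simp
    moreover have "F (S - y / vel x) x = b - y"
    proof -
      have "vel x * (S - y / vel x) = b - x - y" using c by (simp add: S_def field_simps)
      then show ?thesis using F_vel[OF x, of "S - y / vel x"] y lo_hi[OF x] by (simp add: b_def)
    qed
    ultimately have zb: "z = b" using F_add[OF x, of "- (y / vel x)" S] by (simp add: z_def)
    have i: "idx x \<in> {1..n}" by (rule idx(1)[OF x])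
    show False
    proof (cases "idx x = n")
      case True then show ?thesis using zb z l_total by (simp add: b_def)
    next
      case False
      then have i': "Suc (idx x) \<in> {1..n}" using i by auto
      then have "idx z = Suc (idx x)"
        using lo_piece[OF i'] idx_eq[OF i'] zb by (simp add: b_def)
      then show False using ne zb by (simp add: b_def)
    qed
  qed
  then show ?thesis using idx(1)[OF z] by (auto simp: D_def z_def S_def b_def)
qed

lemma hits_D_after:
  assumes x: "x \<in> {0..<1}" and c: "vel x \<noteq> 0"
  obtains y where "Y < y" "F (y / vel x) x \<in> D"
proof -
  define z where "z = F (Y / vel x) x"
  have z: "z \<in> {0..<1}" "vel z = vel x" unfolding z_def using F_unit[OF x] vel_F[OF x] by auto
  have "F ((hi (idx z) - z) / vel x) z \<in> D" using exit[OF z(1)] c z by simp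
  then show ?thesis using that[of "hi (idx z) - z + Y"] lo_hi[OF z(1)] 
    by (simp add: z_def F_add[OF x] add_divide_distrib)
qed

text \<open>The orbit meets the finite set \<open>D\<close> at infinitely many parameters, so two
  hits coincide, and by injectivity of the flow their difference fixes \<open>x\<close>.\<close>

lemma periodic:
  assumes x: "x \<in> {0..<1}" and c: "vel x \<noteq> 0"
  obtains L where "0 < L" "F (L / vel x) x = x"
proof -
  define A where "A = {y. F (y / vel x) x \<in> D}"
  have "infinite A"
  proof
    assume "finite A"
    then obtain Y where Y: "\<And>y. y \<in> A \<Longrightarrow> y \<le> Y" using bdd_above_finite[of A] by (auto simp: bdd_above_def)
    obtain y where "Y < y" "F (y / vel x) x \<in> D" using hits_D_after[OF x c] .
    then show False using Y[of y] by (auto simp: A_def)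
  qed
  moreover have "finite ((\<lambda>y. F (y / vel x) x) ` A)"
    by (rule finite_subset[OF _ finite_D]) (auto simp: A_def)
  ultimately have "\<not> inj_on (\<lambda>y. F (y / vel x) x) A" using finite_imageD by blast
  then obtain y y' where "F (y / vel x) x = F (y' / vel x) x" "y \<noteq> y'" by (auto simp: inj_on_def)
  then obtain y y' where yy: "F (y' / vel x) x = F (y / vel x) x" "y < y'" by (metis linorder_neqE)
  then show ?thesis using that[of "y' - y"] F_diff[OF yy(1) x x] by (simp add: diff_divide_distrib)
qed

lemma minimal_period:
  assumes x: "x \<in> {0..<1}" and c: "vel x \<noteq> 0"
  obtains L where "0 < L" "F (L / vel x) x = x" "\<And>y. 0 < y \<Longrightarrow> y < L \<Longrightarrow> F (y / vel x) x \<noteq> x"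
proof -
  define A where "A = {y. 0 < y \<and> F (y / vel x) x = x}"
  define e where "e = hi (idx x) - x"
  have e: "0 < e" using lo_hi[OF x] by (simp add: e_def)
  have small: "\<not> y < e" if "y \<in> A" for y
  proof
    assume "y < e"
    then have "F (y / vel x) x = x + y"
      using F_vel[OF x, of "y / vel x"] that c lo_hi[OF x] by (auto simp: A_def e_def)
    then show False using that by (auto simp: A_def)
  qed
  have gap: "y' - y \<in> A" if "y \<in> A" "y' \<in> A" "y < y'" for y y'
    using that F_diff[of "y' / vel x" x "y / vel x" x] x by (auto simp: A_def diff_divide_distrib)
  obtain y0 where "y0 \<in> A" using periodic[OF x c] by (auto simp: A_def)
  then have ne: "A \<noteq> {}" by auto
  have bdd: "bdd_below A" by (rule bdd_belowI[of _ 0]) (auto simp: A_def)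
  \<comment> \<open>Return distances are at least \<open>e\<close>, and the difference of two of
    them is again one, so a return distance within \<open>e\<close> of the infimum is the
    least.\<close>
  obtain y where y: "y \<in> A" "y < Inf A + e"
    using cInf_lessD[OF ne, of "Inf A + e"] e by auto
  have "F (y' / vel x) x \<noteq> x" if "0 < y'" "y' < y" for y'
  proof
    assume "F (y' / vel x) x = x"
    then have "y' \<in> A" using that by (simp add: A_def)
    then have "\<not> y - y' < e" using gap[of y' y] small that y by blast
    moreover have "Inf A \<le> y'" by (rule cInf_lower[OF \<open>y' \<in> A\<close> bdd])
    ultimately show False using y by simp
  qed
  then show ?thesis using that[of y] y by (auto simp: A_def)
qed

text \<open>Each moving orbit is represented by its least point in \<open>D\<close> and parametrised by arc length;
  each piece at rest is represented by its left end point.\<close>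

definition reps :: "real set" where
  "reps = {p \<in> D. vel p \<noteq> 0 \<longrightarrow> (\<forall>s. F s p \<in> D \<longrightarrow> p \<le> F s p)}"

definition per :: "real \<Rightarrow> real" where
  "per p = (if vel p = 0 then hi (idx p) - p else
     (SOME L. 0 < L \<and> F (L / vel p) p = p \<and> (\<forall>y. 0 < y \<longrightarrow> y < L \<longrightarrow> F (y / vel p) p \<noteq> p)))"

definition chart :: "real \<Rightarrow> real \<Rightarrow> real" where
  "chart p y = (if vel p = 0 then p + y else F (y / vel p) p)"

section \<open>Periods and charts along orbits\<close>

lemma reps_D: "p \<in> reps \<Longrightarrow> p \<in> D" and finite_reps: "finite reps"
  using finite_subset[OF _ finite_D, of reps] by (auto simp: reps_def)

lemma reps_unit: "p \<in> reps \<Longrightarrow> p \<in> {0..<1}"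
  using reps_D D_unit by blast

lemma per_nonzero:
  assumes "p \<in> {0..<1}" "vel p \<noteq> 0"
  shows "0 < per p" "F (per p / vel p) p = p" "\<And>y. 0 < y \<Longrightarrow> y < per p \<Longrightarrow> F (y / vel p) p \<noteq> p"
proof -
  obtain L where "0 < L \<and> F (L / vel p) p = p \<and> (\<forall>y. 0 < y \<longrightarrow> y < L \<longrightarrow> F (y / vel p) p \<noteq> p)"
    using minimal_period[OF assms] by metis
  then have "0 < per p \<and> F (per p / vel p) p = p \<and> (\<forall>y. 0 < y \<longrightarrow> y < per p \<longrightarrow> F (y / vel p) p \<noteq> p)"
    unfolding per_def if_not_P[OF assms(2)] by (rule someI)
  then show "0 < per p" "F (per p / vel p) p = p" "\<And>y. 0 < y \<Longrightarrow> y < per p \<Longrightarrow> F (y / vel p) p \<noteq> p"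
    by auto
qed

lemma per_pos: "p \<in> {0..<1} \<Longrightarrow> 0 < per p"
  using per_nonzero(1)[of p] lo_hi[of p] by (cases "vel p = 0") (auto simp: per_def)

text \<open>Whole periods fix \<open>p\<close>, so every parameter can be brought into the domain of
  the chart; \<open>frac\<close> matches the reduction in \<open>torus_class\<close>.\<close>

lemma F_mod_per:
  assumes p: "p \<in> {0..<1}" and c: "vel p \<noteq> 0"
  shows "F (y / vel p) p = F (per p * frac (y / per p) / vel p) p"
proof -
  let ?P = "per p / vel p"
  have nat: "F (real m * ?P) p = p" for m
  proof (induction m)
    case 0 then show ?case using F_zero[OF p] by simp
  next
    case (Suc m)
    have "real (Suc m) * ?P = ?P + real m * ?P" by (simp only: of_nat_Suc distrib_right mult_1)
    then show ?case using F_add[OF p] Suc per_nonzero(2)[OF p c] by simp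
  qed
  have int: "F (of_int m * ?P) p = p" for m
  proof (cases "0 \<le> m")
    case True then show ?thesis using nat[of "nat m"] by simp
  next
    case False
    then have "of_int m * ?P = - (real (nat (- m)) * ?P)" by simp
    then show ?thesis using F_minus[OF p] nat by metis
  qed
  have "y = per p * frac (y / per p) + of_int \<lfloor>y / per p\<rfloor> * per p"
    using per_pos[OF p] by (simp add: frac_def algebra_simps)
  then have "y / vel p = per p * frac (y / per p) / vel p + of_int \<lfloor>y / per p\<rfloor> * ?P"
    by (simp add: add_divide_distrib[symmetric])
  then show ?thesis using F_add[OF p] int by metis
qed

lemma chart_zero_piece:
  assumes "p \<in> {0..<1}" "vel p = 0" "y \<in> {0..<per p}"
  shows "chart p y \<in> piece l (idx p)"
  using assms lo_hi[of p] by (auto simp: chart_def per_def piece_def)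

lemma chart_unit:
  assumes "p \<in> {0..<1}" "y \<in> {0..<per p}"
  shows "chart p y \<in> {0..<1}"
proof (cases "vel p = 0")
  case True
  then show ?thesis using piece_unit[OF idx(1)[OF assms(1)] chart_zero_piece[OF assms(1) True assms(2)]] by simp
next
  case False
  then show ?thesis using F_unit[OF assms(1)] by (simp add: chart_def)
qed

lemma vel_chart:
  assumes "p \<in> {0..<1}" "y \<in> {0..<per p}"
  shows "vel (chart p y) = vel p"
proof (cases "vel p = 0")
  case True
  then show ?thesis using idx_eq[OF idx(1)[OF assms(1)] chart_zero_piece[OF assms(1) True assms(2)]]
    by (simp add: vel_def)
next
  case False
  then show ?thesis using vel_F[OF assms(1)] by (simp add: chart_def)
qed

text \<open>In a chart the flow is the rotation of a circle of length \<open>per p\<close>; charts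
  at rest fit the same formula with angle zero.\<close>

lemma F_chart:
  assumes p: "p \<in> {0..<1}" and y: "y \<in> {0..<per p}"
  shows "F t (chart p y) = chart p (per p * frac ((y + vel p * t) / per p))"
proof (cases "vel p = 0")
  case True
  have "F t (chart p y) = chart p y"
    using F_vel[OF chart_unit[OF p y], of t] lo_hi[OF chart_unit[OF p y]] vel_chart[OF p y] True by simp
  moreover have "frac (y / per p) = y / per p" using y by (auto simp: frac_eq)
  ultimately show ?thesis using True per_pos[OF p] by simp
next
  case False
  have "F t (chart p y) = F ((y + vel p * t) / vel p) p"
    using False F_add[OF p, of t "y / vel p"] by (simp add: chart_def add_divide_distrib add.commute)
  then show ?thesis using F_mod_per[OF p False] False by (simp add: chart_def)
qed

lemma inj_chart:
  assumes p: "p \<in> {0..<1}"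
  shows "inj_on (chart p) {0..<per p}"
proof (cases "vel p = 0")
  case True then show ?thesis by (auto simp: chart_def inj_on_def)
next
  case False
  have *: "\<not> y < y'" if "y \<in> {0..<per p}" "y' \<in> {0..<per p}" "chart p y = chart p y'" for y y'
  proof
    assume "y < y'"
    moreover have "F ((y' - y) / vel p) p = p"
      using F_diff[of "y' / vel p" p "y / vel p" p] that p False by (simp add: chart_def diff_divide_distrib)
    ultimately show False using per_nonzero(3)[OF p False, of "y' - y"] that by auto
  qed
  show ?thesis
  proof (rule inj_onI)
    fix y y' assume a: "y \<in> {0..<per p}" "y' \<in> {0..<per p}" "chart p y = chart p y'"
    show "y = y'" using *[OF a] *[OF a(2,1) a(3)[symmetric]] by simp
  qed
qed

text \<open>Two moving representatives on one orbit are both its least point in \<open>D\<close>;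
  two resting ones in the same piece are both its left end.\<close>

lemma chart_disjoint:
  assumes p: "p \<in> reps" "p' \<in> reps" and y: "y \<in> {0..<per p}" "y' \<in> {0..<per p'}"
    and eq: "chart p y = chart p' y'"
  shows "p = p'"
proof -
  have p01: "p \<in> {0..<1}" "p' \<in> {0..<1}" using p reps_unit by auto
  have veq: "vel p = vel p'" using vel_chart[OF p01(1) y(1)] vel_chart[OF p01(2) y(2)] eq by simp
  show ?thesis
  proof (cases "vel p = 0")
    case True
    have "idx p = idx p'"
      using chart_zero_piece[OF p01(1) _ y(1)] chart_zero_piece[OF p01(2) _ y(2)] True veq eq
        idx_eq idx(1)[OF p01(1)] idx(1)[OF p01(2)] by metis
    then show ?thesis using D_lo[OF reps_D[OF p(1)]] D_lo[OF reps_D[OF p(2)]] by simp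
  next
    case False
    have e: "F (y / vel p) p = F (y' / vel p) p'" using eq False veq by (simp add: chart_def)
    have "p \<le> p'" using F_diff[OF e p01] p False reps_D[OF p(2)] unfolding reps_def by force
    moreover have "p' \<le> p"
      using F_diff[OF e[symmetric] p01(2,1)] p False veq reps_D[OF p(1)] unfolding reps_def by force
    ultimately show ?thesis by simp
  qed
qed

lemma chart_surj:
  assumes x: "x \<in> {0..<1}"
  obtains p y where "p \<in> reps" "y \<in> {0..<per p}" "chart p y = x"
proof (cases "vel x = 0")
  case True
  define p where "p = lo (idx x)"
  have i: "idx x \<in> {1..n}" by (rule idx(1)[OF x])
  have ip: "idx p = idx x" unfolding p_def by (rule idx_eq[OF i lo_piece[OF i]])
  have "vel p = 0" using True ip by (simp add: vel_def)
  moreover have "p \<in> D" using i by (auto simp: D_def p_def)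
  ultimately show ?thesis
    using that[of p "x - p"] lo_hi[OF x] ip by (auto simp: reps_def per_def chart_def p_def)
next
  case False
  \<comment> \<open>The points of \<open>D\<close> on the orbit of \<open>x\<close>, of which the
    least represents the orbit.\<close>
  define H where "H = {p \<in> D. \<exists>s. F s x = p}"
  have finH: "finite H" using finite_D by (simp add: H_def)
  obtain y where "F (y / vel x) x \<in> D" using hits_D_after[OF x False] .
  then have neH: "H \<noteq> {}" by (auto simp: H_def)
  define p where "p = Min H"
  have "p \<in> H" unfolding p_def by (rule Min_in[OF finH neH])
  then obtain s where s: "p \<in> D" "p = F s x" by (auto simp: H_def)
  have p01: "p \<in> {0..<1}" by (rule D_unit[OF s(1)])
  have vp: "vel p = vel x" unfolding s(2) by (rule vel_F[OF x])
  have "p \<le> F t p" if "F t p \<in> D" for t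
  proof -
    have "F t p \<in> H" using that F_add[OF x, of t s] s(2) by (auto simp: H_def)
    then show ?thesis unfolding p_def by (rule Min_le[OF finH])
  qed
  then have "p \<in> reps" using s by (auto simp: reps_def)
  \<comment> \<open>Going from \<open>p\<close> back to \<open>x\<close> takes time
    \<open>- s\<close>; the corresponding distance is reduced modulo the period.\<close>
  moreover define y where "y = per p * frac (- s * vel p / per p)"
  have "F (- s) p = x" unfolding s(2) by (rule F_minus[OF x])
  then have "chart p y = x"
    using F_mod_per[OF p01, of "- s * vel p"] False vp by (simp add: chart_def y_def)
  moreover have "y \<in> {0..<per p}"
    using per_pos[OF p01] frac_lt_1[of "- s * vel p / per p"] by (simp add: y_def)
  ultimately show ?thesis using that by blast
qed

text \<open>A moving chart can break only where the orbit meets \<open>D\<close>, since between two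
  hits it runs inside one piece. Injectivity of the chart makes these breaks finite in
  number.\<close>

lemma chart_translation:
  assumes p: "p \<in> {0..<1}"
  obtains B where "finite B"
    "\<And>x y. \<lbrakk>x \<in> {0..<per p}; y \<in> {0..<per p}; x \<le> y; B \<inter> {x<..y} = {}\<rbrakk> \<Longrightarrow> chart p y - chart p x = y - x"
proof (cases "vel p = 0")
  case True then show ?thesis using that[of "{}"] by (simp add: chart_def)
next
  case False
  define B where "B = chart p -` D \<inter> {0..<per p}"
  show ?thesis
  proof (rule that[of B])
    show "finite B" unfolding B_def by (rule finite_vimage_IntI[OF finite_D inj_chart[OF p]])
    fix x y assume xy: "x \<in> {0..<per p}" "y \<in> {0..<per p}" "x \<le> y" and B: "B \<inter> {x<..y} = {}"
    define z where "z = chart p x"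
    have z: "z \<in> {0..<1}" "vel z = vel p"
      unfolding z_def using chart_unit[OF p xy(1)] vel_chart[OF p xy(1)] by auto
    have add: "chart p (x + w) = F (w / vel p) z" for w
      using False F_add[OF p, of "w / vel p" "x / vel p"] by (simp add: z_def chart_def add_divide_distrib add.commute)
    have "z + (y - x) < hi (idx z)"
    proof (rule ccontr)
      assume neg: "\<not> ?thesis"
      define w where "w = hi (idx z) - z"
      have w: "0 < w" "w \<le> y - x" using neg lo_hi[OF z(1)] by (auto simp: w_def)
      have "chart p (x + w) \<in> D" unfolding add using exit[OF z(1)] z False by (simp add: w_def)
      then have "x + w \<in> B \<inter> {x<..y}" using w xy by (auto simp: B_def)
      then show False using B by blast
    qed
    then have "F ((y - x) / vel p) z = z + (y - x)"
      using F_vel[OF z(1), of "(y - x) / vel p"] z lo_hi[OF z(1)] xy False by simp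
    then show "chart p y - chart p x = y - x" using add[of "y - x"] by (simp add: z_def)
  qed
qed

section \<open>Conjugation to rotations of intervals\<close>

lemma sum_per: "(\<Sum>p\<in>reps. per p) = 1"
proof -
  \<comment> \<open>These images are disjoint, cover the unit interval and have measure
    \<open>per p\<close>; hence the periods can serve as the lengths of a standard torus
    action.\<close>
  let ?I = "\<lambda>p. chart p ` {0..<per p}"
  have m: "?I p \<in> sets lborel \<and> emeasure lborel (?I p) = ennreal (per p)" if "p \<in> reps" for p
  proof -
    have p: "p \<in> {0..<1}" using that by (rule reps_unit)
    obtain B where B: "finite B"
      "\<And>x y. \<lbrakk>x \<in> {0..<per p}; y \<in> {0..<per p}; x \<le> y; B \<inter> {x<..y} = {}\<rbrakk> \<Longrightarrow> chart p y - chart p x = y - x"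
      by (rule chart_translation[OF p]) (rule that)
    have "?I p \<in> sets lborel \<and> emeasure lborel (?I p) = ennreal (per p - 0)"
      by (rule emeasure_piecewise_translation_image[OF B(1) _ inj_chart[OF p] B(2)])
        (use per_pos[OF p] in simp_all)
    then show ?thesis by simp
  qed
  have "(\<Union>p\<in>reps. ?I p) = {0..<1}"
  proof (intro subset_antisym subsetI)
    fix x assume "x \<in> (\<Union>p\<in>reps. ?I p)"
    then show "x \<in> {0..<1}" using chart_unit[OF reps_unit] by blast
  next
    fix x :: real assume "x \<in> {0..<1}"
    then show "x \<in> (\<Union>p\<in>reps. ?I p)" by (rule chart_surj) blast
  qed
  moreover have "(\<Sum>p\<in>reps. emeasure lborel (?I p)) = emeasure lborel (\<Union>p\<in>reps. ?I p)"
  proof (rule sum_emeasure)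
    show "disjoint_family_on ?I reps"
      unfolding disjoint_family_on_def using chart_disjoint by blast
  qed (use m finite_reps in auto)
  moreover have "(\<Sum>p\<in>reps. emeasure lborel (?I p)) = (\<Sum>p\<in>reps. ennreal (per p))"
    using m by (intro sum.cong) auto
  moreover have "\<dots> = ennreal (\<Sum>p\<in>reps. per p)"
    using per_pos[OF reps_unit] by (intro sum_ennreal) (auto intro: less_imp_le)
  ultimately show ?thesis by simp
qed

text \<open>Arcs of lengths \<open>per p\<close> are laid side by side in the unit interval. The map
  \<open>h\<close> sends each arc to its orbit, or to its resting piece, by the chart, and so turns
  rotations of the arcs into \<open>F\<close>.\<close>

theorem rotation_action: "rotation_action F"
proof -
  interpret G: group IET_group by (rule group_IET_group)
  define N where "N = card reps"
  obtain e where e: "bij_betw e {1..N} reps"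
    using ex_bij_betw_nat_finite_1[OF finite_reps] unfolding N_def by blast
  have er: "e j \<in> reps" if "j \<in> {1..N}" for j using e that by (rule bij_betwE[THEN bspec])
  have eu: "e j \<in> {0..<1}" if "j \<in> {1..N}" for j using er[OF that] by (rule reps_unit)
  define m where "m = (\<lambda>j\<in>{1..N}. per (e j))"
  have mpos: "0 < m j" if "j \<in> {1..N}" for j using per_pos[OF eu[OF that]] that by (simp add: m_def)
  have "(\<Sum>j=1..N. m j) = (\<Sum>j=1..N. per (e j))" by (intro sum.cong) (auto simp: m_def)
  also have "\<dots> = 1" using sum.reindex_bij_betw[OF e, of per] sum_per by simp
  finally have msum: "(\<Sum>j=1..N. m j) = 1" .
  then have N1: "1 \<le> N" by (cases N) auto
  have mL: "m \<in> Lambda N" using mpos msum by (auto simp: Lambda_def m_def)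
  have mnn: "\<forall>j\<in>{1..N}. 0 \<le> m j" and m1: "breakpoint m N = 1"
    using mpos msum by (auto simp: breakpoint_def less_imp_le)
  define b where "b = breakpoint m"
  have pc: "piece m j = {b (j - 1)..<b (j - 1) + per (e j)}" and bs: "b j = b (j - 1) + per (e j)"
    if "j \<in> {1..N}" for j
    using that breakpoint_step[of j m] by (auto simp: piece_def b_def m_def)
  define h where "h = (\<lambda>x\<in>{0..<1}. let j = (THE j. j \<in> {1..N} \<and> x \<in> piece m j) in chart (e j) (x - b (j - 1)))"
  have h: "h x = chart (e j) (x - b (j - 1))" "x - b (j - 1) \<in> {0..<per (e j)}"
    if "j \<in> {1..N}" "x \<in> piece m j" for j x
    using THE_piece[OF mnn that] piece_subset[OF mnn m1 that(1)] that(2) pc[OF that(1)]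
    by (auto simp: h_def Let_def)
  have "inj_on h {0..<1}"
  proof (rule inj_onI)
    fix x y :: real assume "x \<in> {0..<1}" "y \<in> {0..<1}" and eq: "h x = h y"
    then obtain j k where j: "j \<in> {1..N}" "x \<in> piece m j" and k: "k \<in> {1..N}" "y \<in> piece m k"
      using piece_exists[OF m1] by metis
    have "e j = e k"
      using chart_disjoint[OF er[OF j(1)] er[OF k(1)] h(2)[OF j] h(2)[OF k]] eq h(1)[OF j] h(1)[OF k] by simp
    then have jk: "j = k" using e j k by (auto simp: bij_betw_def dest: inj_onD)
    have "x - b (j - 1) = y - b (j - 1)"
      using inj_onD[OF inj_chart[OF eu[OF j(1)]] _ h(2)[OF j]] h[OF k] h(1)[OF j] eq jk by simp
    then show "x = y" by simp
  qed
  moreover have "h ` {0..<1} = {0..<1}"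
  proof (intro subset_antisym subsetI)
    fix y assume "y \<in> h ` {0..<1}"
    then obtain x where x: "x \<in> {0..<1}" "y = h x" by blast
    obtain j where j: "j \<in> {1..N}" "x \<in> piece m j" using piece_exists[OF m1 x(1)] .
    show "y \<in> {0..<1}" using chart_unit[OF eu[OF j(1)] h(2)[OF j]] h(1)[OF j] x by simp
  next
    fix x :: real assume "x \<in> {0..<1}"
    then obtain p y where py: "p \<in> reps" "y \<in> {0..<per p}" "chart p y = x" using chart_surj by blast
    moreover have "reps = e ` {1..N}" using e by (simp only: bij_betw_def)
    ultimately obtain j where j: "j \<in> {1..N}" "p = e j" by blast
    have z: "b (j - 1) + y \<in> piece m j" using py j pc[OF j(1)] by auto
    have "h (b (j - 1) + y) = x" using h(1)[OF j(1) z] py j by simp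
    then show "x \<in> h ` {0..<1}" using z piece_subset[OF mnn m1 j(1)] by (metis image_eqI subsetD)
  qed
  ultimately have "h \<in> Bij {0..<1}" by (auto simp: Bij_def bij_betw_def h_def)
  moreover have "piecewise_translation h"
  proof -
    have "\<forall>j\<in>{1..N}. \<exists>B. finite B \<and> (\<forall>x y. x \<in> {0..<per (e j)} \<longrightarrow> y \<in> {0..<per (e j)} \<longrightarrow>
        x \<le> y \<longrightarrow> B \<inter> {x<..y} = {} \<longrightarrow> chart (e j) y - chart (e j) x = y - x)"
      using chart_translation[OF eu] by metis
    then obtain B where B: "\<And>j. j \<in> {1..N} \<Longrightarrow> finite (B j)"
      "\<And>j x y. \<lbrakk>j \<in> {1..N}; x \<in> {0..<per (e j)}; y \<in> {0..<per (e j)}; x \<le> y; B j \<inter> {x<..y} = {}\<rbrakk>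
        \<Longrightarrow> chart (e j) y - chart (e j) x = y - x"
      by metis
    \<comment> \<open>\<open>h\<close> can break only at the ends of the arcs and at the breaks of
      the charts, moved to their arcs.\<close>
    define C where "C = b ` {0..N} \<union> (\<Union>j\<in>{1..N}. (\<lambda>z. b (j - 1) + z) ` B j)"
    show ?thesis
      unfolding piecewise_translation_def
    proof (intro exI[of _ C] conjI ballI impI)
      show "finite C" using B(1) by (auto simp: C_def)
      fix x y :: real assume xy: "x \<in> {0..<1}" "y \<in> {0..<1}" "x \<le> y" and C: "C \<inter> {x<..y} = {}"
      obtain j where j: "j \<in> {1..N}" "x \<in> piece m j" using piece_exists[OF m1 xy(1)] .
      have "b j \<in> C" using j(1) by (auto simp: C_def)
      then have "b j \<notin> {x<..y}" using C by blast
      then have y: "y \<in> piece m j" using j xy pc[OF j(1)] bs[OF j(1)] by auto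
      have "B j \<inter> {x - b (j - 1)<..y - b (j - 1)} = {}"
      proof (rule ccontr)
        assume "\<not> ?thesis"
        then obtain z where "z \<in> B j" "x - b (j - 1) < z" "z \<le> y - b (j - 1)" by auto
        then have "b (j - 1) + z \<in> C \<inter> {x<..y}" using j(1) by (auto simp: C_def)
        then show False using C by blast
      qed
      then show "h y - h x = y - x"
        using B(2)[OF j(1) h(2)[OF j] h(2)[OF j(1) y]] xy h(1)[OF j] h(1)[OF j(1) y] by simp
    qed
  qed
  ultimately have hI: "h \<in> IET" by (simp add: IET_iff)
  \<comment> \<open>Torus coordinates are relative to the lengths, so each speed is divided by the
    period.\<close>
  define a where "a = (\<lambda>j\<in>{1..N}. vel (e j) / per (e j))"
  define R where "R = (\<lambda>t. torus_exchange N (torus_class N (\<lambda>j. t * a j)) m)"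
  have RI: "R t \<in> IET" for t
    unfolding R_def by (rule torus_exchange_in_IET[OF mL]) (auto simp: torus_class_def frac_lt_1)
  have conj: "F t \<otimes>\<^bsub>IET_group\<^esub> h = h \<otimes>\<^bsub>IET_group\<^esub> R t" for t
  proof -
    have "F t (h x) = h (R t x)" if x: "x \<in> {0..<1}" for x
    proof -
      obtain j where j: "j \<in> {1..N}" "x \<in> piece m j" using piece_exists[OF m1 x] .
      define y where "y = x - b (j - 1)"
      define P where "P = per (e j)"
      define f where "f = frac (t * vel (e j) / P)"
      have y: "y \<in> {0..<P}" using h(2)[OF j] by (simp add: y_def P_def)
      have P: "0 < P" unfolding P_def by (rule per_pos[OF eu[OF j(1)]])
      have f: "0 \<le> P * f" "P * f < P" using P frac_lt_1[of "t * vel (e j) / P"] by (auto simp: f_def)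
      have yP: "frac (y / P) = y / P" using y P by (auto simp: frac_eq)
      \<comment> \<open>In the local coordinate \<open>y\<close> on the arc, the case distinction of
        \<open>torus_exchange\<close> becomes the one in the addition formula for
        \<open>frac\<close>.\<close>
      have Rx: "R t x = (if y + P * f < P then b (j - 1) + (y + P * f) else b (j - 1) + (y + P * f - P))"
      proof -
        have mj: "m j = P" using j(1) by (simp add: m_def P_def)
        have tc: "torus_class N (\<lambda>j. t * a j) j = f"
          using j(1) by (simp add: torus_class_def a_def f_def P_def)
        have "R t x = (if x < b j - P * f then x + P * f else x + P * f - P)"
          using x THE_piece[OF mnn j] by (simp add: R_def torus_exchange_def Let_def mj tc b_def)
        then show ?thesis using bs[OF j(1)] by (auto simp: y_def P_def)
      qed
      have fr: "P * frac ((y + vel (e j) * t) / P) = (if y + P * f < P then y + P * f else y + P * f - P)"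
      proof -
        have "(y + vel (e j) * t) / P = y / P + t * vel (e j) / P" by (simp add: add_divide_distrib mult.commute)
        then have "frac ((y + vel (e j) * t) / P) = (if y / P + f < 1 then y / P + f else y / P + f - 1)"
          using frac_add[of "y / P" "t * vel (e j) / P"] yP by (simp add: f_def)
        moreover have "y / P + f < 1 \<longleftrightarrow> y + P * f < P" using P by (simp add: field_simps)
        ultimately show ?thesis using P by (simp add: field_simps)
      qed
      have "b (j - 1) \<le> R t x \<and> R t x < b (j - 1) + P"
      proof (cases "y + P * f < P")
        case True
        then have "R t x = b (j - 1) + (y + P * f)" using Rx by (simp only: if_True)
        then show ?thesis using f y True unfolding atLeastLessThan_iff by linarith
      next
        case False
        then have "R t x = b (j - 1) + (y + P * f - P)" using Rx by (simp only: if_False)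
        then show ?thesis using f y False unfolding atLeastLessThan_iff by linarith
      qed
      moreover have "R t x - b (j - 1) = P * frac ((y + vel (e j) * t) / P)"
        unfolding Rx fr by simp
      ultimately have Rj: "R t x \<in> piece m j" "R t x - b (j - 1) = P * frac ((y + vel (e j) * t) / P)"
        unfolding pc[OF j(1)] by (simp_all add: P_def)
      have "F t (h x) = chart (e j) (P * frac ((y + vel (e j) * t) / P))"
        using F_chart[OF eu[OF j(1)], of y t] h(1)[OF j] y by (simp add: y_def P_def)
      then show ?thesis using h(1)[OF j(1) Rj(1)] Rj(2) by simp
    qed
    then show ?thesis
      unfolding IET_mult[OF F_IET hI] IET_mult[OF hI RI] by (auto simp: compose_def fun_eq_iff)
  qed
  have "F t = h \<otimes>\<^bsub>IET_group\<^esub> R t \<otimes>\<^bsub>IET_group\<^esub> inv\<^bsub>IET_group\<^esub> h" for t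
  proof -
    have "F t \<in> carrier IET_group" "h \<in> carrier IET_group"
      using F_IET hI by (simp_all add: carrier_IET_group)
    then show ?thesis unfolding conj[symmetric] by (simp add: G.m_assoc)
  qed
  moreover have "a \<in> {1..N} \<rightarrow>\<^sub>E UNIV" by (auto simp: a_def)
  ultimately show ?thesis
    unfolding rotation_action_def R_def using hom N1 mL hI by blast
qed

end

section \<open>Separation\<close>

lemma topological_group_mult:
  assumes "topological_group G T" "continuous_map X T f" "continuous_map X T g"
  shows "continuous_map X T (\<lambda>x. f x \<otimes>\<^bsub>G\<^esub> g x)"
proof -
  have "continuous_map X T ((\<lambda>(x, y). x \<otimes>\<^bsub>G\<^esub> y) \<circ> (\<lambda>x. (f x, g x)))"
    using assms by (intro continuous_map_compose[of _ "prod_topology T T"])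
      (auto simp: topological_group_def continuous_map_paired)
  then show ?thesis by (simp add: o_def)
qed

lemma topological_group_inv:
  assumes "topological_group G T" "continuous_map X T f"
  shows "continuous_map X T (\<lambda>x. inv\<^bsub>G\<^esub> f x)"
proof -
  have "continuous_map X T ((\<lambda>x. inv\<^bsub>G\<^esub> x) \<circ> f)"
    using assms by (intro continuous_map_compose) (auto simp: topological_group_def)
  then show ?thesis by (simp add: o_def)
qed

lemma interval_exchange_IET:
  "1 \<le> n \<Longrightarrow> unpartitioned n \<pi> \<Longrightarrow> l \<in> Lambda n \<Longrightarrow> interval_exchange n \<pi> l \<in> IET"
  unfolding IET_def unpartitioned_def by blast

text \<open>Together with the transposition of 2 and 3, these lengths describe the exchange of the
  two adjacent intervals of length \<open>e\<close> that start at \<open>a\<close>.\<close>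

definition swap_lengths :: "real \<Rightarrow> real \<Rightarrow> nat \<Rightarrow> real" where
  "swap_lengths a e = (\<lambda>i\<in>{1..4}. if i = 1 then a else if i = 4 then 1 - a - 2 * e else e)"

lemma swap_lengths_Lambda:
  assumes "0 < a" "0 < e" "a + 2 * e < 1"
  shows "swap_lengths a e \<in> Lambda 4"
proof -
  have "{1..4} = {1, 2, 3, 4::nat}" by auto
  then show ?thesis using assms by (auto simp: Lambda_def swap_lengths_def)
qed

lemma unpartitioned_transpose: "unpartitioned 4 (Transposition.transpose 2 3)"
proof -
  have "{1..<4} = {1, 2, 3::nat}" by auto
  moreover have "Transposition.transpose 2 3 permutes {1..4::nat}" by (rule permutes_swap_id) auto
  ultimately show ?thesis by (auto simp: unpartitioned_def Transposition.transpose_def)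
qed

lemma interval_exchange_swap:
  assumes a: "0 < a" "0 < e" "a + 2 * e < 1" and x: "x \<in> {0..<1}"
  shows "interval_exchange 4 (Transposition.transpose 2 3) (swap_lengths a e) x =
    (if a \<le> x \<and> x < a + e then x + e else if a + e \<le> x \<and> x < a + 2 * e then x - e else x)"
proof -
  let ?l = "swap_lengths a e" and ?f = "interval_exchange 4 (Transposition.transpose 2 3) (swap_lengths a e)"
  have L: "?l \<in> Lambda_closed 4" using swap_lengths_Lambda[OF a] Lambda_subset_closed[of 4] by auto
  note lD = Lambda_closedD(1,2)[OF _ L, simplified]
  have S1: "{1..4} = {1, 2, 3, 4::nat}" "{1..3} = {1, 2, 3::nat}" "{1..2} = {1, 2::nat}" by auto
  have bp: "breakpoint ?l 0 = 0" "breakpoint ?l 1 = a" "breakpoint ?l 2 = a + e"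
    "breakpoint ?l 3 = a + 2 * e" "breakpoint ?l 4 = 1"
    unfolding breakpoint_def S1 by (simp_all add: swap_lengths_def)
  have f: "?f x = x + shift 4 (Transposition.transpose 2 3) ?l j"
    if "j \<in> {1..4}" "breakpoint ?l (j - 1) \<le> x" "x < breakpoint ?l j" for j
    by (rule interval_exchange_eq) (use lD that in \<open>auto simp: piece_def\<close>)
  have S2: "{i. i \<in> {1..4} \<and> Transposition.transpose 2 3 i < Transposition.transpose 2 3 (1::nat)} = {}"
    "{i. i \<in> {1..4} \<and> Transposition.transpose 2 3 i < Transposition.transpose 2 3 (2::nat)} = {1, 3}"
    "{i. i \<in> {1..4} \<and> Transposition.transpose 2 3 i < Transposition.transpose 2 3 (3::nat)} = {1}"
    "{i. i \<in> {1..4} \<and> Transposition.transpose 2 3 i < Transposition.transpose 2 3 (4::nat)} = {1, 2, 3}"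
    "{i. i \<in> {1..4} \<and> i < (1::nat)} = {}" "{i. i \<in> {1..4} \<and> i < (2::nat)} = {1}"
    "{i. i \<in> {1..4} \<and> i < (3::nat)} = {1, 2}" "{i. i \<in> {1..4} \<and> i < (4::nat)} = {1, 2, 3}"
    unfolding S1 by (auto simp: Transposition.transpose_def)
  have sh: "shift 4 (Transposition.transpose 2 3) ?l 1 = 0" "shift 4 (Transposition.transpose 2 3) ?l 2 = e"
    "shift 4 (Transposition.transpose 2 3) ?l 3 = - e" "shift 4 (Transposition.transpose 2 3) ?l 4 = 0"
    unfolding shift_def S2 by (simp_all add: swap_lengths_def)
  consider "x < a" | "a \<le> x" "x < a + e" | "a + e \<le> x" "x < a + 2 * e" | "a + 2 * e \<le> x" by linarith
  then show ?thesis
  proof cases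
    case 1 then show ?thesis using f[of 1] sh bp x a by simp
  next
    case 2 then show ?thesis using f[of 2] sh bp x a by simp
  next
    case 3 then show ?thesis using f[of 3] sh bp x a by simp
  next
    case 4 then show ?thesis using f[of 4] sh bp x a by simp
  qed
qed

text \<open>Near some point \<open>h\<close> is a translation by a nonzero \<open>w\<close>, so
  conjugating a swap supported there gives the same swap moved by \<open>w\<close>. Both are values
  of one coordinate map at distinct points, which the embedding hypothesis can tell apart.\<close>

lemma conjugate_swap:
  assumes "h \<in> IET" "h \<noteq> \<one>\<^bsub>IET_group\<^esub>"
  obtains a b e where "a \<noteq> b" "swap_lengths a e \<in> Lambda 4" "swap_lengths b e \<in> Lambda 4"
    "h \<otimes>\<^bsub>IET_group\<^esub> interval_exchange 4 (Transposition.transpose 2 3) (swap_lengths a e) \<otimes>\<^bsub>IET_group\<^esub> inv\<^bsub>IET_group\<^esub> h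
      = interval_exchange 4 (Transposition.transpose 2 3) (swap_lengths b e)"
proof -
  interpret G: group IET_group by (rule group_IET_group)
  have one: "\<one>\<^bsub>IET_group\<^esub> = (\<lambda>x\<in>{0..<1}. x)" by (simp add: IET_group_def BijGroup_def)
  have "\<one>\<^bsub>IET_group\<^esub> \<in> IET" using G.one_closed by (simp add: carrier_IET_group)
  then have "\<exists>x\<in>{0..<1}. h x \<noteq> x"
    using IET_eqI[OF assms(1), of "\<one>\<^bsub>IET_group\<^esub>"] assms(2) by (auto simp: one)
  then obtain x where x: "x \<in> {0..<1}" "h x \<noteq> x" by blast
  obtain d where d: "0 < d" "x + d \<le> 1" "\<And>y. x \<le> y \<Longrightarrow> y < x + d \<Longrightarrow> h y = h x + (y - x)"
    using IET_right_translation[OF assms(1) x(1)] by metis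
  define w where "w = h x - x"
  \<comment> \<open>The middle of the interval rather than its left end: \<open>x\<close> or
    \<open>h x\<close> may be \<open>0\<close>, while both swaps need a first piece of positive
    length.\<close>
  define a where "a = x + d / 2"
  define e where "e = d / 8"
  have hy: "h y = y + w" if "x \<le> y" "y < x + d" for y using d(3)[OF that] by (simp add: w_def)
  have a: "0 < a" "0 < e" "a + 2 * e < 1" using x(1) d(1,2) by (auto simp: a_def e_def)
  have "h x \<in> {0..<1}" "h (a + 2 * e) \<in> {0..<1}"
    using IET_in_unit[OF assms(1), of x] IET_in_unit[OF assms(1), of "a + 2 * e"] x(1) a by auto
  moreover have "h (a + 2 * e) = a + 2 * e + w" using d(1) by (intro hy) (auto simp: a_def e_def)
  ultimately have b: "0 < a + w" "a + w + 2 * e < 1" using d(1) by (auto simp: w_def a_def)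
  let ?S = "\<lambda>c. interval_exchange 4 (Transposition.transpose 2 3) (swap_lengths c e)"
  note La = swap_lengths_Lambda[OF a] and Lb = swap_lengths_Lambda[OF b(1) a(2) b(2)]
  have SI: "?S a \<in> IET" "?S (a + w) \<in> IET"
    using La Lb by (intro interval_exchange_IET unpartitioned_transpose; simp)+
  have "h (?S a y) = ?S (a + w) (h y)" if y: "y \<in> {0..<1}" for y
  proof (cases "a \<le> y \<and> y < a + 2 * e")
    case True
    have hS: "h z = z + w" if "a \<le> z" "z < a + 2 * e" for z
      using that d(1) by (intro hy) (auto simp: a_def e_def)
    have "h y \<in> {0..<1}" by (rule IET_in_unit[OF assms(1) y])
    then show ?thesis
      using True hS[of y] hS[of "y + e"] hS[of "y - e"] y a(2)
      by (auto simp: interval_exchange_swap[OF a y] interval_exchange_swap[OF b(1) a(2) b(2)])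
  next
    case False
    have hy01: "h y \<in> {0..<1}" by (rule IET_in_unit[OF assms(1) y])
    \<comment> \<open>By injectivity, a point outside the support of the first swap goes outside the
      support of the second.\<close>
    have "\<not> (a + w \<le> h y \<and> h y < a + w + 2 * e)"
    proof
      assume c: "a + w \<le> h y \<and> h y < a + w + 2 * e"
      define z where "z = h y - w"
      have "h z = h y" using c d(1) hy[of z] by (auto simp: z_def a_def e_def)
      moreover have "z \<in> {0..<1}" using c a by (auto simp: z_def)
      ultimately have "z = y" using IET_inj[OF assms(1)] y by blast
      then show False using False c by (auto simp: z_def)
    qed
    then show ?thesis using False a(2)
      by (auto simp: interval_exchange_swap[OF a y] interval_exchange_swap[OF b(1) a(2) b(2) hy01])
  qed
  then have "h \<otimes>\<^bsub>IET_group\<^esub> ?S a = ?S (a + w) \<otimes>\<^bsub>IET_group\<^esub> h"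
    unfolding IET_mult[OF assms(1) SI(1)] IET_mult[OF SI(2) assms(1)]
    by (auto simp: compose_def fun_eq_iff)
  moreover have "h \<in> carrier IET_group" "?S (a + w) \<in> carrier IET_group"
    using assms(1) SI by (simp_all add: carrier_IET_group)
  ultimately have "h \<otimes>\<^bsub>IET_group\<^esub> ?S a \<otimes>\<^bsub>IET_group\<^esub> inv\<^bsub>IET_group\<^esub> h = ?S (a + w)"
    by (simp add: G.m_assoc)
  then show ?thesis using that[of a "a + w" e] La Lb x by (simp add: w_def)
qed

text \<open>It is enough to find, for each \<open>h\<close> other than the identity, a neighbourhood
  of the identity that misses \<open>h\<close>; the group operations spread this separation to all
  pairs.\<close>

lemma Hausdorff_space_IET:
  assumes tg: "topological_group IET_group T"
    and emb: "embedding_map (subtopology (powertop_real {1..4}) (Lambda 4)) T (interval_exchange 4 (Transposition.transpose 2 3))"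
  shows "Hausdorff_space T"
proof -
  interpret G: group IET_group by (rule group_IET_group)
  have topT: "topspace T = carrier IET_group" using tg by (simp add: topological_group_def)
  let ?X = "subtopology (powertop_real {1..4}) (Lambda 4)"
  let ?\<Gamma> = "interval_exchange 4 (Transposition.transpose 2 3)"
  have topX: "topspace ?X = Lambda 4" by (auto simp: Lambda_def)
  have haus: "Hausdorff_space ?X"
    by (simp add: Hausdorff_space_subtopology Hausdorff_space_product_topology)
  have hom: "homeomorphic_map ?X (subtopology T (?\<Gamma> ` Lambda 4)) ?\<Gamma>"
    using emb unfolding embedding_map_def topX .
  have sep: "\<exists>V. openin T V \<and> \<one>\<^bsub>IET_group\<^esub> \<in> V \<and> h \<notin> V"
    if h: "h \<in> carrier IET_group" "h \<noteq> \<one>\<^bsub>IET_group\<^esub>" for h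
  proof (rule ccontr)
    assume neg: "\<not> ?thesis"
    obtain a b e where ab: "a \<noteq> b" "swap_lengths a e \<in> Lambda 4" "swap_lengths b e \<in> Lambda 4"
      and conj: "h \<otimes>\<^bsub>IET_group\<^esub> ?\<Gamma> (swap_lengths a e) \<otimes>\<^bsub>IET_group\<^esub> inv\<^bsub>IET_group\<^esub> h = ?\<Gamma> (swap_lengths b e)"
      using conjugate_swap[of h] h unfolding carrier_IET_group by metis
    have "swap_lengths a e \<noteq> swap_lengths b e"
      using ab(1) by (auto simp: swap_lengths_def dest: fun_cong[of _ _ 1])
    then obtain U where U: "openin ?X U" "swap_lengths a e \<in> U" "swap_lengths b e \<notin> U"
      using haus ab unfolding Hausdorff_space_def topX by (metis disjnt_iff)
    have "openin (subtopology T (?\<Gamma> ` Lambda 4)) (?\<Gamma> ` U)"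
      using homeomorphic_imp_open_map[OF hom] U(1) by (auto simp: open_map_def)
    then obtain W where W: "openin T W" "?\<Gamma> ` U = W \<inter> ?\<Gamma> ` Lambda 4"
      by (auto simp: openin_subtopology)
    \<comment> \<open>\<open>\<psi> x\<close> conjugates the swap by \<open>x\<close>. If every open
      set around the identity contained \<open>h\<close>, the value at \<open>h\<close> would lie in
      \<open>W\<close>, hence in the image of \<open>U\<close>, against the choice of
      \<open>U\<close>.\<close>
    define \<psi> where "\<psi> = (\<lambda>x. x \<otimes>\<^bsub>IET_group\<^esub> ?\<Gamma> (swap_lengths a e) \<otimes>\<^bsub>IET_group\<^esub> inv\<^bsub>IET_group\<^esub> x)"
    have \<Gamma>c: "?\<Gamma> (swap_lengths a e) \<in> carrier IET_group"
      using ab(2) unfolding carrier_IET_group by (intro interval_exchange_IET unpartitioned_transpose) simp_all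
    have "continuous_map T T \<psi>"
      unfolding \<psi>_def using \<Gamma>c topT
      by (intro topological_group_mult[OF tg] topological_group_inv[OF tg]) auto
    then have o: "openin T {x \<in> topspace T. \<psi> x \<in> W}" using W(1) openin_continuous_map_preimage by blast
    have "\<psi> \<one>\<^bsub>IET_group\<^esub> \<in> W" using U(2) W(2) \<Gamma>c by (auto simp: \<psi>_def)
    then have "\<one>\<^bsub>IET_group\<^esub> \<in> {x \<in> topspace T. \<psi> x \<in> W}" using topT by simp
    then have "h \<in> {x \<in> topspace T. \<psi> x \<in> W}" using neg o by blast
    then have "?\<Gamma> (swap_lengths b e) \<in> ?\<Gamma> ` U" using W(2) conj ab(3) by (auto simp: \<psi>_def)
    then obtain u where u: "u \<in> U" "?\<Gamma> (swap_lengths b e) = ?\<Gamma> u" by auto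
    have "inj_on ?\<Gamma> (Lambda 4)" using homeomorphic_imp_injective_map[OF hom] topX by simp
    then have "swap_lengths b e = u"
      using u ab(3) openin_subset[OF U(1)] topX by (auto dest: inj_onD)
    then show False using u U(3) by simp
  qed
  show ?thesis
    unfolding Hausdorff_space_def topT
  proof (intro allI impI)
    fix f g assume fg: "f \<in> carrier IET_group \<and> g \<in> carrier IET_group \<and> f \<noteq> g"
    define h where "h = inv\<^bsub>IET_group\<^esub> f \<otimes>\<^bsub>IET_group\<^esub> g"
    have h: "h \<in> carrier IET_group" using fg by (simp add: h_def)
    have "f \<otimes>\<^bsub>IET_group\<^esub> h = g" using fg by (simp add: h_def G.m_assoc[symmetric])
    then have "h \<noteq> \<one>\<^bsub>IET_group\<^esub>" using fg by auto
    then obtain V where V: "openin T V" "\<one>\<^bsub>IET_group\<^esub> \<in> V" "h \<notin> V" using sep h by blast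
    \<comment> \<open>\<open>\<phi>\<close> is the identity at \<open>(f, g)\<close> and equals
      \<open>h\<close> on the diagonal, so the preimage of \<open>V\<close> is open around
      \<open>(f, g)\<close> and misses the diagonal.\<close>
    define \<phi> where "\<phi> = (\<lambda>(x, y). inv\<^bsub>IET_group\<^esub> (inv\<^bsub>IET_group\<^esub> x \<otimes>\<^bsub>IET_group\<^esub> y) \<otimes>\<^bsub>IET_group\<^esub> h)"
    have "continuous_map (prod_topology T T) T
        (\<lambda>p. inv\<^bsub>IET_group\<^esub> (inv\<^bsub>IET_group\<^esub> (fst p) \<otimes>\<^bsub>IET_group\<^esub> snd p) \<otimes>\<^bsub>IET_group\<^esub> h)"
      using h topT
      by (intro topological_group_mult[OF tg] topological_group_inv[OF tg] continuous_map_fst continuous_map_snd) auto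
    then have "continuous_map (prod_topology T T) T \<phi>" by (simp add: \<phi>_def case_prod_unfold)
    moreover define Q where "Q = {p \<in> topspace (prod_topology T T). \<phi> p \<in> V}"
    ultimately have o: "openin (prod_topology T T) Q"
      using V(1) openin_continuous_map_preimage by blast
    have "\<phi> (f, g) = \<one>\<^bsub>IET_group\<^esub>" using h by (simp add: \<phi>_def h_def[symmetric])
    then have fgQ: "(f, g) \<in> Q" using fg V(2) topT by (simp add: Q_def)
    have "\<exists>A B. openin T A \<and> openin T B \<and> f \<in> A \<and> g \<in> B \<and> A \<times> B \<subseteq> Q"
      using iffD1[OF openin_prod_topology_alt o] fgQ by (elim allE impE)
    then obtain A B where AB: "openin T A" "openin T B" "f \<in> A" "g \<in> B" "A \<times> B \<subseteq> Q"
      by (elim exE conjE)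
    have "False" if x: "x \<in> A" "x \<in> B" for x
    proof -
      have "x \<in> carrier IET_group" using openin_subset[OF AB(1)] x topT by auto
      then have "\<phi> (x, x) = h" using h by (simp add: \<phi>_def)
      then show False using AB(5) x V(3) by (auto simp: Q_def)
    qed
    then show "\<exists>U V. openin T U \<and> openin T V \<and> f \<in> U \<and> g \<in> V \<and> disjnt U V"
      using AB by (intro exI[of _ A] exI[of _ B]) (auto simp: disjnt_iff)
  qed
qed

section \<open>Continuous homomorphisms\<close>

lemma Baire_avoid:
  fixes C :: "'i \<Rightarrow> 'a::{real_normed_vector, heine_borel} set"
  assumes "countable I" "\<And>i. i \<in> I \<Longrightarrow> closed (C i)" "\<And>i. i \<in> I \<Longrightarrow> interior (C i) = {}"
    and U: "open U" "U \<noteq> {}"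
  obtains t where "t \<in> U" "\<And>i. i \<in> I \<Longrightarrow> t \<notin> C i"
proof -
  have "UNIV \<subseteq> closure (\<Inter>((\<lambda>i. - C i) ` I))"
    using assms(1-3) by (intro Baire) (auto simp: closure_complement open_closed[symmetric])
  then have "U \<inter> closure (\<Inter>((\<lambda>i. - C i) ` I)) \<noteq> {}" using U by auto
  then have "U \<inter> (\<Inter>((\<lambda>i. - C i) ` I)) \<noteq> {}" using open_Int_closure_eq_empty[OF U(1)] by blast
  then show ?thesis using that by blast
qed

lemma compactin_Lambda_closed:
  assumes "1 \<le> n"
  shows "compactin (powertop_real {1..n}) (Lambda_closed n)"
proof (rule closed_compactin)
  show "compactin (powertop_real {1..n}) ({1..n} \<rightarrow>\<^sub>E {0..1})"
    by (simp add: compactin_PiE)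
  show "closedin (powertop_real {1..n}) (Lambda_closed n)"
    by (simp add: Lambda_closed_def)
  show "Lambda_closed n \<subseteq> {1..n} \<rightarrow>\<^sub>E {0..1}"
  proof
    fix l assume "l \<in> Lambda_closed n"
    then have l: "l \<in> {1..n} \<rightarrow>\<^sub>E UNIV" "\<And>i. i \<in> {1..n} \<Longrightarrow> 0 \<le> l i" "(\<Sum>i=1..n. l i) = 1"
      using assms by (auto simp: Lambda_closed_eq)
    have "l i \<le> 1" if "i \<in> {1..n}" for i
      using member_le_sum[OF that, of l] l by auto
    then show "l \<in> {1..n} \<rightarrow>\<^sub>E {0..1}" using l by (auto simp: PiE_iff)
  qed
qed

text \<open>After subtracting the linear function with the same value at \<open>r\<close>, let the
  absolute value of the rest \<open>u\<close> be maximal on \<open>[0, r]\<close> at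
  \<open>x\<close>. Doubling \<open>x\<close>, or its reflection \<open>r - x\<close> if
  \<open>x\<close> lies in the right half, doubles this absolute value, so the maximum is
  \<open>0\<close>.\<close>

lemma locally_additive_imp_linear:
  fixes w :: "real \<Rightarrow> real"
  assumes d: "0 < d" and cont: "continuous_on {-d<..<d} w"
    and add: "\<And>s t. \<lbrakk>\<bar>s\<bar> < d; \<bar>t\<bar> < d; \<bar>s + t\<bar> < d\<rbrakk> \<Longrightarrow> w (s + t) = w s + w t"
  obtains c e where "0 < e" "\<And>s. \<bar>s\<bar> < e \<Longrightarrow> w s = c * s"
proof -
  define r where "r = d / 2"
  have r: "0 < r" "r < d" using d by (auto simp: r_def)
  define c where "c = w r / r"
  define u where "u = (\<lambda>s. w s - c * s)"
  have ur: "u r = 0" using r by (simp add: u_def c_def)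
  have uadd: "u (s + t) = u s + u t" if "\<bar>s\<bar> < d" "\<bar>t\<bar> < d" "\<bar>s + t\<bar> < d" for s t
    using add[OF that] by (simp add: u_def algebra_simps)
  have "continuous_on {0..r} (\<lambda>s. \<bar>u s\<bar>)"
    unfolding u_def using r d by (auto intro!: continuous_intros continuous_on_subset[OF cont])
  then obtain x where x: "x \<in> {0..r}" "\<And>y. y \<in> {0..r} \<Longrightarrow> \<bar>u y\<bar> \<le> \<bar>u x\<bar>"
    using continuous_attains_sup[of "{0..r}" "\<lambda>s. \<bar>u s\<bar>"] r by fastforce
  have "u x = 0"
  proof (cases "x \<le> r / 2")
    case True
    then have "u (x + x) = u x + u x" using x(1) r by (intro uadd) auto
    moreover have "\<bar>u (x + x)\<bar> \<le> \<bar>u x\<bar>" using True x(1) by (intro x(2)) auto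
    ultimately show ?thesis by simp
  next
    case False
    define y where "y = r - x"
    have y: "0 \<le> y" "y < r / 2" using False x(1) by (auto simp: y_def)
    have "u (y + x) = u y + u x" using x(1) r y by (intro uadd) (auto simp: y_def)
    then have "\<bar>u y\<bar> = \<bar>u x\<bar>" using ur by (simp add: y_def)
    moreover have "u (y + y) = u y + u y" using y r by (intro uadd) auto
    moreover have "\<bar>u (y + y)\<bar> \<le> \<bar>u x\<bar>" using y by (intro x(2)) auto
    ultimately show ?thesis by simp
  qed
  then have pos: "u s = 0" if "0 \<le> s" "s \<le> r" for s using x(2)[of s] that by simp
  have "u s = 0" if "\<bar>s\<bar> < r" for s
  proof (cases "0 \<le> s")
    case False
    have "u (s + - s) = u s + u (- s)" using that r by (intro uadd) auto
    then show ?thesis using pos[of 0] pos[of "- s"] that False r by simp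
  qed (use that pos[of s] in auto)
  then show ?thesis using that[of r c] r by (simp add: u_def)
qed

section \<open>Lengths as continuous functions of time on some interval\<close>

lemma local_coordinates:
  fixes F :: "real \<Rightarrow> real \<Rightarrow> real"
  assumes haus: "Hausdorff_space T"
    and closed: "\<And>n \<pi>. 1 \<le> n \<Longrightarrow> unpartitioned n \<pi> \<Longrightarrow>
      continuous_map (subtopology (powertop_real {1..n}) (Lambda_closed n)) T (interval_exchange n \<pi>)"
    and emb: "\<And>n \<pi>. 1 \<le> n \<Longrightarrow> unpartitioned n \<pi> \<Longrightarrow>
      embedding_map (subtopology (powertop_real {1..n}) (Lambda n)) T (interval_exchange n \<pi>)"
    and F: "continuous_map euclideanreal T F" "\<And>t. F t \<in> IET"
  obtains n \<pi> L t0 d where "1 \<le> n" "unpartitioned n \<pi>" "0 < d"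
    "\<And>t. \<bar>t - t0\<bar> < d \<Longrightarrow> L t \<in> Lambda n \<and> F t = interval_exchange n \<pi> (L t)"
    "\<And>i. i \<in> {1..n} \<Longrightarrow> continuous_on {t0 - d<..<t0 + d} (\<lambda>t. L t i)"
proof -
  define C where "C = (\<lambda>(n, \<pi>). {t. F t \<in> interval_exchange n \<pi> ` Lambda_closed n})"
  define I where "I = {(n, \<pi>). 1 \<le> n \<and> unpartitioned n \<pi>}"
  have clC: "closed (C i)" if "i \<in> I" for i
  proof -
    obtain n \<pi> where i: "i = (n, \<pi>)" "1 \<le> n" "unpartitioned n \<pi>" using \<open>i \<in> I\<close> by (auto simp: I_def)
    have "compactin (subtopology (powertop_real {1..n}) (Lambda_closed n)) (Lambda_closed n)"
      using compactin_Lambda_closed[OF i(2)] by (simp add: compactin_subtopology)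
    then have "compactin T (interval_exchange n \<pi> ` Lambda_closed n)"
      by (rule image_compactin[OF _ closed[OF i(2,3)]])
    then have "closedin T (interval_exchange n \<pi> ` Lambda_closed n)"
      by (rule compactin_imp_closedin[OF haus])
    then have "closedin euclideanreal {t \<in> topspace euclideanreal. F t \<in> interval_exchange n \<pi> ` Lambda_closed n}"
      by (rule closedin_continuous_map_preimage[OF F(1)])
    then show ?thesis by (simp add: C_def i)
  qed
  have fin: "finite {\<pi>. unpartitioned n \<pi>}" for n
    by (rule finite_subset[OF _ finite_permutations[of "{1..n}"]]) (auto simp: unpartitioned_def)
  have "I \<subseteq> (SIGMA n:UNIV. {\<pi>. unpartitioned n \<pi>})" by (auto simp: I_def)
  moreover have "countable (SIGMA n:UNIV. {\<pi>. unpartitioned n \<pi>})"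
    by (rule countable_SIGMA) (simp_all add: countable_finite fin)
  ultimately have cI: "countable I" by (rule countable_subset)
  have "\<exists>i\<in>I. interior (C i) \<noteq> {}"
  proof (rule ccontr)
    assume "\<not> ?thesis"
    then obtain t where t: "\<And>i. i \<in> I \<Longrightarrow> t \<notin> C i"
      using Baire_avoid[of I C UNIV] cI clC by auto
    obtain n \<pi> l where *: "1 \<le> n" "unpartitioned n \<pi>" "l \<in> Lambda n" "F t = interval_exchange n \<pi> l"
      using IET_normal_form[OF F(2)] by metis
    then have "t \<in> C (n, \<pi>)" "(n, \<pi>) \<in> I" using Lambda_subset_closed[OF *(1)] by (auto simp: C_def I_def)
    then show False using t by blast
  qed
  then have ex: "\<exists>n. \<exists>\<pi>. (n, \<pi>) \<in> I \<and> interior (C (n, \<pi>)) \<noteq> {}" by auto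
  define n where "n = (LEAST n. \<exists>\<pi>. (n, \<pi>) \<in> I \<and> interior (C (n, \<pi>)) \<noteq> {})"
  obtain \<pi> where \<pi>: "(n, \<pi>) \<in> I" "interior (C (n, \<pi>)) \<noteq> {}"
    using LeastI_ex[OF ex] unfolding n_def by blast
  have n: "1 \<le> n" "unpartitioned n \<pi>" using \<pi>(1) by (auto simp: I_def)
  define J where "J = {(m, \<rho>) \<in> I. m < n}"
  have J: "i \<in> I" "interior (C i) = {}" if "i \<in> J" for i
    using that not_less_Least unfolding J_def n_def by blast+
  have "J \<subseteq> (SIGMA m:{..<n}. {\<pi>. unpartitioned m \<pi>})" by (auto simp: J_def I_def)
  moreover have "finite (SIGMA m:{..<n}. {\<pi>. unpartitioned m \<pi>})"
    by (intro finite_SigmaI fin) simp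
  ultimately have finJ: "finite J" by (rule finite_subset)
  \<comment> \<open>By minimality of \<open>n\<close>, the sets for fewer pieces are closed without
    interior; removing these finitely many leaves a nonempty open set of times.\<close>
  define U where "U = interior (C (n, \<pi>)) - (\<Union>i\<in>J. C i)"
  have openU: "open U" unfolding U_def using finJ clC J(1) by (intro open_Diff open_interior closed_UN) auto
  have clJ: "closed (C i)" if "i \<in> J" for i using clC J(1)[OF that] .
  obtain t0 where "t0 \<in> interior (C (n, \<pi>))" "\<And>i. i \<in> J \<Longrightarrow> t0 \<notin> C i"
    by (rule Baire_avoid[of J C, OF countable_finite[OF finJ] clJ J(2) open_interior \<pi>(2)]) (assumption | rule that)+
  then have "t0 \<in> U" by (simp add: U_def)
  then obtain d where d: "0 < d" "\<And>t. \<bar>t - t0\<bar> < d \<Longrightarrow> t \<in> U"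
    using openU unfolding open_dist dist_real_def by blast
  have rep: "F t \<in> interval_exchange n \<pi> ` Lambda n" if "t \<in> U" for t
  proof -
    have "t \<in> C (n, \<pi>)" using that interior_subset by (auto simp: U_def)
    then obtain l where l: "l \<in> Lambda_closed n" "F t = interval_exchange n \<pi> l" by (auto simp: C_def)
    have "\<pi> permutes {1..n}" using n(2) by (simp add: unpartitioned_def)
    then obtain m \<rho> l' where m: "1 \<le> m" "m \<le> n" "unpartitioned m \<rho>" "l' \<in> Lambda m"
      "interval_exchange n \<pi> l = interval_exchange m \<rho> l'" "m = n \<Longrightarrow> l \<in> Lambda n"
      using interval_exchange_normal_form[OF n(1) _ l(1)] by metis
    \<comment> \<open>A reduction to fewer pieces would put \<open>t\<close> into one of the removed
      sets.\<close>
    have "\<not> m < n"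
    proof
      assume "m < n"
      then have "(m, \<rho>) \<in> J" using m by (auto simp: J_def I_def)
      moreover have "t \<in> C (m, \<rho>)" using l(2) m Lambda_subset_closed[OF m(1)] by (auto simp: C_def)
      ultimately show False using that by (auto simp: U_def)
    qed
    then have "l \<in> Lambda n" using m(2,6) by simp
    then show ?thesis unfolding l(2) by (rule imageI)
  qed
  let ?X = "subtopology (powertop_real {1..n}) (Lambda n)"
  have topX: "topspace ?X = Lambda n" by (auto simp: Lambda_def)
  have "homeomorphic_map ?X (subtopology T (interval_exchange n \<pi> ` Lambda n)) (interval_exchange n \<pi>)"
    using emb[OF n] unfolding embedding_map_def topX .
  \<comment> \<open>The inverse \<open>g\<close> of the coordinate map reads off the lengths, so
    \<open>g \<circ> F\<close> is the required \<open>L\<close>.\<close>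
  then obtain g where g: "homeomorphic_maps ?X (subtopology T (interval_exchange n \<pi> ` Lambda n)) (interval_exchange n \<pi>) g"
    unfolding homeomorphic_map_maps by blast
  have inv: "g (interval_exchange n \<pi> l) = l" if "l \<in> Lambda n" for l
    using g that topX unfolding homeomorphic_maps_def by blast
  have gc: "continuous_map (subtopology T (interval_exchange n \<pi> ` Lambda n)) ?X g"
    using g unfolding homeomorphic_maps_def by blast
  let ?B = "{t0 - d<..<t0 + d}"
  have BU: "?B \<subseteq> U" using d(2) by (auto simp: abs_less_iff)
  have "continuous_map (top_of_set ?B) (subtopology T (interval_exchange n \<pi> ` Lambda n)) F"
    using rep BU by (intro continuous_map_into_subtopology continuous_map_from_subtopology[OF F(1)]) auto
  then have "continuous_map (top_of_set ?B) ?X (g \<circ> F)" using gc by (rule continuous_map_compose)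
  then have gF: "continuous_map (top_of_set ?B) (powertop_real {1..n}) (g \<circ> F)"
    by (simp add: continuous_map_in_subtopology)
  show ?thesis
  proof (rule that[OF n d(1), of t0 "g \<circ> F"])
    fix t assume "\<bar>t - t0\<bar> < d"
    then obtain l where "l \<in> Lambda n" "F t = interval_exchange n \<pi> l" using rep[OF d(2)] by blast
    then show "(g \<circ> F) t \<in> Lambda n \<and> F t = interval_exchange n \<pi> ((g \<circ> F) t)" using inv by simp
  next
    fix i assume "i \<in> {1..n}"
    then show "continuous_on ?B (\<lambda>t. (g \<circ> F) t i)"
      using gF unfolding continuous_map_componentwise by (auto simp: o_def)
  qed
qed

text \<open>Since \<open>F s (F t0 y) = F (t0 + s) y\<close>, a point in the image of a piece under
  \<open>F t0\<close> is moved by the change of the shift of that piece. Hence the pieces sought are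
  the image pieces, with lengths \<open>L t0\<close> listed in the order given by
  \<open>\<pi>\<close>.\<close>

lemma (in iet_flow) piecewise_flow_of_coordinates:
  assumes n: "1 \<le> n" "unpartitioned n \<pi>" and d: "0 < d"
    and L: "\<And>t. \<bar>t - t0\<bar> < d \<Longrightarrow> L t \<in> Lambda n"
    and FL: "\<And>t. \<bar>t - t0\<bar> < d \<Longrightarrow> F t = interval_exchange n \<pi> (L t)"
    and cont: "\<And>i. i \<in> {1..n} \<Longrightarrow> continuous_on {t0 - d<..<t0 + d} (\<lambda>t. L t i)"
  obtains l v where "piecewise_flow F n l v"
proof -
  have \<pi>: "\<pi> permutes {1..n}" using n(2) by (simp add: unpartitioned_def)
  have L0: "L t0 \<in> Lambda n" using L[of t0] d by simp
  have Lnn: "\<forall>i\<in>{1..n}. 0 \<le> L t i" and L1: "breakpoint (L t) n = 1" if "\<bar>t - t0\<bar> < d" for t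
    using L[OF that] by (auto simp: Lambda_def breakpoint_def less_imp_le)
  let ?b = "\<lambda>j t. breakpoint (L t) j"
  \<comment> \<open>The displacement in time \<open>s\<close> of points in the image of the
    \<open>j\<close>-th piece.\<close>
  let ?w = "\<lambda>j s. shift n \<pi> (L (t0 + s)) j - shift n \<pi> (L t0) j"
  have cb: "continuous_on {t0 - d<..<t0 + d} (?b j)" if "j \<le> n" for j
    unfolding breakpoint_def using that by (intro continuous_on_sum cont) auto
  have tb: "(?b j \<longlongrightarrow> ?b j t0) (nhds t0)" if "j \<le> n" for j
  proof -
    have "isCont (?b j) t0"
      using continuous_on_eq_continuous_at[of "{t0 - d<..<t0 + d}" "?b j"] cb[OF that] d by simp
    then show ?thesis using tendsto_at_iff_tendsto_nhds[of "?b j" t0] by (simp add: isCont_def)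
  qed
  have cw: "continuous_on {-d<..<d} (?w j)" for j
  proof -
    have "continuous_on {t0 - d<..<t0 + d} (\<lambda>t. shift n \<pi> (L t) j)"
      unfolding shift_def by (intro continuous_intros cont) auto
    then have "continuous_on {-d<..<d} (\<lambda>s. shift n \<pi> (L (t0 + s)) j)"
      by (rule continuous_on_compose2) (auto intro!: continuous_intros)
    then show ?thesis by (intro continuous_intros)
  qed
  \<comment> \<open>One time bound serves a whole closed subinterval, because additivity below
    compares two starting points in the same piece.\<close>
  have near: "\<exists>e>0. e \<le> d \<and> (\<forall>s. \<bar>s\<bar> < e \<longrightarrow> (\<forall>y\<in>{y1..y2}.
      F s (y + shift n \<pi> (L t0) j) = y + shift n \<pi> (L t0) j + ?w j s))"
    if j: "j \<in> {1..n}" and y: "?b (j - 1) t0 < y1" "y2 < ?b j t0" for j y1 y2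
  proof -
    have jn: "j - 1 \<le> n" "j \<le> n" using j by auto
    have "eventually (\<lambda>t. ?b (j - 1) t < y1) (nhds t0)" "eventually (\<lambda>t. y2 < ?b j t) (nhds t0)"
      by (rule order_tendstoD(2)[OF tb[OF jn(1)] y(1)], rule order_tendstoD(1)[OF tb[OF jn(2)] y(2)])
    then have "eventually (\<lambda>t. ?b (j - 1) t < y1 \<and> y2 < ?b j t) (nhds t0)" by (rule eventually_conj)
    then obtain e0 where e0: "0 < e0" "\<And>t. \<bar>t - t0\<bar> < e0 \<Longrightarrow> ?b (j - 1) t < y1 \<and> y2 < ?b j t"
      unfolding eventually_nhds_metric dist_real_def by blast
    show ?thesis
    proof (intro exI[of _ "min e0 d"] conjI allI impI ballI)
      fix s y assume s: "\<bar>s\<bar> < min e0 d" and yy: "y \<in> {y1..y2}"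
      have 0: "\<bar>t0 - t0\<bar> < d" "\<bar>t0 + s - t0\<bar> < d" using d s by auto
      have p0: "y \<in> piece (L t0) j" using y yy by (auto simp: piece_def)
      have ps: "y \<in> piece (L (t0 + s)) j" using e0(2)[of "t0 + s"] s yy by (auto simp: piece_def)
      have y01: "y \<in> {0..<1}" using piece_subset[OF Lnn L1 j] p0 0 by blast
      have "F t0 y = y + shift n \<pi> (L t0) j"
        unfolding FL[OF 0(1)] by (rule interval_exchange_eq[OF Lnn[OF 0(1)] L1[OF 0(1)] j p0])
      moreover have "F (t0 + s) y = y + shift n \<pi> (L (t0 + s)) j"
        unfolding FL[OF 0(2)] by (rule interval_exchange_eq[OF Lnn[OF 0(2)] L1[OF 0(2)] j ps])
      ultimately show "F s (y + shift n \<pi> (L t0) j) = y + shift n \<pi> (L t0) j + ?w j s"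
        using F_add[OF y01, of s t0] by (simp add: add.commute)
    qed (use e0 d in auto)
  qed
  have lin: "\<exists>c e. 0 < e \<and> (\<forall>s. \<bar>s\<bar> < e \<longrightarrow> ?w j s = c * s)" if j: "j \<in> {1..n}" for j
  proof -
    have "?b j t0 = ?b (j - 1) t0 + L t0 j" using j by (intro breakpoint_step) auto
    then have "?b (j - 1) t0 < ?b j t0" using L0 j by (auto simp: Lambda_def)
    \<comment> \<open>\<open>y0\<close> is the midpoint of the piece, and a displacement smaller
      than \<open>r\<close> keeps it in the range where \<open>near\<close> applies.\<close>
    define r where "r = (?b j t0 - ?b (j - 1) t0) / 4"
    define y0 where "y0 = ?b (j - 1) t0 + 2 * r"
    have r: "0 < r" using \<open>?b (j - 1) t0 < ?b j t0\<close> by (simp add: r_def)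
    have "?b (j - 1) t0 < y0 - r" "y0 + r < ?b j t0" using r by (auto simp: y0_def r_def field_simps)
    then obtain e1 where e1: "0 < e1" "e1 \<le> d" "\<And>s y. \<bar>s\<bar> < e1 \<Longrightarrow> y \<in> {y0 - r..y0 + r} \<Longrightarrow>
      F s (y + shift n \<pi> (L t0) j) = y + shift n \<pi> (L t0) j + ?w j s"
      using near[OF j, of "y0 - r" "y0 + r"] by blast
    have "isCont (?w j) 0"
      using continuous_on_eq_continuous_at[of "{-d<..<d}" "?w j"] cw d by simp
    then have "(?w j \<longlongrightarrow> 0) (nhds 0)"
      using tendsto_at_iff_tendsto_nhds[of "?w j" 0] by (simp add: isCont_def)
    then have "eventually (\<lambda>s. dist (?w j s) 0 < r) (nhds 0)" using r by (rule tendstoD)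
    then obtain e2 where e2: "0 < e2" "\<And>s. \<bar>s\<bar> < e2 \<Longrightarrow> \<bar>?w j s\<bar> < r"
      unfolding eventually_nhds_metric dist_real_def by auto
    define e where "e = min e1 e2"
    have e: "0 < e" "e \<le> d" using e1 e2 by (auto simp: e_def)
    have y01: "y0 + shift n \<pi> (L t0) j \<in> {0..<1}"
    proof -
      have p: "y0 \<in> piece (L t0) j" using r by (simp add: piece_def y0_def r_def field_simps)
      have z: "\<bar>t0 - t0\<bar> < d" using d by simp
      have "F t0 y0 = y0 + shift n \<pi> (L t0) j"
        unfolding FL[OF z] by (rule interval_exchange_eq[OF Lnn[OF z] L1[OF z] j p])
      moreover have "F t0 y0 \<in> {0..<1}" using piece_subset[OF Lnn[OF z] L1[OF z] j] p by (intro F_unit) auto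
      ultimately show ?thesis by simp
    qed
    have add: "?w j (s + t) = ?w j s + ?w j t" if "\<bar>s\<bar> < e" "\<bar>t\<bar> < e" "\<bar>s + t\<bar> < e" for s t
    proof -
      define x where "x = y0 + shift n \<pi> (L t0) j"
      have 1: "F (s + t) x = x + ?w j (s + t)" "F t x = x + ?w j t"
        unfolding x_def using e1(3)[of "s + t" y0] e1(3)[of t y0] that r by (auto simp: e_def)
      have "y0 + ?w j t \<in> {y0 - r..y0 + r}" using e2(2)[of t] that by (auto simp: e_def)
      then have "F s (y0 + ?w j t + shift n \<pi> (L t0) j) = y0 + ?w j t + shift n \<pi> (L t0) j + ?w j s"
        using that by (intro e1(3)) (auto simp: e_def)
      then have "F s (x + ?w j t) = x + ?w j t + ?w j s" by (simp add: x_def algebra_simps)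
      then show ?thesis using 1 F_add[OF y01, of s t] by (simp add: x_def)
    qed
    have "continuous_on {-e<..<e} (?w j)" using e by (intro continuous_on_subset[OF cw]) auto
    from locally_additive_imp_linear[OF e(1) this add] show ?thesis by metis
  qed
  then obtain c e where ce: "\<And>j. j \<in> {1..n} \<Longrightarrow> 0 < e j" "\<And>j s. j \<in> {1..n} \<Longrightarrow> \<bar>s\<bar> < e j \<Longrightarrow> ?w j s = c j * s"
    by metis
  let ?p = "inv_into UNIV \<pi>"
  have p: "?p permutes {1..n}" by (rule permutes_inv[OF \<pi>])
  have "piecewise_flow F n (L t0 \<circ> ?p) (c \<circ> ?p)"
  proof
    show "L t0 \<circ> ?p \<in> Lambda n"
    proof -
      have "L t0 (?p i) = undefined" if "i \<notin> {1..n}" for i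
        using that L0 permutes_not_in[OF p that] by (auto simp: Lambda_def PiE_def extensional_def)
      moreover have "0 < L t0 (?p i)" if "i \<in> {1..n}" for i
        using that L0 permutes_in_image[OF p, of i] by (simp add: Lambda_def)
      moreover have "(\<Sum>i=1..n. L t0 (?p i)) = 1"
        using sum.permute[OF p, of "L t0"] L0 by (simp add: Lambda_def)
      ultimately show ?thesis by (auto simp: Lambda_def PiE_def extensional_def)
    qed
    fix k x assume k: "k \<in> {1..n}"
      and x: "breakpoint (L t0 \<circ> ?p) (k - 1) < x" "x < breakpoint (L t0 \<circ> ?p) k"
    define j where "j = ?p k"
    have j: "j \<in> {1..n}" "\<pi> j = k" using k permutes_in_image[OF p, of k] permutes_inverses[OF \<pi>] by (auto simp: j_def)
    have z: "\<bar>t0 - t0\<bar> < d" using d by simp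
    define y where "y = x - shift n \<pi> (L t0) j"
    have sh: "shift n \<pi> (L t0) j = breakpoint (L t0 \<circ> ?p) (k - 1) - breakpoint (L t0) (j - 1)"
      using shift_eq[OF \<pi> j(1)] j(2) by simp
    have "breakpoint (L t0 \<circ> ?p) k = breakpoint (L t0 \<circ> ?p) (k - 1) + L t0 j"
      using k breakpoint_step[of k "L t0 \<circ> ?p"] by (simp add: j_def)
    moreover have "breakpoint (L t0) j = breakpoint (L t0) (j - 1) + L t0 j"
      using j by (intro breakpoint_step) auto
    ultimately have y: "breakpoint (L t0) (j - 1) < y" "y < breakpoint (L t0) j"
      using x sh by (auto simp: y_def)
    obtain e' where e': "0 < e'" "\<And>s. \<bar>s\<bar> < e' \<Longrightarrow> F s (y + shift n \<pi> (L t0) j) = y + shift n \<pi> (L t0) j + ?w j s"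
      using near[OF j(1) y] by auto
    show "\<exists>d>0. \<forall>s. \<bar>s\<bar> < d \<longrightarrow> F s x = x + (c \<circ> ?p) k * s"
    proof (intro exI[of _ "min e' (e j)"] conjI allI impI)
      fix s assume "\<bar>s\<bar> < min e' (e j)"
      then show "F s x = x + (c \<circ> ?p) k * s"
        using e'(2)[of s] ce(2)[OF j(1), of s] by (simp add: y_def j_def)
    qed (use e'(1) ce(1)[OF j(1)] in auto)
  qed
  then show ?thesis by (rule that)
qed

section \<open>Rotation actions\<close>

text \<open>A rotation of the \<open>j\<close>-th interval exchanges two adjacent subintervals,
  which receive the numbers \<open>2 * j - 1\<close> and \<open>2 * j\<close>.\<close>

definition pair_swap :: "nat \<Rightarrow> nat \<Rightarrow> nat" where
  "pair_swap n i = (if i \<in> {1..2 * n} then if odd i then i + 1 else i - 1 else i)"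

text \<open>\<open>u j\<close> is the length of the first subinterval of the \<open>j\<close>-th
  interval. It may be \<open>0\<close> or \<open>l j\<close>, so in general the result is only in
  the closed simplex.\<close>

definition split_lengths :: "nat \<Rightarrow> (nat \<Rightarrow> real) \<Rightarrow> (nat \<Rightarrow> real) \<Rightarrow> nat \<Rightarrow> real" where
  "split_lengths n l u =
    (\<lambda>i\<in>{1..2 * n}. if odd i then u ((i + 1) div 2) else l (i div 2) - u (i div 2))"

lemma pair_swap_pair_swap: "pair_swap n (pair_swap n i) = i"
  unfolding pair_swap_def atLeastAtMost_iff by (simp split: if_split; presburger)

lemma unpartitioned_pair_swap: "unpartitioned (2 * n) (pair_swap n)"
proof -
  have "pair_swap n permutes {1..2 * n}"
    unfolding permutes_def by (metis pair_swap_def pair_swap_pair_swap)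
  moreover have "pair_swap n (j + 1) \<noteq> pair_swap n j + 1" if "j \<in> {1..<2 * n}" for j
    using that by (auto simp: pair_swap_def)
  ultimately show ?thesis by (simp add: unpartitioned_def)
qed

lemma breakpoint_split_lengths:
  assumes "j \<le> n"
  shows "breakpoint (split_lengths n l u) (2 * j) = breakpoint l j"
  using assms
proof (induction j)
  case (Suc j)
  have "2 * Suc j = Suc (Suc (2 * j))" by simp
  then have "breakpoint (split_lengths n l u) (2 * Suc j) = breakpoint (split_lengths n l u) (2 * j)
      + split_lengths n l u (2 * j + 1) + split_lengths n l u (2 * Suc j)"
    by (simp add: breakpoint_def)
  then show ?case using Suc by (simp add: split_lengths_def breakpoint_def)
qed (simp add: breakpoint_def)

lemma breakpoint_split_lengths_odd:
  assumes "j \<in> {1..n}"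
  shows "breakpoint (split_lengths n l u) (2 * j - 1) = breakpoint l (j - 1) + u j"
proof -
  have "breakpoint (split_lengths n l u) (2 * j - 1)
      = breakpoint (split_lengths n l u) (2 * j - 1 - 1) + split_lengths n l u (2 * j - 1)"
    using assms by (intro breakpoint_step) auto
  moreover have "2 * j - 1 - 1 = 2 * (j - 1)" using assms by auto
  moreover have "split_lengths n l u (2 * j - 1) = u j" using assms by (auto simp: split_lengths_def)
  moreover have "breakpoint (split_lengths n l u) (2 * (j - 1)) = breakpoint l (j - 1)"
    using assms by (intro breakpoint_split_lengths) auto
  ultimately show ?thesis by simp
qed

lemma split_lengths_closed:
  assumes "1 \<le> n" "l \<in> Lambda n" "\<And>j. j \<in> {1..n} \<Longrightarrow> 0 \<le> u j \<and> u j \<le> l j"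
  shows "split_lengths n l u \<in> Lambda_closed (2 * n)"
proof (rule Lambda_closedI)
  show "breakpoint (split_lengths n l u) (2 * n) = 1"
    using breakpoint_split_lengths[of n n l u] assms(2) by (simp add: Lambda_def breakpoint_def)
  fix i assume i: "i \<in> {1..2 * n}"
  show "0 \<le> split_lengths n l u i"
  proof (cases "odd i")
    case True
    then have "(i + 1) div 2 \<in> {1..n}" using i unfolding atLeastAtMost_iff by presburger
    then show ?thesis using assms(3)[of "(i + 1) div 2"] i True by (simp add: split_lengths_def)
  next
    case False
    then have "i div 2 \<in> {1..n}" using i by (auto elim!: evenE)
    then show ?thesis using assms(3)[of "i div 2"] i False by (simp add: split_lengths_def)
  qed
qed (use assms in \<open>auto simp: split_lengths_def\<close>)

lemma shift_split_lengths:
  assumes "j \<in> {1..n}"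
  shows "shift (2 * n) (pair_swap n) (split_lengths n l u) (2 * j - 1) = l j - u j"
    "shift (2 * n) (pair_swap n) (split_lengths n l u) (2 * j) = - u j"
proof -
  let ?m = "split_lengths n l u"
  let ?A = "{i. i \<in> {1..2 * n} \<and> i < 2 * j - 1}"
  have ps: "pair_swap n (2 * j - 1) = 2 * j" "pair_swap n (2 * j) = 2 * j - 1"
    using assms by (auto simp: pair_swap_def)
  \<comment> \<open>\<open>pair_swap\<close> permutes only inside the pairs, so it does not change
    which indices come before the \<open>j\<close>-th pair.\<close>
  have lt: "pair_swap n i < 2 * j - 1 \<longleftrightarrow> i < 2 * j - 1" if i: "i \<in> {1..2 * n}" for i
  proof (cases "odd i")
    case True
    then show ?thesis using i assms unfolding atLeastAtMost_iff by (simp add: pair_swap_def; presburger)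
  next
    case False
    then show ?thesis using i assms unfolding atLeastAtMost_iff by (simp add: pair_swap_def; presburger)
  qed
  have eq: "pair_swap n i = 2 * j - 1 \<longleftrightarrow> i = 2 * j" for i
    using ps pair_swap_pair_swap by metis
  have S: "{i. i \<in> {1..2 * n} \<and> pair_swap n i < pair_swap n (2 * j)} = ?A"
    "{i. i \<in> {1..2 * n} \<and> i < 2 * j} = insert (2 * j - 1) ?A"
    "{i. i \<in> {1..2 * n} \<and> pair_swap n i < pair_swap n (2 * j - 1)} = insert (2 * j) ?A"
  proof -
    show "{i. i \<in> {1..2 * n} \<and> pair_swap n i < pair_swap n (2 * j)} = ?A"
      unfolding ps using lt by blast
    show "{i. i \<in> {1..2 * n} \<and> i < 2 * j} = insert (2 * j - 1) ?A" using assms by auto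
    have "pair_swap n i < 2 * j \<longleftrightarrow> pair_swap n i < 2 * j - 1 \<or> pair_swap n i = 2 * j - 1" for i
      using assms by auto
    moreover have "2 * j \<in> {1..2 * n}" using assms by auto
    ultimately show "{i. i \<in> {1..2 * n} \<and> pair_swap n i < pair_swap n (2 * j - 1)} = insert (2 * j) ?A"
      unfolding ps using lt eq by blast
  qed
  have fin: "finite ?A" and ni: "2 * j \<notin> ?A" "2 * j - 1 \<notin> ?A" by auto
  have m: "?m (2 * j - 1) = u j" "?m (2 * j) = l j - u j"
    using assms by (auto simp: split_lengths_def)
  show "shift (2 * n) (pair_swap n) ?m (2 * j - 1) = l j - u j"
    unfolding shift_def S sum.insert[OF fin ni(1)] m by simp
  show "shift (2 * n) (pair_swap n) ?m (2 * j) = - u j"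
    unfolding shift_def S sum.insert[OF fin ni(2)] m by simp
qed

text \<open>With \<open>a j = 0\<close>, the choice \<open>u j = 0\<close> is a second coordinate
  for the identity on the \<open>j\<close>-th interval, besides \<open>u j = l j\<close>; it is the
  limit at time \<open>0\<close> when the speed is negative.\<close>

lemma torus_exchange_eq_interval_exchange:
  assumes n: "1 \<le> n" and l: "l \<in> Lambda n"
    and u: "\<And>j. j \<in> {1..n} \<Longrightarrow> 0 \<le> u j \<and> u j \<le> l j"
    and ua: "\<And>j. j \<in> {1..n} \<Longrightarrow> u j = l j * (1 - a j) \<or> u j = 0 \<and> a j = 0"
  shows "torus_exchange n a l = interval_exchange (2 * n) (pair_swap n) (split_lengths n l u)"
proof
  let ?m = "split_lengths n l u"
  have lnn: "\<forall>i\<in>{1..n}. 0 \<le> l i" and l1: "breakpoint l n = 1"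
    using l by (auto simp: Lambda_def breakpoint_def less_imp_le)
  have n2: "1 \<le> 2 * n" using n by simp
  note mD = Lambda_closedD(1,2)[OF n2 split_lengths_closed[OF n l u]]
  fix x show "torus_exchange n a l x = interval_exchange (2 * n) (pair_swap n) ?m x"
  proof (cases "x \<in> {0..<1}")
    case True
    then obtain j where j: "j \<in> {1..n}" "x \<in> piece l j" using piece_exists[OF l1] by metis
    have bs: "breakpoint l j = breakpoint l (j - 1) + l j" using j by (intro breakpoint_step) auto
    have tx: "torus_exchange n a l x =
        (if x < breakpoint l j - l j * a j then x + l j * a j else x + l j * a j - l j)"
      using True THE_piece[OF lnn j] by (simp add: torus_exchange_def Let_def)
    have bm: "breakpoint ?m (2 * j - 1) = breakpoint l (j - 1) + u j"
      "breakpoint ?m (2 * j) = breakpoint l j" "breakpoint ?m (2 * j - 1 - 1) = breakpoint l (j - 1)"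
    proof -
      have "2 * j - 1 - 1 = 2 * (j - 1)" using j by auto
      then show "breakpoint ?m (2 * j - 1 - 1) = breakpoint l (j - 1)"
        using breakpoint_split_lengths[of "j - 1" n l u] j(1) by auto
    qed (use breakpoint_split_lengths_odd[OF j(1)] breakpoint_split_lengths[of j] j(1) in auto)
    have j2: "2 * j - 1 \<in> {1..2 * n}" "2 * j \<in> {1..2 * n}" using j(1) by auto
    show ?thesis
    proof (cases "x < breakpoint l (j - 1) + u j")
      case x: True
      then have "u j \<noteq> 0" using j by (auto simp: piece_def)
      then have uj: "u j = l j * (1 - a j)" using ua[OF j(1)] by blast
      have "x \<in> piece ?m (2 * j - 1)" unfolding piece_def bm using x j by (simp add: piece_def)
      then have "interval_exchange (2 * n) (pair_swap n) ?m x = x + (l j - u j)"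
        using interval_exchange_eq[OF mD j2(1)] shift_split_lengths(1)[OF j(1)] by simp
      moreover have "x < breakpoint l j - l j * a j" using x bs uj by (simp add: algebra_simps)
      ultimately show ?thesis using tx uj by (simp add: algebra_simps)
    next
      case x: False
      have "x \<in> piece ?m (2 * j)" unfolding piece_def bm using x j by (simp add: piece_def)
      then have ix: "interval_exchange (2 * n) (pair_swap n) ?m x = x - u j"
        using interval_exchange_eq[OF mD j2(2)] shift_split_lengths(2)[OF j(1)] by simp
      show ?thesis
      proof (cases "u j = 0 \<and> a j = 0")
        case True
        then show ?thesis using tx ix j by (simp add: piece_def)
      next
        case False
        then have uj: "u j = l j * (1 - a j)" using ua[OF j(1)] by blast
        then have "\<not> x < breakpoint l j - l j * a j" using x bs by (simp add: algebra_simps)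
        then show ?thesis using tx ix uj by (simp add: algebra_simps)
      qed
    qed
  qed (simp only: torus_exchange_def interval_exchange_def restrict_apply if_False)
qed

text \<open>For negative speed the first subinterval starts with length \<open>0\<close> instead of \<open>l j\<close>: this keeps the
  lengths continuous at \<open>t = 0\<close>, where \<open>frac (t * a j)\<close> jumps.\<close>

definition first_lengths :: "(nat \<Rightarrow> real) \<Rightarrow> (nat \<Rightarrow> real) \<Rightarrow> real \<Rightarrow> nat \<Rightarrow> real" where
  "first_lengths l a t j = (if 0 \<le> a j then l j * (1 - t * a j) else - (l j * (t * a j)))"

lemma continuous_map_torus_exchange:
  assumes n: "1 \<le> n" and l: "l \<in> Lambda n"
    and cont: "continuous_map (subtopology (powertop_real {1..2 * n}) (Lambda_closed (2 * n))) T
      (interval_exchange (2 * n) (pair_swap n))"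
  obtains d where "0 < d"
    "continuous_map (top_of_set {0..<d}) T (\<lambda>t. torus_exchange n (torus_class n (\<lambda>j. t * a j)) l)"
proof -
  \<comment> \<open>\<open>A\<close> strictly exceeds every \<open>\<bar>a j\<bar>\<close>, so for
    \<open>0 \<le> t\<close> and \<open>t < 1 / A\<close> no angle \<open>t * a j\<close> completes
    a turn.\<close>
  define A where "A = 1 + (\<Sum>j=1..n. \<bar>a j\<bar>)"
  have A: "1 \<le> A" by (simp add: A_def sum_nonneg)
  have aA: "\<bar>a j\<bar> < A" if "j \<in> {1..n}" for j
    using member_le_sum[OF that, of "\<lambda>j. \<bar>a j\<bar>"] by (simp add: A_def)
  define d where "d = 1 / A"
  have d: "0 < d" using A by (simp add: d_def)
  have ta: "\<bar>t * a j\<bar> < 1" if "t \<in> {0..<d}" "j \<in> {1..n}" for t j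
  proof -
    have "\<bar>t * a j\<bar> \<le> t * A" using that aA[OF that(2)] by (auto simp: abs_mult intro!: mult_left_mono)
    also have "\<dots> < 1" using that A by (simp add: d_def field_simps)
    finally show ?thesis .
  qed
  have lpos: "0 < l j" if "j \<in> {1..n}" for j using l that by (auto simp: Lambda_def)
  define u where "u = first_lengths l a"
  have u: "0 \<le> u t j \<and> u t j \<le> l j" if t: "t \<in> {0..<d}" and j: "j \<in> {1..n}" for t j
  proof (cases "0 \<le> a j")
    case True
    then have "0 \<le> t * a j" "t * a j \<le> 1" using ta[OF t j] t by auto
    then show ?thesis using lpos[OF j] True by (simp add: u_def first_lengths_def mult_left_le)
  next
    case False
    then have s: "t * a j \<le> 0" "- 1 \<le> t * a j" using ta[OF t j] t by (auto simp: mult_nonneg_nonpos)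
    then have "l j * (- (t * a j)) \<le> l j * 1" using lpos[OF j] by (intro mult_left_mono) auto
    moreover have "0 \<le> l j * (- (t * a j))" using s lpos[OF j] by (intro mult_nonneg_nonneg) auto
    ultimately show ?thesis using False by (simp add: u_def first_lengths_def)
  qed
  have ua: "u t j = l j * (1 - torus_class n (\<lambda>j. t * a j) j) \<or> u t j = 0 \<and> torus_class n (\<lambda>j. t * a j) j = 0"
    if t: "t \<in> {0..<d}" and j: "j \<in> {1..n}" for t j
  proof (cases "0 \<le> a j")
    case True
    then have "frac (t * a j) = t * a j" using ta[OF t j] t by (subst frac_eq) auto
    then show ?thesis using True j by (simp add: u_def first_lengths_def torus_class_def)
  next
    case False
    show ?thesis
    proof (cases "t = 0")
      case True
      then show ?thesis using False j by (simp add: u_def first_lengths_def torus_class_def)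
    next
      case t0: False
      then have "t * a j < 0" using False t by (auto simp: mult_pos_neg)
      moreover have "- 1 < t * a j" using ta[OF t j] by simp
      \<comment> \<open>For a negative angle the fractional part adds \<open>1\<close>, so one minus
        it is \<open>- (t * a j)\<close>, as in \<open>first_lengths\<close>.\<close>
      ultimately have "frac (t * a j) = t * a j + 1"
        by (subst frac_unique_iff) (auto intro: Ints_minus)
      then show ?thesis using False j by (simp add: u_def first_lengths_def torus_class_def)
    qed
  qed
  have eq: "interval_exchange (2 * n) (pair_swap n) (split_lengths n l (u t))
      = torus_exchange n (torus_class n (\<lambda>j. t * a j)) l" if "t \<in> {0..<d}" for t
    using torus_exchange_eq_interval_exchange[OF n l u[OF that] ua[OF that]] by simp
  have "continuous_map (top_of_set {0..<d})
      (subtopology (powertop_real {1..2 * n}) (Lambda_closed (2 * n))) (\<lambda>t. split_lengths n l (u t))"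
  proof (rule continuous_map_into_subtopology)
    have c: "continuous_on {0..<d} (\<lambda>t. u t j)" for j
      unfolding u_def first_lengths_def by (cases "0 \<le> a j") (auto intro!: continuous_intros)
    show "continuous_map (top_of_set {0..<d}) (powertop_real {1..2 * n}) (\<lambda>t. split_lengths n l (u t))"
      unfolding continuous_map_componentwise
      using c by (auto simp: split_lengths_def intro!: continuous_intros)
    show "(\<lambda>t. split_lengths n l (u t)) \<in> topspace (top_of_set {0..<d}) \<rightarrow> Lambda_closed (2 * n)"
      using split_lengths_closed[OF n l u] by auto
  qed
  then have "continuous_map (top_of_set {0..<d}) T
      (interval_exchange (2 * n) (pair_swap n) \<circ> (\<lambda>t. split_lengths n l (u t)))"
    using cont by (rule continuous_map_compose)
  then have "continuous_map (top_of_set {0..<d}) T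
      (\<lambda>t. torus_exchange n (torus_class n (\<lambda>j. t * a j)) l)"
    by (rule continuous_map_eq) (use eq in auto)
  then show ?thesis using that d by blast
qed

text \<open>Near \<open>t\<close>, the time \<open>s\<close> is \<open>t\<close> plus the positive
  part minus the negative part of \<open>s - t\<close>. Both parts lie in \<open>[0, d)\<close> and
  depend continuously on \<open>s\<close>, so products and inverses carry continuity from the right
  germ at \<open>0\<close> to a neighbourhood of \<open>t\<close>.\<close>

lemma (in iet_flow) continuous_of_right_germ:
  assumes tg: "topological_group IET_group T" and d: "0 < d"
    and cont: "continuous_map (top_of_set {0..<d}) T F"
  shows "continuous_map euclideanreal T F"
proof -
  interpret G: group IET_group by (rule group_IET_group)
  have topT: "topspace T = carrier IET_group" using tg by (simp add: topological_group_def)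
  have Fc: "F s \<in> carrier IET_group" for s using F_IET by (simp add: carrier_IET_group)
  have add: "F (s + t) = F s \<otimes>\<^bsub>IET_group\<^esub> F t" for s t
    using hom by (auto simp: hom_def real_group_def)
  have zero: "F 0 = \<one>\<^bsub>IET_group\<^esub>" using add[of 0 0] Fc[of 0] G.l_cancel_one by fastforce
  have minus: "F (- s) = inv\<^bsub>IET_group\<^esub> F s" for s
    using add[of "- s" s] zero Fc by (metis G.inv_equality add.left_inverse)
  have near: "continuous_map (top_of_set {t - d<..<t + d}) T F" for t
  proof -
    have split: "F s = F t \<otimes>\<^bsub>IET_group\<^esub> (F (max (s - t) 0) \<otimes>\<^bsub>IET_group\<^esub> inv\<^bsub>IET_group\<^esub> F (max (t - s) 0))" for s
    proof -
      have "s = t + (max (s - t) 0 + - max (t - s) 0)" by auto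
      then show ?thesis by (metis add minus)
    qed
    have c: "continuous_map (top_of_set {t - d<..<t + d}) T (\<lambda>s. F (g s))"
      if g: "continuous_on {t - d<..<t + d} g" "g ` {t - d<..<t + d} \<subseteq> {0..<d}" for g :: "real \<Rightarrow> real"
    proof -
      have "continuous_map (top_of_set {t - d<..<t + d}) (top_of_set {0..<d}) g"
        using g by (intro continuous_map_into_subtopology) auto
      then have "continuous_map (top_of_set {t - d<..<t + d}) T (F \<circ> g)"
        using cont by (rule continuous_map_compose)
      then show ?thesis by (simp add: o_def)
    qed
    have "continuous_map (top_of_set {t - d<..<t + d}) T (\<lambda>s. F (max (s - t) 0))"
      "continuous_map (top_of_set {t - d<..<t + d}) T (\<lambda>s. F (max (t - s) 0))"
      by (rule c; use d in \<open>auto intro!: continuous_intros\<close>)+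
    then have "continuous_map (top_of_set {t - d<..<t + d}) T
        (\<lambda>s. F t \<otimes>\<^bsub>IET_group\<^esub> (F (max (s - t) 0) \<otimes>\<^bsub>IET_group\<^esub> inv\<^bsub>IET_group\<^esub> F (max (t - s) 0)))"
      using topT Fc by (intro topological_group_mult[OF tg] topological_group_inv[OF tg]) auto
    then show ?thesis by (rule continuous_map_eq) (rule split[symmetric])
  qed
  have "open {s. F s \<in> U}" if U: "openin T U" for U
  proof (subst open_subopen, intro ballI)
    fix t assume t: "t \<in> {s. F s \<in> U}"
    have "openin (top_of_set {t - d<..<t + d}) {s \<in> topspace (top_of_set {t - d<..<t + d}). F s \<in> U}"
      by (rule openin_continuous_map_preimage[OF near U])
    then have "open {s \<in> {t - d<..<t + d}. F s \<in> U}" by (simp add: openin_open_eq)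
    then show "\<exists>V. open V \<and> t \<in> V \<and> V \<subseteq> {s. F s \<in> U}"
      using t d by (intro exI[of _ "{s \<in> {t - d<..<t + d}. F s \<in> U}"]) auto
  qed
  then show ?thesis using Fc topT by (auto simp: continuous_map_def)
qed

theorem theorem1p1:
  fixes T :: "(real \<Rightarrow> real) topology" and F :: "real \<Rightarrow> real \<Rightarrow> real"
  assumes "topological_group IET_group T"
    and "\<And>n \<pi>. 1 \<le> n \<Longrightarrow> unpartitioned n \<pi> \<Longrightarrow>
      continuous_map (subtopology (powertop_real {1..n}) (Lambda_closed n)) T (interval_exchange n \<pi>)"
    and "\<And>n \<pi>. 1 \<le> n \<Longrightarrow> unpartitioned n \<pi> \<Longrightarrow>
      embedding_map (subtopology (powertop_real {1..n}) (Lambda n)) T (interval_exchange n \<pi>)"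
    and "F \<in> hom real_group IET_group"
  shows "continuous_map euclideanreal T F \<longleftrightarrow> rotation_action F"
proof
  interpret iet_flow F by (unfold_locales) (rule assms(4))
  assume cont: "continuous_map euclideanreal T F"
  have haus: "Hausdorff_space T"
    using assms(1) by (rule Hausdorff_space_IET) (intro assms(3) unpartitioned_transpose, simp)
  show "rotation_action F"
  proof (rule local_coordinates[OF haus assms(2,3) cont F_IET])
    fix n \<pi> L t0 d
    assume n: "1 \<le> n" "unpartitioned n \<pi>" and d: "0 < (d::real)"
      and L: "\<And>t. \<bar>t - t0\<bar> < d \<Longrightarrow> L t \<in> Lambda n \<and> F t = interval_exchange n \<pi> (L t)"
      and c: "\<And>i. i \<in> {1..n} \<Longrightarrow> continuous_on {t0 - d<..<t0 + d} (\<lambda>t. L t i)"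
    obtain l v where "piecewise_flow F n l v"
      using piecewise_flow_of_coordinates[OF n d conjunct1[OF L] conjunct2[OF L] c] .
    then show ?thesis by (rule piecewise_flow.rotation_action)
  qed
next
  interpret iet_flow F by (unfold_locales) (rule assms(4))
  interpret G: group IET_group by (rule group_IET_group)
  have topT: "topspace T = carrier IET_group" using assms(1) by (simp add: topological_group_def)
  assume "rotation_action F"
  then obtain n l a h where n: "1 \<le> n" "l \<in> Lambda n" and h: "h \<in> IET"
    and F: "\<And>t. F t = h \<otimes>\<^bsub>IET_group\<^esub> torus_exchange n (torus_class n (\<lambda>j. t * a j)) l
                     \<otimes>\<^bsub>IET_group\<^esub> inv\<^bsub>IET_group\<^esub> h"
    unfolding rotation_action_def by metis
  have hc: "h \<in> carrier IET_group" using h by (simp add: carrier_IET_group)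
  have n2: "1 \<le> 2 * n" using n by simp
  obtain d where d: "0 < d"
    "continuous_map (top_of_set {0..<d}) T (\<lambda>t. torus_exchange n (torus_class n (\<lambda>j. t * a j)) l)"
    using continuous_map_torus_exchange[OF n assms(2)[OF n2 unpartitioned_pair_swap]] by metis
  \<comment> \<open>Multiplication by \<open>h\<close> and its inverse is continuous, so the right
    germ of the torus action passes to \<open>F\<close>.\<close>
  have "continuous_map (top_of_set {0..<d}) T F"
    unfolding F[abs_def] using hc topT
    by (intro topological_group_mult[OF assms(1)] topological_group_inv[OF assms(1)] d) auto
  then show "continuous_map euclideanreal T F" by (rule continuous_of_right_germ[OF assms(1) d(1)])
qed

end
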